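(* Let $M$ be a smooth paracompact manifold of dimension $n\ge 3$. The projective class of a reversible spray on $T^\circ M$ is the geodesic class of a globally-defined absolutely-homogeneous Finsler function on $T^\circ M$ if and only if there is a smooth type $(0,2)$ tensor field $h$ along $\tau:T^\circ M\to M$ which is positive quasi-definite and whose components $h_{ij}$ in every canonical coordinate system $(x^i,y^i)$ satisfy $$h_{ji}=h_{ij},\quad h_{ij}y^j=0,\quad \frac{\partial h_{ij}}{\partial y^k}=\frac{\partial h_{ik}}{\partial y^j},\quad (\nabla h)_{ij}=0,\quad h_{ik}W^k_j=h_{jk}W^k_i,$$ where $\nabla$ is the dynamical covariant derivative of any spray in the class and $W^i_j$ is the Weyl curvature of the class.
   Context: Summation over repeated indices is understood; all objects are smooth. $T^\circ M$ is the slit tangent bundle ($TM$ with the zero section removed), $\tau:T^\circ M\to M$ the projection. A tensor field of type $(0,2)$ along $\tau$ has components $h_{ij}(x,y)$ which are functions on $T^\circ M$ and which transform under changes of coordinates $(x^i)$ like the components of a type $(0,2)$ tensor on $M$. $\Delta=y^i\,\partial/\partial y^i$. A spray is a vector field $\Gamma$ on $T^\circ M$ with $\tau_*\Gamma_{(x,y)}=y$ and $[\Delta,\Gamma]=\Gamma$; in coordinates $\Gamma=y^i\frac{\partial}{\partial x^i}-2\Gamma^i\frac{\partial}{\partial y^i}$. Put $\Gamma^i_j=\partial\Gamma^i/\partial y^j$, $V_i=\partial/\partial y^i$, $H_i=\frac{\partial}{\partial x^i}-\Gamma^j_i\frac{\partial}{\partial y^j}$. Two sprays are projectively equivalent if $\tilde\Gamma=\Gamma-2P\Delta$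 for some function $P$ on $T^\circ M$ with $\Delta(P)=P$; a projective class is an equivalence class under this relation. Let $\rho:T^\circ M\to T^\circ M$, $\rho(x,y)=(x,-y)$. The reverse of a spray $\Gamma$ is the spray $\bar\Gamma=-\rho_*\Gamma$, and $\Gamma$ is reversible if it is projectively equivalent to its reverse. Dynamical covariant derivative: $(\nabla h)_{ij}=\Gamma(h_{ij})-\Gamma_i^kh_{kj}-\Gamma_j^kh_{ik}$ (for $h$ satisfying the first three conditions it is the same for all sprays in the class). The Riemann curvature components $R^j_i$ are defined by $[\Gamma,H_i]=\Gamma^j_iH_j+R^j_iV_j$, and the Weyl curvature, which is projectively invariant, is $W^i_j=R^i_j-R\,\delta^i_j-\rho_jy^i$ with $R=\frac{1}{n-1}R^k_k$, $\rho_j=\frac{1}{n+1}\left(\frac{\partial R^k_j}{\partial y^k}-\frac{\partial R}{\partial y^j}\right)$. A function $F$ is positively homogeneous if $F(x,ky)=kF(x,y)$ for all $k>0$, and absolutely homogeneous if $F(x,ky)=|k|F(x,y)$ for all real $k\ne0$. A Finsler function is a smooth function $F$ on $T^\circ M$ which is positive, positively homogeneous, and strongly convex, i.e. $F\frac{\partial^2F}{\partial y^i\partial y^j}+\frac{\partial F}{\partial y^i}\frac{\partial F}{\partial y^j}$ is positive definite. The tensor $h$ is positive quasi-definite if at every $(x,y)$, $h_{ij}(x,y)v^iv^j\ge0$ for all $v$, with equality only if $v$ is a scalar multiple of $y$. The geodesic class of a Finsler function $F$ is the projective class of sprays consisting of the sprays $\Gamma$ satisfying the Euler-Lagrange equations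 $\Gamma\left(\frac{\partial F}{\partial y^i}\right)-\frac{\partial F}{\partial x^i}=0$. *)

theory Defs
  imports "HOL-Analysis.Analysis"
begin

section \<open>Smooth maps between open sets of normed spaces\<close>

primrec k_smooth_on ::
    "nat \<Rightarrow> 'a::real_normed_vector set \<Rightarrow> ('a \<Rightarrow> 'b::real_normed_vector) \<Rightarrow> bool" where
  "k_smooth_on 0 S f \<longleftrightarrow> continuous_on S f"
| "k_smooth_on (Suc k) S f \<longleftrightarrow> (\<forall>x\<in>S. f differentiable (at x)) \<and>
     (\<forall>v. k_smooth_on k S (\<lambda>x. frechet_derivative f (at x) v))"

definition smooth_on ::
    "'a::real_normed_vector set \<Rightarrow> ('a \<Rightarrow> 'b::real_normed_vector) \<Rightarrow> bool" where
  "smooth_on S f \<longleftrightarrow> (\<forall>k. k_smooth_on k S f)"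

section \<open>Manifolds\<close>

text \<open>
  A chart is a domain together with a coordinate map, whose values outside the domain are
  irrelevant.  A smooth structure is a maximal set of pairwise compatible charts.
\<close>

type_synonym ('m, 'e) chart = "'m set \<times> ('m \<Rightarrow> 'e)"

abbreviation dom_chart :: "('m, 'e) chart \<Rightarrow> 'm set" where
  "dom_chart c \<equiv> fst c"

abbreviation coord :: "('m, 'e) chart \<Rightarrow> 'm \<Rightarrow> 'e" where
  "coord c \<equiv> snd c"

definition coord_range :: "('m, 'e) chart \<Rightarrow> 'e set" where
  "coord_range c = coord c ` dom_chart c"

definition coord_inv :: "('m, 'e) chart \<Rightarrow> 'e \<Rightarrow> 'm" where
  "coord_inv c = inv_into (dom_chart c) (coord c)"

definition carrier_of :: "('m, 'e) chart set \<Rightarrow> 'm set" where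
  "carrier_of A = \<Union>(dom_chart ` A)"

definition charts_at :: "('m, 'e) chart set \<Rightarrow> 'm \<Rightarrow> ('m, 'e) chart set" where
  "charts_at A p = {c \<in> A. p \<in> dom_chart c}"

definition chart_on :: "'m topology \<Rightarrow> ('m, 'e::euclidean_space) chart \<Rightarrow> bool" where
  "chart_on X c \<longleftrightarrow> openin X (dom_chart c) \<and> open (coord_range c) \<and>
     homeomorphic_map (subtopology X (dom_chart c)) (top_of_set (coord_range c)) (coord c)"

definition compatible ::
    "('m, 'e::euclidean_space) chart \<Rightarrow> ('m, 'e) chart \<Rightarrow> bool" where
  "compatible c d \<longleftrightarrow>
     smooth_on (coord c ` (dom_chart c \<inter> dom_chart d)) (coord d \<circ> coord_inv c) \<and>
     smooth_on (coord d ` (dom_chart c \<inter> dom_chart d)) (coord c \<circ> coord_inv d)"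

definition smooth_manifold :: "'m topology \<Rightarrow> ('m, 'e::euclidean_space) chart set \<Rightarrow> bool" where
  "smooth_manifold X A \<longleftrightarrow>
     Hausdorff_space X \<and>
     carrier_of A = topspace X \<and>
     (\<forall>c\<in>A. chart_on X c) \<and>
     (\<forall>c\<in>A. \<forall>d\<in>A. compatible c d) \<and>
     (\<forall>c. chart_on X c \<and> (\<forall>d\<in>A. compatible c d) \<longrightarrow> c \<in> A)"

definition paracompact_space :: "'m topology \<Rightarrow> bool" where
  "paracompact_space X \<longleftrightarrow>
     (\<forall>\<U>. (\<forall>U\<in>\<U>. openin X U) \<and> \<Union>\<U> = topspace X \<longrightarrow>
       (\<exists>\<V>. (\<forall>V\<in>\<V>. openin X V) \<and> \<Union>\<V> = topspace X \<and>
            (\<forall>V\<in>\<V>. \<exists>U\<in>\<U>. V \<subseteq> U) \<and> locally_finite_in X \<V>))"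

text \<open>
  A tangent vector at \<open>p\<close> is the family of its components with respect to all charts around
  \<open>p\<close>, related by the Jacobians of the coordinate changes.  The value 0 at all other charts
  makes the family unique.
\<close>

definition tangent_space ::
    "('m, 'e::euclidean_space) chart set \<Rightarrow> 'm \<Rightarrow> (('m, 'e) chart \<Rightarrow> 'e) set" where
  "tangent_space A p = {v.
     (\<forall>c\<in>charts_at A p. \<forall>d\<in>charts_at A p.
        v d = frechet_derivative (coord d \<circ> coord_inv c) (at (coord c p)) (v c)) \<and>
     (\<forall>c. c \<notin> charts_at A p \<longrightarrow> v c = 0)}"

text \<open>
  In the next two definitions the result does not depend on the chart chosen by \<open>SOME\<close>.
\<close>

definition tangent_map ::
    "('m, 'e::euclidean_space) chart set \<Rightarrow> ('k, 'f::euclidean_space) chart set \<Rightarrow> ('m \<Rightarrow> 'k) \<Rightarrow>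
     'm \<Rightarrow> (('m, 'e) chart \<Rightarrow> 'e) \<Rightarrow> ('k, 'f) chart \<Rightarrow> 'f" where
  "tangent_map A B f p v = (\<lambda>d. if d \<in> charts_at B (f p) then
     (let c = SOME c. c \<in> charts_at A p in
        frechet_derivative (coord d \<circ> f \<circ> coord_inv c) (at (coord c p)) (v c)) else 0)"

definition apply_field ::
    "('m, 'e::euclidean_space) chart set \<Rightarrow> ('m \<Rightarrow> ('m, 'e) chart \<Rightarrow> 'e) \<Rightarrow> ('m \<Rightarrow> real) \<Rightarrow>
     'm \<Rightarrow> real" where
  "apply_field A X f p = (let c = SOME c. c \<in> charts_at A p in
     frechet_derivative (f \<circ> coord_inv c) (at (coord c p)) (X p c))"

definition smooth_fun :: "('m, 'e::euclidean_space) chart set \<Rightarrow> ('m \<Rightarrow> real) \<Rightarrow> bool" where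
  "smooth_fun A f \<longleftrightarrow> (\<forall>c\<in>A. smooth_on (coord_range c) (f \<circ> coord_inv c))"

definition field_rep ::
    "('m, 'e) chart \<Rightarrow> ('m \<Rightarrow> ('m, 'e) chart \<Rightarrow> 'e) \<Rightarrow> 'e \<Rightarrow> 'e" where
  "field_rep c X z = X (coord_inv c z) c"

definition smooth_field ::
    "('m, 'e::euclidean_space) chart set \<Rightarrow> ('m \<Rightarrow> ('m, 'e) chart \<Rightarrow> 'e) \<Rightarrow> bool" where
  "smooth_field A X \<longleftrightarrow> (\<forall>p\<in>carrier_of A. X p \<in> tangent_space A p) \<and>
     (\<forall>c\<in>A. smooth_on (coord_range c) (field_rep c X))"

definition coord_bracket ::
    "('e::real_normed_vector \<Rightarrow> 'e) \<Rightarrow> ('e \<Rightarrow> 'e) \<Rightarrow> 'e \<Rightarrow> 'e" where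
  "coord_bracket X Y z =
     frechet_derivative Y (at z) (X z) - frechet_derivative X (at z) (Y z)"

definition lie_bracket ::
    "('m, 'e::euclidean_space) chart set \<Rightarrow> ('m \<Rightarrow> ('m, 'e) chart \<Rightarrow> 'e) \<Rightarrow>
     ('m \<Rightarrow> ('m, 'e) chart \<Rightarrow> 'e) \<Rightarrow> 'm \<Rightarrow> ('m, 'e) chart \<Rightarrow> 'e" where
  "lie_bracket A X Y p = (\<lambda>c. if c \<in> charts_at A p then
     coord_bracket (field_rep c X) (field_rep c Y) (coord c p) else 0)"

section \<open>The slit tangent bundle\<close>

type_synonym ('m, 'n) tm = "'m \<times> (('m, real^'n) chart \<Rightarrow> real^'n)"

type_synonym ('m, 'n) tm_chart = "(('m, 'n) tm, (real^'n) \<times> (real^'n)) chart"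

type_synonym ('m, 'n) tm_field =
  "('m, 'n) tm \<Rightarrow> ('m, 'n) tm_chart \<Rightarrow> (real^'n) \<times> (real^'n)"

definition slit :: "('m, real^'n) chart set \<Rightarrow> ('m, 'n::finite) tm set" where
  "slit A = {(p, v). p \<in> carrier_of A \<and> v \<in> tangent_space A p \<and> v \<noteq> (\<lambda>_. 0)}"

text \<open>The canonical coordinates \<open>(x\<^sup>i, y\<^sup>i)\<close> on the part of the slit tangent bundle over a chart.\<close>

definition canonical ::
    "('m, real^'n) chart set \<Rightarrow> ('m, real^'n) chart \<Rightarrow> ('m, 'n::finite) tm_chart" where
  "canonical A c = ({w \<in> slit A. fst w \<in> dom_chart c}, \<lambda>w. (coord c (fst w), snd w c))"

definition slit_charts :: "('m, real^'n) chart set \<Rightarrow> ('m, 'n::finite) tm_chart set" where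
  "slit_charts A = canonical A ` A"

definition scale_tm :: "real \<Rightarrow> ('m, 'n::finite) tm \<Rightarrow> ('m, 'n) tm" where
  "scale_tm k w = (fst w, \<lambda>c. k *\<^sub>R snd w c)"

text \<open>In the coordinates \<open>b = (x\<^sup>i, y\<^sup>i)\<close>, the field \<open>\<Delta>\<close> has components \<open>(0, y\<^sup>i)\<close>.\<close>

definition liouville :: "('m, real^'n) chart set \<Rightarrow> ('m, 'n::finite) tm_field" where
  "liouville A w = (\<lambda>b. if b \<in> charts_at (slit_charts A) w then (0, snd (coord b w)) else 0)"

definition spray :: "('m, real^'n) chart set \<Rightarrow> ('m, 'n::finite) tm_field \<Rightarrow> bool" where
  "spray A \<Gamma> \<longleftrightarrow> smooth_field (slit_charts A) \<Gamma> \<and>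
     (\<forall>w\<in>slit A. tangent_map (slit_charts A) A fst w (\<Gamma> w) = snd w) \<and>
     (\<forall>w\<in>slit A. lie_bracket (slit_charts A) (liouville A) \<Gamma> w = \<Gamma> w)"

definition projectively_equivalent ::
    "('m, real^'n) chart set \<Rightarrow> ('m, 'n::finite) tm_field \<Rightarrow> ('m, 'n) tm_field \<Rightarrow> bool" where
  "projectively_equivalent A \<Gamma> \<Gamma>' \<longleftrightarrow> (\<exists>P. smooth_fun (slit_charts A) P \<and>
     (\<forall>w\<in>slit A. apply_field (slit_charts A) (liouville A) P w = P w) \<and>
     (\<forall>w\<in>slit A. \<forall>b. \<Gamma>' w b = \<Gamma> w b - (2 * P w) *\<^sub>R liouville A w b))"

definition projective_class ::
    "('m, real^'n) chart set \<Rightarrow> ('m, 'n::finite) tm_field \<Rightarrow> ('m, 'n) tm_field set" where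
  "projective_class A \<Gamma> = {\<Gamma>'. spray A \<Gamma>' \<and> projectively_equivalent A \<Gamma> \<Gamma>'}"

definition reflect :: "('m, 'n::finite) tm \<Rightarrow> ('m, 'n) tm" where
  "reflect w = scale_tm (- 1) w"

text \<open>
  Since \<open>reflect\<close> is an involution, the push-forward of \<open>\<Gamma>\<close> at \<open>w\<close> is the image of
  \<open>\<Gamma> (reflect w)\<close>.
\<close>

definition reverse_spray ::
    "('m, real^'n) chart set \<Rightarrow> ('m, 'n::finite) tm_field \<Rightarrow> ('m, 'n) tm_field" where
  "reverse_spray A \<Gamma> w = (\<lambda>b. - tangent_map (slit_charts A) (slit_charts A) reflect
     (reflect w) (\<Gamma> (reflect w)) b)"

definition reversible :: "('m, real^'n) chart set \<Rightarrow> ('m, 'n::finite) tm_field \<Rightarrow> bool" where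
  "reversible A \<Gamma> \<longleftrightarrow> projectively_equivalent A \<Gamma> (reverse_spray A \<Gamma>)"

section \<open>Coordinate formulas\<close>

text \<open>
  Here \<open>z = (x, y)\<close> is a point in the range of a canonical chart and \<open>S\<close> is the coordinate
  representation \<open>S z = (y, - 2 \<Gamma>\<^sup>i)\<close> of a spray.  The upper index always comes first.
\<close>

definition d_x :: "'n::finite \<Rightarrow> ((real^'n) \<times> (real^'n) \<Rightarrow> real) \<Rightarrow> (real^'n) \<times> (real^'n) \<Rightarrow> real" where
  "d_x i f z = frechet_derivative f (at z) (axis i 1, 0)"

definition d_y :: "'n::finite \<Rightarrow> ((real^'n) \<times> (real^'n) \<Rightarrow> real) \<Rightarrow> (real^'n) \<times> (real^'n) \<Rightarrow> real" where
  "d_y i f z = frechet_derivative f (at z) (0, axis i 1)"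

definition spray_coeff ::
    "((real^'n) \<times> (real^'n) \<Rightarrow> (real^'n) \<times> (real^'n)) \<Rightarrow> 'n::finite \<Rightarrow> (real^'n) \<times> (real^'n) \<Rightarrow> real" where
  "spray_coeff S i z = - (snd (S z) $ i) / 2"

definition conn_coeff ::
    "((real^'n) \<times> (real^'n) \<Rightarrow> (real^'n) \<times> (real^'n)) \<Rightarrow> 'n::finite \<Rightarrow> 'n \<Rightarrow> (real^'n) \<times> (real^'n) \<Rightarrow> real" where
  "conn_coeff S i j z = d_y j (spray_coeff S i) z"

definition horizontal ::
    "((real^'n) \<times> (real^'n) \<Rightarrow> (real^'n) \<times> (real^'n)) \<Rightarrow> 'n::finite \<Rightarrow>
     (real^'n) \<times> (real^'n) \<Rightarrow> (real^'n) \<times> (real^'n)" where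
  "horizontal S i z = (axis i 1, - (\<chi> j. conn_coeff S j i z))"

definition vertical :: "'n::finite \<Rightarrow> (real^'n) \<times> (real^'n) \<Rightarrow> (real^'n) \<times> (real^'n)" where
  "vertical i z = (0, axis i 1)"

text \<open>
  \<open>R\<^sup>j\<^sub>i\<close> is the \<open>V\<^sub>j\<close> component of \<open>[\<Gamma>, H\<^sub>i] - \<Gamma>\<^sup>k\<^sub>i H\<^sub>k\<close>, which is vertical;
  see \<open>riemann_eq\<close> below.
\<close>

definition riemann ::
    "((real^'n) \<times> (real^'n) \<Rightarrow> (real^'n) \<times> (real^'n)) \<Rightarrow> 'n::finite \<Rightarrow> 'n \<Rightarrow> (real^'n) \<times> (real^'n) \<Rightarrow> real" where
  "riemann S j i z = snd (coord_bracket S (horizontal S i) z -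
     (\<Sum>k\<in>UNIV. conn_coeff S k i z *\<^sub>R horizontal S k z)) $ j"

lemma riemann_eq:
  fixes S :: "(real^'n) \<times> (real^'n) \<Rightarrow> (real^'n) \<times> (real^'n::finite)"
  assumes S: "S differentiable (at z)"
    and H: "horizontal S i differentiable (at z)"
    and nbhd: "open U" "z \<in> U" "\<And>u. u \<in> U \<Longrightarrow> fst (S u) = snd u"
  shows "coord_bracket S (horizontal S i) z =
    (\<Sum>j\<in>UNIV. conn_coeff S j i z *\<^sub>R horizontal S j z) +
    (\<Sum>j\<in>UNIV. riemann S j i z *\<^sub>R vertical j z)"
proof -
  define B where "B = coord_bracket S (horizontal S i) z"
  let ?C = "\<Sum>k\<in>UNIV. conn_coeff S k i z *\<^sub>R horizontal S k z"
  have expand: "(\<Sum>j\<in>UNIV. f j *\<^sub>R axis j 1) = (\<chi> j. f j)" for f :: "'n \<Rightarrow> real"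
    by (simp add: vec_eq_iff axis_def if_distrib if_distribR cong: if_cong)
  have DS: "(S has_derivative frechet_derivative S (at z)) (at z)"
    and DH: "(horizontal S i has_derivative frechet_derivative (horizontal S i) (at z)) (at z)"
    using S H by (simp_all add: frechet_derivative_works)
  have "((\<lambda>u. fst (horizontal S i u)) has_derivative
      (\<lambda>v. fst (frechet_derivative (horizontal S i) (at z) v))) (at z)"
    by (rule has_derivative_fst[OF DH])
  moreover have "((\<lambda>u. fst (horizontal S i u)) has_derivative (\<lambda>v. 0)) (at z)"
    by (simp add: horizontal_def)
  ultimately have fH: "fst (frechet_derivative (horizontal S i) (at z) v) = 0" for v
    using has_derivative_unique by (metis (mono_tags, lifting))
  have "((\<lambda>u. fst (S u)) has_derivative (\<lambda>v. fst (frechet_derivative S (at z) v))) (at z)"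
    by (rule has_derivative_fst[OF DS])
  moreover have "((\<lambda>u. fst (S u)) has_derivative snd) (at z)"
    by (rule has_derivative_transform_within_open[OF _ nbhd(1,2), where f = snd])
      (auto simp: nbhd(3) intro!: bounded_linear_imp_has_derivative bounded_linear_snd)
  ultimately have fS: "fst (frechet_derivative S (at z) v) = snd v" for v
    using has_derivative_unique by (metis (mono_tags, lifting))
  have "fst B = (\<chi> j. conn_coeff S j i z)"
    by (simp add: B_def coord_bracket_def fH fS) (simp add: horizontal_def)
  also have "\<dots> = fst ?C"
    by (simp add: fst_sum horizontal_def expand)
  finally have 1: "fst B = fst ?C" .
  have 2: "snd (\<Sum>j\<in>UNIV. riemann S j i z *\<^sub>R vertical j z) = snd B - snd ?C"
    by (simp add: snd_sum vertical_def expand vec_eq_iff riemann_def B_def)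
  have "fst (\<Sum>j\<in>UNIV. riemann S j i z *\<^sub>R vertical j z) = 0"
    by (simp add: fst_sum vertical_def)
  with 1 2 show ?thesis
    unfolding B_def[symmetric] by (intro prod_eqI) simp_all
qed

definition riemann_scalar ::
    "((real^'n) \<times> (real^'n) \<Rightarrow> (real^'n) \<times> (real^'n::finite)) \<Rightarrow> (real^'n) \<times> (real^'n) \<Rightarrow> real" where
  "riemann_scalar S z = (\<Sum>k\<in>UNIV. riemann S k k z) / (real CARD('n) - 1)"

definition weyl_rho ::
    "((real^'n) \<times> (real^'n) \<Rightarrow> (real^'n) \<times> (real^'n)) \<Rightarrow> 'n::finite \<Rightarrow> (real^'n) \<times> (real^'n) \<Rightarrow> real" where
  "weyl_rho S j z =
     ((\<Sum>k\<in>UNIV. d_y k (riemann S k j) z) - d_y j (riemann_scalar S) z) / (real CARD('n) + 1)"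

definition weyl ::
    "((real^'n) \<times> (real^'n) \<Rightarrow> (real^'n) \<times> (real^'n)) \<Rightarrow> 'n::finite \<Rightarrow> 'n \<Rightarrow> (real^'n) \<times> (real^'n) \<Rightarrow> real" where
  "weyl S i j z = riemann S i j z - (if i = j then riemann_scalar S z else 0) -
     weyl_rho S j z * snd z $ i"

definition dyn_cov_deriv ::
    "((real^'n) \<times> (real^'n) \<Rightarrow> (real^'n) \<times> (real^'n)) \<Rightarrow>
     ('n::finite \<Rightarrow> 'n \<Rightarrow> (real^'n) \<times> (real^'n) \<Rightarrow> real) \<Rightarrow> 'n \<Rightarrow> 'n \<Rightarrow> (real^'n) \<times> (real^'n) \<Rightarrow> real" where
  "dyn_cov_deriv S h i j z = frechet_derivative (h i j) (at z) (S z) -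
     (\<Sum>k\<in>UNIV. conn_coeff S k i z * h k j z) - (\<Sum>k\<in>UNIV. conn_coeff S k j z * h i k z)"

section \<open>Tensor fields along the projection\<close>

text \<open>
  A tensor field of type \<open>(0,2)\<close> along the projection assigns to a point of the slit tangent
  bundle and a chart around its base point a matrix of components.
\<close>

type_synonym ('m, 'n) tensor02 = "('m, 'n) tm \<Rightarrow> ('m, real^'n) chart \<Rightarrow> real^'n^'n"

definition tensor_comp ::
    "('m, real^'n) chart set \<Rightarrow> ('m, real^'n) chart \<Rightarrow> ('m, 'n) tensor02 \<Rightarrow>
     'n::finite \<Rightarrow> 'n \<Rightarrow> (real^'n) \<times> (real^'n) \<Rightarrow> real" where
  "tensor_comp A c h i j z = h (coord_inv (canonical A c) z) c $ i $ j"

definition smooth_tensor02 ::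
    "('m, real^'n) chart set \<Rightarrow> ('m, 'n::finite) tensor02 \<Rightarrow> bool" where
  "smooth_tensor02 A h \<longleftrightarrow>
     (\<forall>w\<in>slit A. \<forall>c\<in>charts_at A (fst w). \<forall>d\<in>charts_at A (fst w).
        let J = frechet_derivative (coord d \<circ> coord_inv c) (at (coord c (fst w))) in
        \<forall>i j. h w c $ i $ j =
          (\<Sum>k\<in>UNIV. \<Sum>l\<in>UNIV. h w d $ k $ l * J (axis i 1) $ k * J (axis j 1) $ l)) \<and>
     (\<forall>c\<in>A. \<forall>i j. smooth_on (coord_range (canonical A c)) (tensor_comp A c h i j))"

definition positive_quasi_definite ::
    "('m, real^'n) chart set \<Rightarrow> ('m, 'n::finite) tensor02 \<Rightarrow> bool" where
  "positive_quasi_definite A h \<longleftrightarrow>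
     (\<forall>c\<in>A. \<forall>z\<in>coord_range (canonical A c). \<forall>v :: real^'n.
        let q = (\<Sum>i\<in>UNIV. \<Sum>j\<in>UNIV. tensor_comp A c h i j z * v $ i * v $ j) in
        q \<ge> 0 \<and> (q = 0 \<longrightarrow> (\<exists>a. v = a *\<^sub>R snd z)))"

section \<open>Finsler functions\<close>

definition positively_homogeneous ::
    "('m, real^'n) chart set \<Rightarrow> (('m, 'n::finite) tm \<Rightarrow> real) \<Rightarrow> bool" where
  "positively_homogeneous A F \<longleftrightarrow> (\<forall>w\<in>slit A. \<forall>k>0. F (scale_tm k w) = k * F w)"

definition absolutely_homogeneous ::
    "('m, real^'n) chart set \<Rightarrow> (('m, 'n::finite) tm \<Rightarrow> real) \<Rightarrow> bool" where
  "absolutely_homogeneous A F \<longleftrightarrow> (\<forall>w\<in>slit A. \<forall>k. k \<noteq> 0 \<longrightarrow> F (scale_tm k w) = \<bar>k\<bar> * F w)"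

definition strongly_convex ::
    "('m, real^'n) chart set \<Rightarrow> (('m, 'n::finite) tm \<Rightarrow> real) \<Rightarrow> bool" where
  "strongly_convex A F \<longleftrightarrow> (\<forall>c\<in>A. \<forall>z\<in>coord_range (canonical A c). \<forall>v :: real^'n.
     let f = F \<circ> coord_inv (canonical A c) in
     v \<noteq> 0 \<longrightarrow>
       (\<Sum>i\<in>UNIV. \<Sum>j\<in>UNIV. (f z * d_y i (d_y j f) z + d_y i f z * d_y j f z) * v $ i * v $ j) > 0)"

definition finsler_function ::
    "('m, real^'n) chart set \<Rightarrow> (('m, 'n::finite) tm \<Rightarrow> real) \<Rightarrow> bool" where
  "finsler_function A F \<longleftrightarrow> smooth_fun (slit_charts A) F \<and> (\<forall>w\<in>slit A. F w > 0) \<and>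
     positively_homogeneous A F \<and> strongly_convex A F"

definition geodesic_class ::
    "('m, real^'n) chart set \<Rightarrow> (('m, 'n::finite) tm \<Rightarrow> real) \<Rightarrow> ('m, 'n) tm_field set" where
  "geodesic_class A F = {\<Gamma>. spray A \<Gamma> \<and>
     (\<forall>c\<in>A. \<forall>z\<in>coord_range (canonical A c). \<forall>i.
        let f = F \<circ> coord_inv (canonical A c); S = field_rep (canonical A c) \<Gamma> in
        frechet_derivative (d_y i f) (at z) (S z) - d_x i f z = 0)}"

end

theory Submission
  imports Defs
begin

text \<open>
  From a Finsler function to a multiplier: take the Hessian of \<open>F\<close> in the fibre directions.  Differentiating
  the Euler-Lagrange expressions \<open>E\<^sub>i\<close> along the fibres gives \<open>\<nabla>h = 0\<close> as the symmetric part and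
  \<open>H\<^sub>j V\<^sub>i F = H\<^sub>i V\<^sub>j F\<close> as the antisymmetric part.  Applying \<open>\<Gamma>\<close> to the latter and using the
  bracket \<open>[\<Gamma>, H\<^sub>i]\<close> yields the symmetry of \<open>h\<^sub>i\<^sub>k R\<^sup>k\<^sub>j\<close>, from which \<open>h\<^sub>i\<^sub>k W\<^sup>k\<^sub>j\<close> differs by
  symmetric terms only.

  Conversely, by reversibility the even part of a multiplier is again a multiplier, so let \<open>h\<close> be even.
  The 1-forms \<open>h\<^sub>i\<^sub>j dy\<^sup>j\<close> are closed on the fibres, and for \<open>n \<ge> 3\<close> they have unique odd primitives
  \<open>\<theta>\<^sub>i\<close>: the value at \<open>u\<close> is minus one half of the integral along any half circle from \<open>u\<close> to \<open>- u\<close>.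
  Then \<open>F = y\<^sup>i \<theta>\<^sub>i\<close> has fibre Hessian \<open>h\<close> and is absolutely homogeneous, and because it is given by an
  invariant integral it is globally defined.
  Finally \<open>\<nabla>h = 0\<close> makes \<open>E\<^sub>i\<close> linear on each fibre, with an antisymmetric coefficient matrix, whereas
  reversibility makes it even, so \<open>E\<^sub>i = 0\<close>.
\<close>

section \<open>Smooth maps\<close>

text \<open>The fibre Hessian fixes a function of degree 1 only up to a term a_i(x) y^i, and such a
  term can spoil both positivity and the Euler-Lagrange equations. A fibre-linear term is odd, so
  asking for an even function removes the whole ambiguity; this is why h is averaged over the
  reflection before anything is integrated. For even h the form h_ij dy^j changes sign under y ->
  -y, so the sum of the values of a primitive at u and at -u is constant on the fibre and can be
  normalised to zero. This fixes the primitive without a choice and makes the charts agree.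
  Integration along rays would give no information, since h_ij y^j = 0; half circles do, and along
  them the sign of the integrand yields F > 0. The dimension enters through the independence of the
  half circle: for n >= 3 there is a vector orthogonal to the plane of a given half circle, and any
  two half circles from u to -u can be deformed into each other by way of it.\<close>

abbreviation fderiv :: "('a::real_normed_vector \<Rightarrow> 'b::real_normed_vector) \<Rightarrow> 'a \<Rightarrow> 'a \<Rightarrow> 'b" where
  "fderiv f x \<equiv> frechet_derivative f (at x)"

lemma frechet_derivative_eqI: "(f has_derivative f') (at x) \<Longrightarrow> fderiv f x = f'"
  by (metis frechet_derivative_at)

lemma frechet_derivative_has: "f differentiable (at x) \<Longrightarrow> (f has_derivative fderiv f x) (at x)"
  by (simp add: frechet_derivative_works)

lemma frechet_derivative_cong_open:
  assumes "open S" "x \<in> S" "\<And>y. y \<in> S \<Longrightarrow> f y = g y"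
  shows "fderiv f x = fderiv g x"
  and "f differentiable (at x) \<longleftrightarrow> g differentiable (at x)"
proof -
  have "(f has_derivative D) (at x) \<longleftrightarrow> (g has_derivative D) (at x)" for D
    using assms has_derivative_transform_within_open[of f D x UNIV S g]
      has_derivative_transform_within_open[of g D x UNIV S f] by auto
  then show "fderiv f x = fderiv g x"
    and "f differentiable (at x) \<longleftrightarrow> g differentiable (at x)"
    unfolding frechet_derivative_def differentiable_def by simp_all
qed

text \<open>The successor step of the recursion does not mention continuity; differentiability
  supplies it at level 0, and the induction passes this on to all directional derivatives.\<close>

lemma k_smooth_on_SucD: "k_smooth_on (Suc k) S f \<Longrightarrow> k_smooth_on k S f"
proof (induction k arbitrary: f)
  case 0
  then show ?case
    by (auto intro!: continuous_at_imp_continuous_on differentiable_imp_continuous_within)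
next
  case (Suc k)
  then show ?case by (metis k_smooth_on.simps(2))
qed

lemma k_smooth_on_cong:
  assumes "open S" "\<And>x. x \<in> S \<Longrightarrow> f x = g x"
  shows "k_smooth_on k S f \<longleftrightarrow> k_smooth_on k S g"
  using assms(2)
proof (induction k arbitrary: f g)
  case 0
  then show ?case by (simp cong: continuous_on_cong)
next
  case (Suc k)
  have "fderiv f x = fderiv g x"
    "f differentiable (at x) \<longleftrightarrow> g differentiable (at x)" if "x \<in> S" for x
    using frechet_derivative_cong_open[OF assms(1) that, of f g] Suc.prems by auto
  then show ?case
    using Suc.IH[of "\<lambda>x. fderiv f x v" "\<lambda>x. fderiv g x v" for v]
    by simp
qed

lemma smooth_on_cong:
  assumes "open S" "\<And>x. x \<in> S \<Longrightarrow> f x = g x"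
  shows "smooth_on S f \<longleftrightarrow> smooth_on S g"
  unfolding smooth_on_def using k_smooth_on_cong[of S f g, OF assms] by blast

lemma k_smooth_on_locally:
  assumes "\<And>x. x \<in> S \<Longrightarrow> \<exists>T. open T \<and> x \<in> T \<and> k_smooth_on k T f"
  shows "k_smooth_on k S f"
  using assms
proof (induction k arbitrary: f)
  case 0
  show ?case unfolding k_smooth_on.simps
  proof (rule continuous_at_imp_continuous_on, rule ballI)
    fix x assume "x \<in> S"
    then obtain T where "open T" "x \<in> T" "continuous_on T f" using 0 by auto
    then show "isCont f x" using continuous_on_eq_continuous_at by blast
  qed
next
  case (Suc k)
  show ?case unfolding k_smooth_on.simps
  proof (intro conjI ballI allI)
    fix x assume "x \<in> S"
    then show "f differentiable (at x)" using Suc.prems by fastforce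
  next
    fix v show "k_smooth_on k S (\<lambda>x. fderiv f x v)"
      by (rule Suc.IH) (use Suc.prems in fastforce)
  qed
qed

lemma smooth_on_locally:
  assumes "\<And>x. x \<in> S \<Longrightarrow> \<exists>T. open T \<and> x \<in> T \<and> smooth_on T f"
  shows "smooth_on S f"
  unfolding smooth_on_def
proof (rule allI, rule k_smooth_on_locally)
  fix k x assume "x \<in> S"
  then show "\<exists>T. open T \<and> x \<in> T \<and> k_smooth_on k T f"
    using assms[of x] by (auto simp: smooth_on_def)
qed

lemma smooth_on_differentiable: "smooth_on S f \<Longrightarrow> x \<in> S \<Longrightarrow> f differentiable (at x)"
  unfolding smooth_on_def using k_smooth_on.simps(2) by blast

lemma smooth_on_linear: "smooth_on S f \<Longrightarrow> x \<in> S \<Longrightarrow> linear (fderiv f x)"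
  by (rule linear_frechet_derivative[OF smooth_on_differentiable])

lemma smooth_on_has_derivative:
  "smooth_on S f \<Longrightarrow> x \<in> S \<Longrightarrow> (f has_derivative fderiv f x) (at x)"
  by (rule frechet_derivative_has[OF smooth_on_differentiable])

lemma smooth_on_continuous_on: "smooth_on S f \<Longrightarrow> continuous_on S f"
  unfolding smooth_on_def by (metis k_smooth_on.simps(1))

lemma smooth_on_frechet: "smooth_on S f \<Longrightarrow> smooth_on S (\<lambda>x. fderiv f x v)"
  unfolding smooth_on_def by (metis k_smooth_on.simps(2))

section \<open>Closure properties of k times differentiable maps\<close>

lemma k_smooth_on_const: "k_smooth_on k S (\<lambda>x. c)"
  by (induction k arbitrary: c) auto

lemma k_smooth_on_bounded_linear:
  assumes "bounded_linear f" shows "k_smooth_on k S f"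
proof (cases k)
  case 0
  then show ?thesis using assms by (simp add: linear_continuous_on)
next
  case (Suc m)
  have "(f has_derivative f) (at x)" for x
    using assms by (rule bounded_linear_imp_has_derivative)
  then have "f differentiable (at x)" "fderiv f x = f" for x
    by (auto simp: differentiable_def frechet_derivative_eqI)
  then show ?thesis using Suc by (simp add: k_smooth_on_const)
qed

text \<open>\<open>fderiv\<close> agrees with an explicit derivative \<open>D\<close> only on
  \<open>S\<close>; openness of \<open>S\<close> ensures that all further derivatives depend on
  these values alone.\<close>

lemma k_smooth_on_SucI:
  assumes S: "open S" and D: "\<And>x. x \<in> S \<Longrightarrow> (f has_derivative D x) (at x)"
    and smooth: "\<And>v. k_smooth_on k S (\<lambda>x. D x v)"
  shows "k_smooth_on (Suc k) S f"
  unfolding k_smooth_on.simps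
proof (intro conjI ballI allI)
  fix v show "k_smooth_on k S (\<lambda>x. fderiv f x v)"
    by (subst k_smooth_on_cong[OF S]) (use frechet_derivative_eqI[OF D] smooth in auto)
qed (use D differentiable_def in blast)

lemma k_smooth_on_add:
  assumes "open S" "k_smooth_on k S f" "k_smooth_on k S g"
  shows "k_smooth_on k S (\<lambda>x. f x + g x)"
  using assms(2-)
proof (induction k arbitrary: f g)
  case 0 then show ?case by (auto intro: continuous_intros)
next
  case (Suc k)
  have D: "((\<lambda>x. f x + g x) has_derivative
      (\<lambda>v. fderiv f x v + fderiv g x v)) (at x)" if "x \<in> S" for x
    using Suc.prems that by (auto intro!: has_derivative_add frechet_derivative_has)
  show ?case
  proof (rule k_smooth_on_SucI[OF assms(1) D])
    fix v
    show "k_smooth_on k S (\<lambda>x. fderiv f x v + fderiv g x v)"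
      using Suc by auto
  qed
qed

lemma k_smooth_on_compose_bounded_linear:
  assumes "open S" "bounded_linear L" "k_smooth_on k S f"
  shows "k_smooth_on k S (\<lambda>x. L (f x))"
  using assms(3)
proof (induction k arbitrary: f)
  case 0 then show ?case using assms(2) by (auto intro: bounded_linear.continuous_on)
next
  case (Suc k)
  have D: "((\<lambda>x. L (f x)) has_derivative (\<lambda>v. L (fderiv f x v))) (at x)" if "x \<in> S" for x
    using Suc.prems that by (auto intro!: bounded_linear.has_derivative[OF assms(2)] frechet_derivative_has)
  show ?case
  proof (rule k_smooth_on_SucI[OF assms(1) D])
    fix v
    show "k_smooth_on k S (\<lambda>x. L (fderiv f x v))"
      using Suc by auto
  qed
qed

lemma k_smooth_on_bilinear:
  assumes "open S" "bounded_bilinear B" "k_smooth_on k S f" "k_smooth_on k S g"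
  shows "k_smooth_on k S (\<lambda>x. B (f x) (g x))"
  using assms(3-)
proof (induction k arbitrary: f g)
  case 0 then show ?case using assms(2) by (auto intro: bounded_bilinear.continuous_on)
next
  case (Suc k)
  have D: "((\<lambda>x. B (f x) (g x)) has_derivative
      (\<lambda>v. B (f x) (fderiv g x v) + B (fderiv f x v) (g x))) (at x)" if "x \<in> S" for x
    using Suc.prems that by (auto intro!: bounded_bilinear.FDERIV[OF assms(2)] frechet_derivative_has)
  show ?case
  proof (rule k_smooth_on_SucI[OF assms(1) D])
    fix v
    show "k_smooth_on k S (\<lambda>x. B (f x) (fderiv g x v) + B (fderiv f x v) (g x))"
      using Suc.prems k_smooth_on_SucD[OF Suc.prems(1)] k_smooth_on_SucD[OF Suc.prems(2)]
      by (intro k_smooth_on_add assms(1) Suc.IH) auto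
  qed
qed

lemma k_smooth_on_sum:
  assumes "open S" "\<And>i. i \<in> I \<Longrightarrow> k_smooth_on k S (f i)"
  shows "k_smooth_on k S (\<lambda>x. \<Sum>i\<in>I. f i x)"
  using assms(2)
  by (induction I rule: infinite_finite_induct) (simp_all add: k_smooth_on_const k_smooth_on_add[OF assms(1)])

lemma linear_expand_Basis:
  fixes L :: "'a::euclidean_space \<Rightarrow> 'b::real_vector"
  assumes "linear L"
  shows "L v = (\<Sum>b\<in>Basis. (v \<bullet> b) *\<^sub>R L b)"
proof -
  have "L v = L (\<Sum>b\<in>Basis. (v \<bullet> b) *\<^sub>R b)" by (simp add: euclidean_representation)
  also have "\<dots> = (\<Sum>b\<in>Basis. (v \<bullet> b) *\<^sub>R L b)"
    by (simp add: linear_sum[OF assms] linear_scale[OF assms])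
  finally show ?thesis .
qed

text \<open>In the chain rule both the base point and the direction of \<open>fderiv g\<close> vary
  with x. Expanding the direction in the basis leaves fixed directions, to which the induction
  hypothesis applies, multiplied by smooth coefficients; hence the Euclidean space in the
  middle.\<close>

lemma k_smooth_on_compose:
  fixes f :: "'a::real_normed_vector \<Rightarrow> 'b::euclidean_space" and g :: "'b \<Rightarrow> 'c::real_normed_vector"
  assumes "open S" "k_smooth_on k S f" "k_smooth_on k T g" "f ` S \<subseteq> T"
  shows "k_smooth_on k S (\<lambda>x. g (f x))"
  using assms(2-)
proof (induction k arbitrary: g)
  case 0 then show ?case by (auto intro: continuous_on_compose2)
next
  case (Suc k)
  have D: "((\<lambda>x. g (f x)) has_derivative
      (\<lambda>v. \<Sum>b\<in>Basis. (fderiv f x v \<bullet> b) *\<^sub>R fderiv g (f x) b)) (at x)" if "x \<in> S" for x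
  proof -
    have d: "f differentiable (at x)" "g differentiable (at (f x))" using Suc.prems that by auto
    show ?thesis
      by (rule has_derivative_eq_rhs[OF diff_chain_at[OF d[unfolded frechet_derivative_works], unfolded o_def]])
        (rule ext, rule linear_expand_Basis[OF linear_frechet_derivative[OF d(2)]])
  qed
  show ?case
  proof (rule k_smooth_on_SucI[OF assms(1) D])
    fix v
    have 1: "k_smooth_on k S (\<lambda>x. fderiv g (f x) b)" for b
      using Suc.prems k_smooth_on_SucD[OF Suc.prems(1)] by (intro Suc.IH) auto
    have 2: "k_smooth_on k S (\<lambda>x. fderiv f x v \<bullet> b)" for b
      using Suc.prems by (intro k_smooth_on_compose_bounded_linear[OF assms(1) bounded_linear_inner_left]) auto
    show "k_smooth_on k S (\<lambda>x. \<Sum>b\<in>Basis. (fderiv f x v \<bullet> b) *\<^sub>R fderiv g (f x) b)"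
      by (intro k_smooth_on_sum[OF assms(1)] k_smooth_on_bilinear[OF assms(1) bounded_bilinear_scaleR] 1 2)
  qed
qed

lemma k_smooth_on_inverse:
  fixes f :: "'a::real_normed_vector \<Rightarrow> real"
  assumes "open S" "k_smooth_on k S f" "\<And>x. x \<in> S \<Longrightarrow> f x \<noteq> 0"
  shows "k_smooth_on k S (\<lambda>x. inverse (f x))"
  using assms(2)
proof (induction k)
  case 0 then show ?case using assms(3) by (auto intro: continuous_on_inverse)
next
  case (Suc k)
  have D: "((\<lambda>x. inverse (f x)) has_derivative
      (\<lambda>v. - (inverse (f x) * fderiv f x v * inverse (f x)))) (at x)" if "x \<in> S" for x
    using Suc.prems that by (intro Deriv.has_derivative_inverse assms(3)) (auto intro: frechet_derivative_has)
  show ?case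
  proof (rule k_smooth_on_SucI[OF assms(1) D])
    fix v
    have 1: "k_smooth_on k S (\<lambda>x. inverse (f x))"
      using Suc k_smooth_on_SucD by blast
    have 2: "k_smooth_on k S (\<lambda>x. fderiv f x v)" using Suc.prems by auto
    show "k_smooth_on k S (\<lambda>x. - (inverse (f x) * fderiv f x v * inverse (f x)))"
      by (intro k_smooth_on_compose_bounded_linear[OF assms(1), of uminus] bounded_linear_minus bounded_linear_ident
        k_smooth_on_bilinear[OF assms(1) bounded_bilinear_mult] 1 2)
  qed
qed

text \<open>Sine and cosine are each other's derivatives up to sign, so the induction carries
  both.\<close>

lemma k_smooth_on_sin_cos: "k_smooth_on k UNIV (sin :: real \<Rightarrow> real) \<and> k_smooth_on k UNIV (cos :: real \<Rightarrow> real)"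
proof (induction k)
  case 0 then show ?case by (auto intro: continuous_intros)
next
  case (Suc k)
  have "(sin has_derivative (\<lambda>v. v * cos x)) (at x)" "(cos has_derivative (\<lambda>v. v * (- sin x))) (at x)" for x :: real
    by (auto intro!: derivative_eq_intros)
  then have D: "sin differentiable (at x)" "fderiv sin x = (\<lambda>v. v * cos x)"
    "cos differentiable (at x)" "fderiv cos x = (\<lambda>v. v * (- sin x))" for x :: real
    by (auto simp: differentiable_def frechet_derivative_eqI)
  have "bounded_linear (\<lambda>x::real. v * x)" "bounded_linear (\<lambda>x::real. v * - x)" for v
    by (rule bounded_linear_mult_right, rule bounded_linear_compose[OF bounded_linear_mult_right
        bounded_linear_minus[OF bounded_linear_ident]])
  then have "k_smooth_on k UNIV (\<lambda>x. v * cos x)" "k_smooth_on k UNIV (\<lambda>x. v * - sin x)" for v :: real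
    using Suc k_smooth_on_compose_bounded_linear[OF open_UNIV] by blast+
  then show ?case by (simp add: D)
qed

section \<open>Closure rules for smooth maps\<close>

named_theorems smooth_intros

lemma smooth_on_const [smooth_intros]: "smooth_on S (\<lambda>x. c)"
  by (simp add: smooth_on_def k_smooth_on_const)

lemma smooth_on_bounded_linear: "bounded_linear f \<Longrightarrow> smooth_on S f"
  by (simp add: smooth_on_def k_smooth_on_bounded_linear)

lemma smooth_on_id [smooth_intros]: "smooth_on S (\<lambda>x. x)"
  by (rule smooth_on_bounded_linear) (rule bounded_linear_ident)

lemma smooth_on_compose_bounded_linear:
  "bounded_linear L \<Longrightarrow> smooth_on S f \<Longrightarrow> open S \<Longrightarrow> smooth_on S (\<lambda>x. L (f x))"
  by (simp add: smooth_on_def k_smooth_on_compose_bounded_linear)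

lemmas smooth_on_fst [smooth_intros] = smooth_on_compose_bounded_linear[OF bounded_linear_fst]
lemmas smooth_on_snd [smooth_intros] = smooth_on_compose_bounded_linear[OF bounded_linear_snd]
lemmas smooth_on_vec_nth [smooth_intros] = smooth_on_compose_bounded_linear[OF bounded_linear_vec_nth]
lemmas smooth_on_minus [smooth_intros] =
  smooth_on_compose_bounded_linear[OF bounded_linear_minus[OF bounded_linear_ident]]
lemmas smooth_on_cdivide [smooth_intros] =
  smooth_on_compose_bounded_linear[OF bounded_linear_divide]

lemma smooth_on_add [smooth_intros]:
  "smooth_on S f \<Longrightarrow> smooth_on S g \<Longrightarrow> open S \<Longrightarrow> smooth_on S (\<lambda>x. f x + g x)"
  by (simp add: smooth_on_def k_smooth_on_add)

lemma smooth_on_diff [smooth_intros]: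
  "smooth_on S f \<Longrightarrow> smooth_on S g \<Longrightarrow> open S \<Longrightarrow> smooth_on S (\<lambda>x. f x - g x)"
  using smooth_on_add[of S f "\<lambda>x. - g x"] smooth_on_minus[of S g] by simp

lemma smooth_on_bilinear:
  "bounded_bilinear B \<Longrightarrow> smooth_on S f \<Longrightarrow> smooth_on S g \<Longrightarrow> open S \<Longrightarrow> smooth_on S (\<lambda>x. B (f x) (g x))"
  by (simp add: smooth_on_def k_smooth_on_bilinear)

lemmas smooth_on_mult [smooth_intros] = smooth_on_bilinear[OF bounded_bilinear_mult]
lemmas smooth_on_scaleR [smooth_intros] = smooth_on_bilinear[OF bounded_bilinear_scaleR]
lemmas smooth_on_inner [smooth_intros] = smooth_on_bilinear[OF bounded_bilinear_inner]

lemma smooth_on_sum [smooth_intros]: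
  "(\<And>i. i \<in> I \<Longrightarrow> smooth_on S (f i)) \<Longrightarrow> open S \<Longrightarrow> smooth_on S (\<lambda>x. \<Sum>i\<in>I. f i x)"
  by (simp add: smooth_on_def k_smooth_on_sum)

lemma smooth_on_compose:
  fixes f :: "'a::real_normed_vector \<Rightarrow> 'b::euclidean_space" and g :: "'b \<Rightarrow> 'c::real_normed_vector"
  shows "smooth_on T g \<Longrightarrow> smooth_on S f \<Longrightarrow> open S \<Longrightarrow> f ` S \<subseteq> T \<Longrightarrow> smooth_on S (\<lambda>x. g (f x))"
  unfolding smooth_on_def by (metis k_smooth_on_compose)

lemma smooth_on_divide [smooth_intros]:
  fixes f g :: "'a::real_normed_vector \<Rightarrow> real"
  assumes "smooth_on S f" "smooth_on S g" "\<And>x. x \<in> S \<Longrightarrow> g x \<noteq> 0" "open S"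
  shows "smooth_on S (\<lambda>x. f x / g x)"
proof -
  have "smooth_on S (\<lambda>x. inverse (g x))"
    using assms by (simp add: smooth_on_def k_smooth_on_inverse)
  then show ?thesis using smooth_on_mult[OF assms(1) _ assms(4)] by (simp add: divide_inverse)
qed

lemma smooth_on_sin_cos [smooth_intros]:
  "smooth_on S f \<Longrightarrow> open S \<Longrightarrow> smooth_on S (\<lambda>x. sin (f x))"
  "smooth_on S f \<Longrightarrow> open S \<Longrightarrow> smooth_on S (\<lambda>x. cos (f x))"
  for f :: "'a::real_normed_vector \<Rightarrow> real"
  using k_smooth_on_sin_cos smooth_on_compose[of UNIV sin S f] smooth_on_compose[of UNIV cos S f]
  by (simp_all add: smooth_on_def)

lemma smooth_on_euclidean_iff:
  fixes f :: "'a::real_normed_vector \<Rightarrow> 'b::euclidean_space"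
  assumes "open S"
  shows "smooth_on S f \<longleftrightarrow> (\<forall>b\<in>Basis. smooth_on S (\<lambda>x. f x \<bullet> b))"
proof
  assume "\<forall>b\<in>Basis. smooth_on S (\<lambda>x. f x \<bullet> b)"
  then have "smooth_on S (\<lambda>x. \<Sum>b\<in>Basis. (f x \<bullet> b) *\<^sub>R b)"
    using assms by (intro smooth_on_sum smooth_on_scaleR smooth_on_const) auto
  then show "smooth_on S f" by (simp add: euclidean_representation)
next
  assume "smooth_on S f"
  then show "\<forall>b\<in>Basis. smooth_on S (\<lambda>x. f x \<bullet> b)"
    using assms smooth_on_compose_bounded_linear[OF bounded_linear_inner_left] by blast
qed

lemma smooth_on_vec_lambda [smooth_intros]:
  fixes f :: "'n::finite \<Rightarrow> 'a::real_normed_vector \<Rightarrow> real"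
  assumes "\<And>i. smooth_on S (f i)" "open S"
  shows "smooth_on S (\<lambda>x. \<chi> i. f i x)"
  using assms by (subst smooth_on_euclidean_iff) (auto simp: Basis_vec_def inner_axis)

lemma smooth_on_Pair [smooth_intros]:
  fixes f :: "'a::real_normed_vector \<Rightarrow> 'b::euclidean_space" and g :: "'a \<Rightarrow> 'c::euclidean_space"
  assumes "smooth_on S f" "smooth_on S g" "open S"
  shows "smooth_on S (\<lambda>x. (f x, g x))"
proof (subst smooth_on_euclidean_iff[OF assms(3)], rule ballI)
  fix b :: "'b \<times> 'c" assume "b \<in> Basis"
  have "smooth_on S (\<lambda>x. f x \<bullet> fst b + g x \<bullet> snd b)" by (intro smooth_intros assms)
  then show "smooth_on S (\<lambda>x. (f x, g x) \<bullet> b)" by (simp add: inner_prod_def)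
qed

text \<open>Smoothness is defined with constant directions; the basis expansion extends it to a
  direction that varies with the point.\<close>

lemma smooth_on_frechet_field [smooth_intros]:
  fixes f :: "'a::euclidean_space \<Rightarrow> 'b::real_normed_vector"
  assumes "smooth_on S f" "smooth_on S X" "open S"
  shows "smooth_on S (\<lambda>x. fderiv f x (X x))"
proof -
  have "smooth_on S (\<lambda>x. \<Sum>b\<in>Basis. (X x \<bullet> b) *\<^sub>R fderiv f x b)"
    by (intro smooth_intros assms smooth_on_frechet)
  then show ?thesis
    by (subst smooth_on_cong[OF assms(3)])
      (auto intro!: linear_expand_Basis linear_frechet_derivative smooth_on_differentiable[OF assms(1)])
qed

text \<open>\<open>leibniz_rule\<close> treats the derivative as a bounded linear map, whose joint
  continuity is checked here direction by direction. The open set \<open>I\<close> leaves room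
  around the interval of integration, because smoothness refers to full neighbourhoods also at its
  end points.\<close>

lemma has_derivative_integral_param:
  fixes g :: "'a::euclidean_space \<times> real \<Rightarrow> 'b::euclidean_space"
  assumes "open S" "open I" "{a..b} \<subseteq> I" "k_smooth_on (Suc k) (S \<times> I) g" "z \<in> S"
  shows "((\<lambda>x. integral {a..b} (\<lambda>t. g (x, t))) has_derivative
    (\<lambda>v. integral {a..b} (\<lambda>t. fderiv g (z, t) (v, 0)))) (at z)"
proof -
  let ?f' = "\<lambda>x t v. fderiv g (x, t) (v, 0)"
  obtain e where e: "e > 0" "ball z e \<subseteq> S" using assms(1,5) openE by blast
  let ?U = "ball z e"
  have ks0: "k_smooth_on 0 (S \<times> I) h" if "k_smooth_on k (S \<times> I) h" for h :: "'a \<times> real \<Rightarrow> 'b"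
    using that by (induction k) (use k_smooth_on_SucD in blast)+
  have gd: "(g has_derivative fderiv g (x, t)) (at (x, t))" if "x \<in> S" "t \<in> I" for x t
    using assms(4) that by (auto intro: frechet_derivative_has)
  have gc: "continuous_on (S \<times> I) g"
    using gd by (intro continuous_at_imp_continuous_on) (auto intro: has_derivative_continuous)
  have comp: "((\<lambda>x. g (x, t)) has_derivative ?f' x t) (at x)" if "x \<in> S" "t \<in> I" for x t
  proof -
    have "((\<lambda>x. (x, t)) has_derivative (\<lambda>v. (v, 0))) (at x)" by (auto intro!: derivative_eq_intros)
    from diff_chain_at[OF this gd[OF that]] show ?thesis by (simp add: o_def)
  qed
  have bl: "bounded_linear (?f' x t)" if "x \<in> S" "t \<in> I" for x t
    using comp[OF that] by (rule has_derivative_bounded_linear)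
  have int: "blinfun_apply (integral {a..b} (\<lambda>t. Blinfun (?f' z t))) v = integral {a..b} (\<lambda>t. ?f' z t v)"
    if "(\<lambda>t. Blinfun (?f' z t)) integrable_on {a..b}" for v
    using assms(3,5) by (subst blinfun_apply_integral[OF that])
      (auto intro!: integral_cong simp: bounded_linear_Blinfun_apply bl subset_eq)
  have cont: "continuous_on (?U \<times> {a..b}) (\<lambda>(x, t). Blinfun (?f' x t))"
  proof (rule continuous_on_blinfun_componentwise)
    fix i :: 'a
    have "continuous_on (S \<times> I) (\<lambda>p. fderiv g p (i, 0))"
      using assms(4) ks0 by auto
    then have "continuous_on (?U \<times> {a..b}) (\<lambda>p. fderiv g p (i, 0))"
      by (rule continuous_on_subset) (use e assms(3) in auto)
    then show "continuous_on (?U \<times> {a..b}) (\<lambda>p. blinfun_apply (case p of (x, t) \<Rightarrow> Blinfun (?f' x t)) i)"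
      by (rule continuous_on_eq)
        (use e assms(3) bl in \<open>auto simp: bounded_linear_Blinfun_apply subset_eq\<close>)
  qed
  have "((\<lambda>x. integral (cbox a b) (\<lambda>t. g (x, t))) has_derivative
      blinfun_apply (integral (cbox a b) (\<lambda>t. Blinfun (?f' z t)))) (at z within ?U)"
  proof (rule leibniz_rule)
    fix x t assume x: "x \<in> ?U" "t \<in> cbox a b"
    then have "x \<in> S" "t \<in> I" using e assms(3) by auto
    then show "((\<lambda>x. g (x, t)) has_derivative blinfun_apply (Blinfun (?f' x t))) (at x within ?U)"
      using comp bl by (auto simp: bounded_linear_Blinfun_apply intro: has_derivative_at_withinI)
  next
    fix x assume "x \<in> ?U"
    then have "continuous_on {a..b} (\<lambda>t. g (x, t))"
      using e assms(3) by (auto intro!: continuous_on_compose2[OF gc] continuous_intros)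
    then show "(\<lambda>t. g (x, t)) integrable_on cbox a b" by (simp add: integrable_continuous_real)
  qed (use cont e in auto)
  moreover have "(\<lambda>t. Blinfun (?f' z t)) integrable_on {a..b}"
  proof (rule integrable_continuous_real)
    have "continuous_on {a..b} (\<lambda>t. (\<lambda>(x, t). Blinfun (?f' x t)) (z, t))"
      by (rule continuous_on_compose2[OF cont]) (use e in \<open>auto intro!: continuous_intros\<close>)
    then show "continuous_on {a..b} (\<lambda>t. Blinfun (?f' z t))" by simp
  qed
  ultimately have "((\<lambda>x. integral {a..b} (\<lambda>t. g (x, t))) has_derivative
      (\<lambda>v. integral {a..b} (\<lambda>t. ?f' z t v))) (at z within ?U)"
    using int by (auto simp: cbox_interval elim!: has_derivative_eq_rhs)
  then show ?thesis using e by (simp add: at_within_open[of z ?U])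
qed

lemma k_smooth_on_integral_param:
  fixes g :: "'a::euclidean_space \<times> real \<Rightarrow> 'b::euclidean_space"
  assumes "open S" "open I" "{a..b} \<subseteq> I" "k_smooth_on k (S \<times> I) g"
  shows "k_smooth_on k S (\<lambda>x. integral {a..b} (\<lambda>t. g (x, t)))"
  using assms(4)
proof (induction k arbitrary: g)
  case 0
  have "continuous_on (S \<times> cbox a b) (\<lambda>(x, t). g (x, t))"
    using 0 assms(3) by (auto intro: continuous_on_subset)
  from integral_continuous_on_param[OF this] show ?case by simp
next
  case (Suc k)
  note D = has_derivative_integral_param[OF assms(1-3) Suc.prems]
  show ?case
  proof (rule k_smooth_on_SucI[OF assms(1) D])
    fix v
    show "k_smooth_on k S (\<lambda>x. integral {a..b} (\<lambda>t. fderiv g (x, t) (v, 0)))"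
      using Suc.prems by (intro Suc.IH) auto
  qed
qed

lemma smooth_on_integral_param:
  fixes g :: "'a::euclidean_space \<times> real \<Rightarrow> 'b::euclidean_space"
  assumes "open S" "open I" "{a..b} \<subseteq> I" "smooth_on (S \<times> I) g"
  shows "smooth_on S (\<lambda>x. integral {a..b} (\<lambda>t. g (x, t)))"
  using assms k_smooth_on_integral_param unfolding smooth_on_def by blast

text \<open>Differentiate
  \<open>f (x + \<tau> w) - f x = \<integral>\<^sub>0\<^sup>\<tau> D f (x + t w) w dt\<close> with respect to \<open>x\<close> under the integral sign
  and then with respect to \<open>\<tau>\<close> at 0.\<close>

lemma second_derivative_sym:
  fixes f :: "'a::euclidean_space \<Rightarrow> 'b::euclidean_space"
  assumes S: "open S" "smooth_on S f" "z \<in> S"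
  shows "fderiv (\<lambda>x. fderiv f x v) z w =
    fderiv (\<lambda>x. fderiv f x w) z v"
proof -
  let ?D = "\<lambda>u x. fderiv f x u"
  have sD: "smooth_on S (?D u)" for u using S(2) by (rule smooth_on_frechet)
  have hD: "(?D u has_derivative fderiv (?D u) x) (at x)" if "x \<in> S" for x u
    using smooth_on_has_derivative[OF sD that] .
  have hf: "(f has_derivative fderiv f x) (at x)" if "x \<in> S" for x
    using smooth_on_has_derivative[OF S(2) that] .
  obtain e where e: "e > 0" "ball z (3 * e) \<subseteq> S"
  proof -
    obtain e where "e > 0" "ball z e \<subseteq> S" using S openE by blast
    then show ?thesis using that[of "e / 3"] by auto
  qed
  \<comment> \<open>The \<open>+ 1\<close> covers the case w = 0. As c |w| <= e, moving a point of
    the ball of radius e by t w with |t| < 2 c does not leave the ball of radius 3 e, which lies in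
    \<open>S\<close>.\<close>
  define c where "c = e / (norm w + 1)"
  have c: "c > 0" using e by (simp add: c_def add_nonneg_pos)
  have "c * norm w = e * (norm w / (norm w + 1))" by (simp add: c_def)
  also have "\<dots> \<le> e * 1" using e by (intro mult_left_mono) (auto simp: divide_simps add_nonneg_pos)
  finally have nw: "c * norm w \<le> e" by simp
  let ?I = "{- c<..<2 * c}"
  have inS: "x + t *\<^sub>R w \<in> S" if "x \<in> ball z e" "t \<in> ?I" for x t
  proof -
    have "dist z (x + t *\<^sub>R w) \<le> dist z x + \<bar>t\<bar> * norm w"
      by (metis dist_norm dist_triangle add_diff_cancel_left' norm_scaleR dist_commute)
    also have "\<dots> < e + 2 * e"
    proof (rule add_less_le_mono)
      have "\<bar>t\<bar> * norm w \<le> (2 * c) * norm w" using that c by (intro mult_right_mono) auto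
      then show "\<bar>t\<bar> * norm w \<le> 2 * e" using nw by linarith
    qed (use that in auto)
    finally show ?thesis using e by auto
  qed
  have sg: "smooth_on (ball z e \<times> ?I) (\<lambda>p. ?D w (fst p + snd p *\<^sub>R w))"
    by (rule smooth_on_compose[OF sD]) (auto intro!: smooth_intros open_Times simp: inS)
  have ftc: "integral {0..\<tau>} (\<lambda>t. ?D w (x + t *\<^sub>R w)) = f (x + \<tau> *\<^sub>R w) - f x"
    if "x \<in> ball z e" "\<tau> \<in> {0..c}" for x \<tau>
  proof -
    have "((\<lambda>t. ?D w (x + t *\<^sub>R w)) has_integral f (x + \<tau> *\<^sub>R w) - f (x + 0 *\<^sub>R w)) {0..\<tau>}"
    proof (rule fundamental_theorem_of_calculus)
      fix t assume t: "t \<in> {0..\<tau>}"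
      have 1: "x + t *\<^sub>R w \<in> S" using inS that t c by auto
      have "((\<lambda>t. x + t *\<^sub>R w) has_derivative (\<lambda>s. s *\<^sub>R w)) (at t)" by (auto intro!: derivative_eq_intros)
      from diff_chain_at[OF this hf[OF 1]]
      have "((\<lambda>t. f (x + t *\<^sub>R w)) has_derivative (\<lambda>s. s *\<^sub>R ?D w (x + t *\<^sub>R w))) (at t)"
        using linear_scale[OF linear_frechet_derivative, OF smooth_on_differentiable[OF S(2) 1]]
        by (simp add: o_def)
      then show "((\<lambda>t. f (x + t *\<^sub>R w)) has_vector_derivative ?D w (x + t *\<^sub>R w)) (at t within {0..\<tau>})"
        unfolding has_vector_derivative_def by (rule has_derivative_at_withinI)
    qed (use that in auto)
    then show ?thesis by (simp add: integral_unique)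
  qed
  have key: "?D v (z + \<tau> *\<^sub>R w) - ?D v z =
      integral {0..\<tau>} (\<lambda>t. fderiv (?D w) (z + t *\<^sub>R w) v)" if \<tau>: "\<tau> \<in> {0..c}" for \<tau>
  proof -
    have z: "z \<in> ball z e" "z \<in> S" "z + \<tau> *\<^sub>R w \<in> S" using e S(3) inS[of z \<tau>] \<tau> c by auto
    let ?g = "\<lambda>p. ?D w (fst p + snd p *\<^sub>R w)"
    have "((\<lambda>x. integral {0..\<tau>} (\<lambda>t. ?g (x, t))) has_derivative
      (\<lambda>v. integral {0..\<tau>} (\<lambda>t. fderiv ?g (z, t) (v, 0)))) (at z)"
      by (rule has_derivative_integral_param[of "ball z e" ?I])
        (use \<tau> sg z c in \<open>auto simp: smooth_on_def simp del: k_smooth_on.simps\<close>)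
    then have 1: "((\<lambda>x. f (x + \<tau> *\<^sub>R w) - f x) has_derivative
      (\<lambda>v. integral {0..\<tau>} (\<lambda>t. fderiv ?g (z, t) (v, 0)))) (at z)"
      by (rule has_derivative_transform_within_open[where s = "ball z e"]) (use z ftc \<tau> in auto)
    have "((\<lambda>x. x + \<tau> *\<^sub>R w) has_derivative (\<lambda>v. v)) (at z)" by (auto intro!: derivative_eq_intros)
    from has_derivative_diff[OF diff_chain_at[OF this hf] hf] z
    have 2: "((\<lambda>x. f (x + \<tau> *\<^sub>R w) - f x) has_derivative (\<lambda>v. ?D v (z + \<tau> *\<^sub>R w) - ?D v z)) (at z)"
      by (auto simp: o_def)
    have "?D v (z + \<tau> *\<^sub>R w) - ?D v z = integral {0..\<tau>} (\<lambda>t. fderiv ?g (z, t) (v, 0))"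
      using has_derivative_unique[OF 1 2] by metis
    also have "\<dots> = integral {0..\<tau>} (\<lambda>t. fderiv (?D w) (z + t *\<^sub>R w) v)"
    proof (rule integral_cong)
      fix t assume "t \<in> {0..\<tau>}"
      then have 3: "z + t *\<^sub>R w \<in> S" using inS z \<tau> c by auto
      have "((\<lambda>p. fst p + snd p *\<^sub>R w) has_derivative (\<lambda>p. fst p + snd p *\<^sub>R w)) (at (z, t))"
        by (auto intro!: derivative_eq_intros)
      from diff_chain_at[OF this, of "?D w"] hD[OF 3]
      have "(?g has_derivative (\<lambda>p. fderiv (?D w) (z + t *\<^sub>R w) (fst p + snd p *\<^sub>R w))) (at (z, t))"
        by (simp add: o_def)
      then show "fderiv ?g (z, t) (v, 0) = fderiv (?D w) (z + t *\<^sub>R w) v"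
        by (simp add: frechet_derivative_eqI)
    qed
    finally show ?thesis .
  qed
  have cont: "continuous_on {0..c} (\<lambda>t. fderiv (?D w) (z + t *\<^sub>R w) v)"
    by (rule continuous_on_compose2[OF smooth_on_continuous_on[OF smooth_on_frechet[OF sD]]])
      (use inS e c in \<open>auto intro!: continuous_intros\<close>)
  have "((\<lambda>\<tau>. integral {0..\<tau>} (\<lambda>t. fderiv (?D w) (z + t *\<^sub>R w) v)) has_vector_derivative
      fderiv (?D w) (z + 0 *\<^sub>R w) v) (at 0 within {0..c})"
    by (rule integral_has_vector_derivative[OF cont]) (use c in simp)
  then have 1: "((\<lambda>\<tau>. ?D v (z + \<tau> *\<^sub>R w) - ?D v z) has_vector_derivative
      fderiv (?D w) z v) (at 0 within {0..c})"
    by (intro has_vector_derivative_transform[OF _ key]) (use c in auto)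
  have "((\<lambda>\<tau>. z + \<tau> *\<^sub>R w) has_derivative (\<lambda>s. s *\<^sub>R w)) (at 0)" by (auto intro!: derivative_eq_intros)
  from diff_chain_at[OF this, of "?D v"] hD[OF S(3)]
  have "((\<lambda>\<tau>. ?D v (z + \<tau> *\<^sub>R w)) has_derivative (\<lambda>s. fderiv (?D v) z (s *\<^sub>R w))) (at 0)"
    by (simp add: o_def)
  then have "((\<lambda>\<tau>. ?D v (z + \<tau> *\<^sub>R w) - ?D v z) has_derivative (\<lambda>s. fderiv (?D v) z (s *\<^sub>R w))) (at 0)"
    by (auto intro!: derivative_eq_intros)
  then have 2: "((\<lambda>\<tau>. ?D v (z + \<tau> *\<^sub>R w) - ?D v z) has_vector_derivative
      fderiv (?D v) z w) (at 0 within {0..c})"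
    unfolding has_vector_derivative_def
    using linear_scale[OF linear_frechet_derivative, OF smooth_on_differentiable[OF sD S(3)]]
    by (simp add: has_derivative_at_withinI)
  show ?thesis
    by (rule vector_derivative_unique_within_closed_interval[of 0 c 0, OF _ _ 2[folded cbox_interval] 1[folded cbox_interval]])
      (use c in auto)
qed

text \<open>Product rule for x -> Df(x)(Y x). Symmetry of the second derivative moves the constant
  vector \<open>v\<close> inside, so that the first summand differentiates a directional derivative
  of \<open>f\<close> along \<open>Y\<close>.\<close>

lemma frechet_derivative_field:
  fixes f :: "'a::euclidean_space \<Rightarrow> 'b::euclidean_space" and Y :: "'a \<Rightarrow> 'a"
  assumes S: "open S" "smooth_on S f" "z \<in> S" and Y: "Y differentiable (at z)"
  shows "((\<lambda>x. fderiv f x (Y x)) has_derivative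
    (\<lambda>v. fderiv (\<lambda>x. fderiv f x v) z (Y z) +
      fderiv f z (fderiv Y z v))) (at z)"
proof -
  let ?D = "\<lambda>u x. fderiv f x u"
  have sD: "smooth_on S (?D u)" for u using S(2) by (rule smooth_on_frechet)
  have lf: "linear (fderiv f x)" if "x \<in> S" for x
    by (rule smooth_on_linear[OF S(2) that])
  have "((\<lambda>x. \<Sum>b\<in>Basis. (Y x \<bullet> b) *\<^sub>R ?D b x) has_derivative
     (\<lambda>v. \<Sum>b\<in>Basis. (Y z \<bullet> b) *\<^sub>R fderiv (?D b) z v +
       (fderiv Y z v \<bullet> b) *\<^sub>R ?D b z)) (at z)"
    by (intro has_derivative_sum has_derivative_scaleR has_derivative_inner_left
      smooth_on_has_derivative[OF sD S(3)] frechet_derivative_has[OF Y])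
  moreover have "(\<Sum>b\<in>Basis. (Y z \<bullet> b) *\<^sub>R fderiv (?D b) z v +
       (fderiv Y z v \<bullet> b) *\<^sub>R ?D b z) =
     fderiv (?D v) z (Y z) + ?D (fderiv Y z v) z" for v
    using linear_expand_Basis[OF lf[OF S(3)], of "fderiv Y z v"]
      linear_expand_Basis[OF smooth_on_linear[OF sD[of v] S(3)], of "Y z"]
    by (simp add: sum.distrib second_derivative_sym[OF S, of _ v])
  ultimately have "((\<lambda>x. \<Sum>b\<in>Basis. (Y x \<bullet> b) *\<^sub>R ?D b x) has_derivative
     (\<lambda>v. fderiv (?D v) z (Y z) + ?D (fderiv Y z v) z)) (at z)"
    by simp
  then show ?thesis
    by (rule has_derivative_transform_within_open[OF _ S(1) S(3)])
      (metis linear_expand_Basis[OF lf])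
qed

text \<open>The identity X(Yf) - Y(Xf) = [X, Y]f: the second-order terms cancel by symmetry.\<close>

lemma coord_bracket_derivative:
  fixes f :: "'a::euclidean_space \<Rightarrow> 'b::euclidean_space" and X Y :: "'a \<Rightarrow> 'a"
  assumes S: "open S" "smooth_on S f" "z \<in> S" and "X differentiable (at z)" "Y differentiable (at z)"
  shows "fderiv (\<lambda>x. fderiv f x (Y x)) z (X z) -
    fderiv (\<lambda>x. fderiv f x (X x)) z (Y z) =
    fderiv f z (coord_bracket X Y z)"
  using linear_diff[OF smooth_on_linear[OF S(2,3)]]
  by (simp add: frechet_derivative_eqI[OF frechet_derivative_field[OF S assms(5)]]
    frechet_derivative_eqI[OF frechet_derivative_field[OF S assms(4)]]
    second_derivative_sym[OF S, of "X z"] coord_bracket_def)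

section \<open>Sprays in coordinates\<close>

type_synonym 'n tpoint = "(real^'n) \<times> (real^'n)"

lemma linear_axis_expand:
  fixes L :: "'n::finite tpoint \<Rightarrow> real"
  assumes "linear L"
  shows "L (0, b) = (\<Sum>k\<in>UNIV. b $ k * L (0, axis k 1))"
    and "L (a, b) = L (a, 0) + (\<Sum>k\<in>UNIV. b $ k * L (0, axis k 1))"
proof -
  have "(0, b) = (\<Sum>k\<in>UNIV. b $ k *\<^sub>R ((0::real^'n), axis k (1::real)))"
    by (intro prod_eqI) (simp_all add: fst_sum snd_sum basis_expansion vec_eq_iff axis_def if_distrib cong: if_cong)
  then show 1: "L (0, b) = (\<Sum>k\<in>UNIV. b $ k * L (0, axis k 1))"
    by (simp add: linear_sum[OF assms] linear_scale[OF assms] del: scaleR_Pair)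
  have "L (a, b) = L ((a, 0) + (0, b))" by simp
  then show "L (a, b) = L (a, 0) + (\<Sum>k\<in>UNIV. b $ k * L (0, axis k 1))"
    by (simp only: linear_add[OF assms] 1)
qed

lemma smooth_on_d_y [smooth_intros]: "smooth_on U f \<Longrightarrow> smooth_on U (d_y i f)"
  and smooth_on_d_x [smooth_intros]: "smooth_on U f \<Longrightarrow> smooth_on U (d_x i f)"
  unfolding d_y_def[abs_def] d_x_def[abs_def] by (rule smooth_on_frechet; assumption)+

lemma d_y_cong: "open U \<Longrightarrow> z \<in> U \<Longrightarrow> (\<And>u. u \<in> U \<Longrightarrow> f u = g u) \<Longrightarrow> d_y i f z = d_y i g z"
  unfolding d_y_def by (metis frechet_derivative_cong_open(1))

lemma d_x_cong: "open U \<Longrightarrow> z \<in> U \<Longrightarrow> (\<And>u. u \<in> U \<Longrightarrow> f u = g u) \<Longrightarrow> d_x i f z = d_x i g z"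
  unfolding d_x_def by (metis frechet_derivative_cong_open(1))

lemma d_y_commute:
  assumes "open U" "smooth_on U f" "z \<in> U"
  shows "d_y i (d_y j f) z = d_y j (d_y i f) z" "d_y i (d_x j f) z = d_x j (d_y i f) z"
    "d_x i (d_x j f) z = d_x j (d_x i f) z"
  unfolding d_y_def[abs_def] d_x_def[abs_def] by (rule second_derivative_sym[OF assms])+

lemma frechet_vertical:
  assumes "f differentiable (at z)"
  shows "fderiv f z (0, b) = (\<Sum>k\<in>UNIV. b $ k * d_y k f z)"
  unfolding d_y_def by (rule linear_axis_expand(1)[OF linear_frechet_derivative[OF assms]])

lemma frechet_horizontal:
  assumes "f differentiable (at z)"
  shows "fderiv f z (horizontal S i z) = d_x i f z - (\<Sum>k\<in>UNIV. conn_coeff S k i z * d_y k f z)"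
  using linear_axis_expand(2)[OF linear_frechet_derivative[OF assms], of "axis i 1" "- (\<chi> j. conn_coeff S j i z)"]
  by (simp add: horizontal_def d_y_def d_x_def sum_negf)

section \<open>Euler-Lagrange expressions, their fibre derivatives and the curvature\<close>

definition euler_lagrange ::
    "('n tpoint \<Rightarrow> 'n tpoint) \<Rightarrow> ('n tpoint \<Rightarrow> real) \<Rightarrow>
     'n::finite \<Rightarrow> 'n tpoint \<Rightarrow> real" where
  "euler_lagrange S f i z = fderiv (d_y i f) z (S z) - d_x i f z"

abbreviation vertical_hessian ::
    "('n tpoint \<Rightarrow> real) \<Rightarrow> 'n::finite \<Rightarrow> 'n \<Rightarrow> 'n tpoint \<Rightarrow> real" where
  "vertical_hessian f i j \<equiv> d_y i (d_y j f)"

text \<open>A spray seen in one canonical chart; \<open>homogeneous_S\<close> is the coordinate form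
  of [\<Delta>, \<Gamma>] = \<Gamma>.\<close>

locale local_spray =
  fixes U :: "('n::finite tpoint) set"
    and S :: "'n tpoint \<Rightarrow> 'n tpoint"
  assumes open_U: "open U" and smooth_S: "smooth_on U S"
    and fst_S: "\<And>z. z \<in> U \<Longrightarrow> fst (S z) = snd z"
    and homogeneous_S: "\<And>z. z \<in> U \<Longrightarrow> coord_bracket (\<lambda>z. (0, snd z)) S z = S z"
begin

lemma diff_S: "z \<in> U \<Longrightarrow> S differentiable (at z)"
  by (rule smooth_on_differentiable[OF smooth_S])

lemma smooth_spray_coeff: "smooth_on U (spray_coeff S i)"
  unfolding spray_coeff_def[abs_def] by (intro smooth_intros smooth_S open_U)

lemma smooth_conn_coeff: "smooth_on U (conn_coeff S i j)"
  unfolding conn_coeff_def[abs_def] using smooth_on_d_y[OF smooth_spray_coeff] by simp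

lemma smooth_horizontal: "smooth_on U (horizontal S i)"
  unfolding horizontal_def[abs_def] by (intro smooth_intros smooth_conn_coeff open_U)

lemma frechet_S_eq:
  assumes z: "z \<in> U"
  shows "fderiv S z v = (snd v, \<chi> k. - 2 * fderiv (spray_coeff S k) z v)"
proof -
  have D: "(S has_derivative fderiv S z) (at z)"
    by (rule smooth_on_has_derivative[OF smooth_S z])
  have "((\<lambda>u. fst (S u)) has_derivative (\<lambda>v. fst (fderiv S z v))) (at z)"
    by (rule has_derivative_fst[OF D])
  moreover have "((\<lambda>u. fst (S u)) has_derivative snd) (at z)"
    by (rule has_derivative_transform_within_open[OF _ open_U z, where f = snd])
      (auto simp: fst_S intro!: bounded_linear_imp_has_derivative bounded_linear_snd)
  ultimately have 1: "fst (fderiv S z v) = snd v"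
    using has_derivative_unique by (metis (mono_tags, lifting))
  have 2: "snd (fderiv S z v) $ k = - 2 * fderiv (spray_coeff S k) z v" for k
  proof -
    have "((\<lambda>u. snd (S u) $ k) has_derivative (\<lambda>v. snd (fderiv S z v) $ k)) (at z)"
      by (intro bounded_linear.has_derivative[OF bounded_linear_vec_nth] has_derivative_snd D)
    from has_derivative_divide'[OF has_derivative_minus[OF this] has_derivative_const[of "2::real"]]
    have "(spray_coeff S k has_derivative (\<lambda>v. - snd (fderiv S z v) $ k / 2)) (at z)"
      by (simp add: spray_coeff_def[abs_def])
    then show ?thesis by (simp add: frechet_derivative_eqI)
  qed
  show ?thesis by (intro prod_eqI) (simp_all add: 1 2 vec_eq_iff)
qed

text \<open>This is the bracket [V_j, \<Gamma>] = 2 H_j - d/dx^j, the point at which the horizontal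
  fields enter the fibre derivative of E_i.\<close>

lemma frechet_S_axis:
  "z \<in> U \<Longrightarrow> fderiv S z (0, axis j 1) = 2 *\<^sub>R horizontal S j z - (axis j 1, 0)"
  by (simp add: frechet_S_eq horizontal_def conn_coeff_def d_y_def scaleR_2 vec_eq_iff)

lemma smooth_euler_lagrange: "smooth_on U f \<Longrightarrow> smooth_on U (euler_lagrange S f i)"
  unfolding euler_lagrange_def[abs_def] by (intro smooth_intros smooth_S open_U)

text \<open>Differentiating the direction \<open>S\<close> in the first term of E_i gives 2 H_j -
  d/dx^j. Rewriting the remaining x-derivatives by H_j and H_i collects exactly the connection terms
  of \<nabla>h. As f is an arbitrary smooth function, the formula serves both directions of the
  theorem.\<close>

lemma euler_lagrange_derivative:
  assumes f: "smooth_on U f" and z: "z \<in> U"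
  shows "d_y j (euler_lagrange S f i) z = dyn_cov_deriv S (vertical_hessian f) i j z +
     fderiv (d_y i f) z (horizontal S j z) - fderiv (d_y j f) z (horizontal S i z)"
proof -
  have \<theta>: "smooth_on U (d_y i f)" for i using f by (rule smooth_on_d_y)
  have d\<theta>: "d_y i f differentiable (at z)" for i by (rule smooth_on_differentiable[OF \<theta> z])
  note lin = linear_frechet_derivative[OF d\<theta>]
  have "(euler_lagrange S f i has_derivative
     (\<lambda>v. fderiv (\<lambda>x. fderiv (d_y i f) x v) z (S z) +
      fderiv (d_y i f) z (fderiv S z v)
      - fderiv (d_x i f) z v)) (at z)"
    unfolding euler_lagrange_def[abs_def]
    by (intro has_derivative_diff frechet_derivative_field[OF open_U \<theta> z] diff_S z
      smooth_on_has_derivative[OF smooth_on_d_x[OF f]])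
  then have "d_y j (euler_lagrange S f i) z =
     fderiv (d_y j (d_y i f)) z (S z) +
      fderiv (d_y i f) z (fderiv S z (0, axis j 1)) - d_y j (d_x i f) z"
    by (simp add: d_y_def[abs_def] frechet_derivative_eqI)
  also have "fderiv (d_y j (d_y i f)) z = fderiv (d_y i (d_y j f)) z"
    by (rule frechet_derivative_cong_open(1)[OF open_U z]) (rule d_y_commute(1)[OF open_U f])
  also have "fderiv (d_y i f) z (fderiv S z (0, axis j 1)) =
      2 * fderiv (d_y i f) z (horizontal S j z) - d_x j (d_y i f) z"
    by (simp add: frechet_S_axis z linear_diff[OF lin] linear_scale[OF lin] d_x_def)
  also have "d_x j (d_y i f) z = fderiv (d_y i f) z (horizontal S j z)
     + (\<Sum>k\<in>UNIV. conn_coeff S k j z * d_y i (d_y k f) z)"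
    by (simp add: frechet_horizontal[OF d\<theta>] d_y_commute(1)[OF open_U f z, of i])
  also have "d_y j (d_x i f) z = fderiv (d_y j f) z (horizontal S i z)
     + (\<Sum>k\<in>UNIV. conn_coeff S k i z * d_y k (d_y j f) z)"
    by (simp add: frechet_horizontal[OF d\<theta>] d_y_commute(2)[OF open_U f z])
  finally show ?thesis by (simp add: dyn_cov_deriv_def)
qed

lemma dyn_cov_deriv_sym:
  assumes "\<And>z i j. z \<in> U \<Longrightarrow> h i j z = h j i z" "z \<in> U"
  shows "dyn_cov_deriv S h i j z = dyn_cov_deriv S h j i z"
proof -
  have "fderiv (h i j) z = fderiv (h j i) z"
    by (rule frechet_derivative_cong_open(1)[OF open_U assms(2)]) (rule assms(1))
  then show ?thesis by (simp add: dyn_cov_deriv_def assms)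
qed

context
  fixes f
  assumes f: "smooth_on U f" and el: "\<And>z i. z \<in> U \<Longrightarrow> euler_lagrange S f i z = 0"
begin

lemma extremal_dyn_cov_deriv:
  assumes z: "z \<in> U"
  shows "dyn_cov_deriv S (vertical_hessian f) i j z = 0"
    and "fderiv (d_y i f) z (horizontal S j z) = fderiv (d_y j f) z (horizontal S i z)"
proof -
  have "d_y j (euler_lagrange S f i) z = 0" for i j
    using d_y_cong[OF open_U z, of "euler_lagrange S f i" "\<lambda>_. 0" j] el by (simp add: d_y_def)
  note 1 = this[unfolded euler_lagrange_derivative[OF f z]]
  have 2: "dyn_cov_deriv S (vertical_hessian f) i j z = dyn_cov_deriv S (vertical_hessian f) j i z"
    by (rule dyn_cov_deriv_sym[OF _ z]) (rule d_y_commute(1)[OF open_U f])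
  show "dyn_cov_deriv S (vertical_hessian f) i j z = 0" using 1[of j i] 1[of i j] 2 by linarith
  then show "fderiv (d_y i f) z (horizontal S j z) = fderiv (d_y j f) z (horizontal S i z)"
    using 1[of i j] 1[of j i] by linarith
qed

lemma extremal_riemann:
  assumes z: "z \<in> U"
  shows "(\<Sum>k\<in>UNIV. vertical_hessian f i k z * riemann S k j z) =
    (\<Sum>k\<in>UNIV. vertical_hessian f j k z * riemann S k i z)"
proof -
  let ?\<theta> = "\<lambda>i. d_y i f" let ?h = "vertical_hessian f" let ?N = "conn_coeff S" let ?H = "horizontal S"
  let ?D = "\<lambda>g. fderiv g z"
  let ?A = "\<lambda>i j. ?D (\<lambda>x. fderiv (?\<theta> i) x (?H j x)) (S z)"
  have \<theta>: "smooth_on U (d_y i f)" for i using f by (rule smooth_on_d_y)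
  have d\<theta>: "d_y i f differentiable (at z)" for i by (rule smooth_on_differentiable[OF \<theta> z])
  have ddx: "d_x i f differentiable (at z)" for i by (rule smooth_on_differentiable[OF smooth_on_d_x[OF f] z])
  note lin = linear_frechet_derivative[OF d\<theta>]
  have hs: "?h i j z = ?h j i z" for i j by (rule d_y_commute(1)[OF open_U f z])
  have dH: "?H i differentiable (at z)" for i by (rule smooth_on_differentiable[OF smooth_horizontal z])
  \<comment> \<open>\<open>?A i j\<close> is \<Gamma>(H_j \<theta>_i), computed as H_j(\<Gamma>
    \<theta>_i) + [\<Gamma>, H_j] \<theta>_i, where \<Gamma> \<theta>_i = df/dx^i on all of
    \<open>U\<close>. The terms N^k_j H_k \<theta>_i cancel, and besides h_ik R^k_j only terms
    symmetric in i and j survive.\<close>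
  have A: "?A i j = d_x j (d_x i f) z - (\<Sum>k\<in>UNIV. ?N k j z * (\<Sum>l\<in>UNIV. ?N l i z * ?h l k z)) +
      (\<Sum>k\<in>UNIV. ?h i k z * riemann S k j z)" for i j
  proof -
    have br: "?D (?\<theta> i) (coord_bracket S (?H j) z) =
      (\<Sum>k\<in>UNIV. ?N k j z * ?D (?\<theta> i) (?H k z)) + (\<Sum>k\<in>UNIV. ?h i k z * riemann S k j z)"
    proof -
      have sc: "?D (?\<theta> i) (0, c *\<^sub>R b) = c * ?D (?\<theta> i) (0, b)" for c b
        using linear_scale[OF lin, of i c "(0, b)"] by simp
      show ?thesis
        using arg_cong[OF riemann_eq[OF diff_S[OF z] dH[of j] open_U z fst_S], of "?D (?\<theta> i)"]
        by (simp add: linear_add[OF lin] linear_sum[OF lin] linear_scale[OF lin] vertical_def sc d_y_def[symmetric]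
           hs[of i] mult.commute)
    qed
    have "?D (\<lambda>x. fderiv (?\<theta> i) x (S x)) = ?D (d_x i f)"
      by (rule frechet_derivative_cong_open(1)[OF open_U z]) (use el in \<open>simp add: euler_lagrange_def\<close>)
    \<comment> \<open>The identity H_i \<theta>_k = H_k \<theta>_i trades the derivative of
      \<theta>_k for one of \<theta>_i, which is the term that the bracket produces.\<close>
    moreover have "d_x i (d_y k f) z = ?D (?\<theta> i) (?H k z) + (\<Sum>l\<in>UNIV. ?N l i z * ?h l k z)" for k
      using extremal_dyn_cov_deriv(2)[OF z, of i k] by (simp add: frechet_horizontal[OF d\<theta>])
    ultimately have "?D (\<lambda>x. fderiv (?\<theta> i) x (S x)) (?H j z) =
      d_x j (d_x i f) z - ((\<Sum>k\<in>UNIV. ?N k j z * ?D (?\<theta> i) (?H k z)) +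
       (\<Sum>k\<in>UNIV. ?N k j z * (\<Sum>l\<in>UNIV. ?N l i z * ?h l k z)))"
      by (simp add: frechet_horizontal[OF ddx] d_y_commute(2)[OF open_U f z] distrib_left sum.distrib)
    with br coord_bracket_derivative[OF open_U \<theta> z diff_S[OF z] dH, of i j]
    show ?thesis by simp
  qed
  have "?D (\<lambda>x. fderiv (?\<theta> i) x (?H j x)) = ?D (\<lambda>x. fderiv (?\<theta> j) x (?H i x))"
    by (rule frechet_derivative_cong_open(1)[OF open_U z]) (rule extremal_dyn_cov_deriv(2))
  then have "?A i j = ?A j i" by simp
  moreover have "(\<Sum>k\<in>UNIV. ?N k j z * (\<Sum>l\<in>UNIV. ?N l i z * ?h l k z)) =
     (\<Sum>k\<in>UNIV. ?N k i z * (\<Sum>l\<in>UNIV. ?N l j z * ?h l k z))"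
    by (simp add: sum_distrib_left, subst sum.swap, rule sum.cong, simp, rule sum.cong) (simp_all add: hs mult_ac)
  ultimately show ?thesis
    unfolding A using d_y_commute(3)[OF open_U f z, of i j] by simp
qed

end

text \<open>In h_ik W^k_j the trace term contributes a multiple of the symmetric h_ij, and the term
  with y^k is annihilated by h.\<close>

lemma weyl_sym:
  assumes "\<And>i j. h i j z = h j i z" "\<And>i. (\<Sum>j\<in>UNIV. h i j z * snd z $ j) = 0"
    and "\<And>i j. (\<Sum>k\<in>UNIV. h i k z * riemann S k j z) = (\<Sum>k\<in>UNIV. h j k z * riemann S k i z)"
  shows "(\<Sum>k\<in>UNIV. h i k z * weyl S k j z) = (\<Sum>k\<in>UNIV. h j k z * weyl S k i z)"
proof -
  have "(\<Sum>k\<in>UNIV. h i k z * weyl S k j z) =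
    (\<Sum>k\<in>UNIV. h i k z * riemann S k j z) - h i j z * riemann_scalar S z" for i j
  proof -
    have "(\<Sum>k\<in>UNIV. h i k z * weyl S k j z) = (\<Sum>k\<in>UNIV. h i k z * riemann S k j z)
      - (\<Sum>k\<in>UNIV. if k = j then h i k z * riemann_scalar S z else 0)
      - (\<Sum>k\<in>UNIV. h i k z * snd z $ k) * weyl_rho S j z"
      unfolding weyl_def sum_distrib_right sum_subtractf[symmetric]
      by (rule sum.cong) (auto simp: algebra_simps)
    then show ?thesis by (simp add: assms(2))
  qed
  then show ?thesis by (simp only: assms(3)[of i j] assms(1)[of i j])
qed

end

section \<open>Homogeneity and reflection\<close>

definition reflect_vec :: "'n::finite tpoint \<Rightarrow> 'n tpoint" where
  "reflect_vec z = (fst z, - snd z)"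

lemma reflect_vec_simps [simp]: "reflect_vec (a, b) = (a, - b)" "reflect_vec (reflect_vec z) = z"
  "fst (reflect_vec z) = fst z" "snd (reflect_vec z) = - snd z"
  by (auto simp: reflect_vec_def)

lemma bounded_linear_reflect_vec: "bounded_linear reflect_vec"
  unfolding reflect_vec_def[abs_def]
  by (intro bounded_linear_Pair bounded_linear_fst bounded_linear_minus bounded_linear_snd)

lemma has_derivative_reflect_vec: "(reflect_vec has_derivative reflect_vec) (at z)"
  by (rule bounded_linear_imp_has_derivative[OF bounded_linear_reflect_vec])

lemma frechet_derivative_reflect:
  assumes "f differentiable (at (reflect_vec z))"
  shows "((\<lambda>z. f (reflect_vec z)) has_derivative
     (\<lambda>v. fderiv f (reflect_vec z) (reflect_vec v))) (at z)"
  using diff_chain_at[OF has_derivative_reflect_vec frechet_derivative_has[OF assms]] by (simp add: o_def)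

lemma d_y_reflect:
  fixes f :: "'n::finite tpoint \<Rightarrow> real"
  assumes "f differentiable (at (reflect_vec z))"
  shows "d_y i (\<lambda>z. f (reflect_vec z)) z = - d_y i f (reflect_vec z)"
    "d_x i (\<lambda>z. f (reflect_vec z)) z = d_x i f (reflect_vec z)"
  using linear_neg[OF linear_frechet_derivative[OF assms], of "(0, axis i 1)"]
  by (simp_all add: d_y_def d_x_def frechet_derivative_eqI[OF frechet_derivative_reflect[OF assms]])

lemma vertical_field_derivative:
  "((\<lambda>z. (0::'a::real_normed_vector, snd z)) has_derivative (\<lambda>v. (0, snd v))) (at z)"
  by (auto intro!: derivative_eq_intros)

lemma homogeneous_euler:
  fixes f :: "'n::finite tpoint \<Rightarrow> real"
  assumes "f differentiable (at (x, y))" "\<And>k. k > 0 \<Longrightarrow> f (x, k *\<^sub>R y) = k * f (x, y)"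
  shows "fderiv f (x, y) (0, y) = f (x, y)"
proof -
  have "((\<lambda>k. (x, k *\<^sub>R y)) has_derivative (\<lambda>s. (0, s *\<^sub>R y))) (at 1)"
    by (auto intro!: derivative_eq_intros)
  from diff_chain_at[OF this, of f] frechet_derivative_has[OF assms(1)]
  have "((\<lambda>k. f (x, k *\<^sub>R y)) has_derivative (\<lambda>s. fderiv f (x, y) (0, s *\<^sub>R y))) (at 1)"
    by (simp add: o_def)
  moreover have "((\<lambda>k. f (x, k *\<^sub>R y)) has_derivative (\<lambda>s. s * f (x, y))) (at 1)"
    by (rule has_derivative_transform_within_open[of "\<lambda>k. k * f (x, y)" _ _ _ "{0<..}"])
      (auto simp: assms(2) intro!: derivative_eq_intros)
  ultimately have "(\<lambda>s. fderiv f (x, y) (0, s *\<^sub>R y)) = (\<lambda>s. s * f (x, y))"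
    by (rule has_derivative_unique)
  from fun_cong[OF this, of 1] show ?thesis by simp
qed

text \<open>Differentiate \<Delta>(f) = f once more: a derivative in y^i lowers the degree by one, a
  derivative in x^i keeps it. That df/dy^i has degree 0 is the same as the nullity of the fibre
  Hessian in the direction y.\<close>

lemma
  fixes f :: "'n::finite tpoint \<Rightarrow> real"
  assumes U: "open U" and f: "smooth_on U f" and hom: "\<And>z. z \<in> U \<Longrightarrow> fderiv f z (0, snd z) = f z"
    and z: "z \<in> U"
  shows homogeneous_d_y: "fderiv (d_y i f) z (0, snd z) = 0"
    and homogeneous_d_x: "fderiv (d_x i f) z (0, snd z) = d_x i f z"
    and homogeneous_hessian: "(\<Sum>j\<in>UNIV. vertical_hessian f i j z * snd z $ j) = 0"
proof -
  let ?L = "\<lambda>z::'n tpoint. (0::real^'n, snd z)"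
  have L: "?L differentiable (at z)" "fderiv ?L z v = (0, snd v)" for v
    by (auto intro: differentiableI vertical_field_derivative simp: frechet_derivative_eqI[OF vertical_field_derivative])
  have "fderiv f z = fderiv (\<lambda>x. fderiv f x (0, snd x)) z"
    by (rule frechet_derivative_cong_open(1)[OF U z]) (simp add: hom)
  also have "\<dots> = (\<lambda>v. fderiv (\<lambda>x. fderiv f x v) z (0, snd z) +
      fderiv f z (0, snd v))"
    using frechet_derivative_eqI[OF frechet_derivative_field[OF U f z L(1)]] by (simp add: L(2))
  finally have "fderiv f z v =
     fderiv (\<lambda>x. fderiv f x v) z (0, snd z) + fderiv f z (0, snd v)" for v
    by (rule fun_cong)
  from this[of "(0, axis i 1)"] this[of "(axis i 1, 0)"]
  show 1: "fderiv (d_y i f) z (0, snd z) = 0"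
    and "fderiv (d_x i f) z (0, snd z) = d_x i f z"
    using linear_0[OF smooth_on_linear[OF f z]]
    by (simp_all add: d_y_def[abs_def] d_x_def[abs_def] zero_prod_def)
  show "(\<Sum>j\<in>UNIV. vertical_hessian f i j z * snd z $ j) = 0"
    using 1 frechet_vertical[OF smooth_on_differentiable[OF smooth_on_d_y[OF f] z], of i "snd z"]
    by (simp add: d_y_commute(1)[OF U f z, of i] mult.commute)
qed

text \<open>The y^j-derivative of h_ik y^k = 0 reads h_ij + y^k dh_ik/dy^j = 0, and closedness turns
  the last term into \<Delta>(h_ij). Degree -1 is what compensates a change of spray in
  \<open>dyn_cov_deriv_projective\<close>.\<close>

lemma tensor_degree:
  fixes h :: "'n::finite \<Rightarrow> 'n \<Rightarrow> 'n tpoint \<Rightarrow> real"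
  assumes U: "open U" and h: "\<And>i j. smooth_on U (h i j)" and z: "z \<in> U"
    and hy: "\<And>z i. z \<in> U \<Longrightarrow> (\<Sum>j\<in>UNIV. h i j z * snd z $ j) = 0"
    and cl: "\<And>i j k. d_y k (h i j) z = d_y j (h i k) z"
  shows "fderiv (h i j) z (0, snd z) = - h i j z"
proof -
  have hd: "(h i j has_derivative fderiv (h i j) z) (at z)" for i j
    by (rule smooth_on_has_derivative[OF h z])
  have "((\<lambda>z. \<Sum>k\<in>UNIV. h i k z * snd z $ k) has_derivative
    (\<lambda>v. \<Sum>k\<in>UNIV. h i k z * snd v $ k + fderiv (h i k) z v * snd z $ k)) (at z)"
    by (intro has_derivative_sum has_derivative_mult hd bounded_linear_imp_has_derivative
      bounded_linear_compose[OF bounded_linear_vec_nth bounded_linear_snd])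
  moreover have "((\<lambda>z. \<Sum>k\<in>UNIV. h i k z * snd z $ k) has_derivative (\<lambda>v. 0)) (at z)"
    by (rule has_derivative_transform_within_open[OF _ U z, of "\<lambda>_. 0"]) (auto simp: hy)
  ultimately have "(\<lambda>v. \<Sum>k\<in>UNIV. h i k z * snd v $ k + fderiv (h i k) z v * snd z $ k) = (\<lambda>v. 0)"
    by (rule has_derivative_unique)
  from fun_cong[OF this, of "(0, axis j 1)"]
  have "(\<Sum>k\<in>UNIV. h i k z * axis j 1 $ k) + (\<Sum>k\<in>UNIV. d_y j (h i k) z * snd z $ k) = 0"
    by (simp add: sum.distrib d_y_def)
  moreover have "(\<Sum>k\<in>UNIV. h i k z * axis j 1 $ k) = h i j z"
    by (simp add: axis_def if_distrib cong: if_cong)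
  ultimately have "h i j z + (\<Sum>k\<in>UNIV. d_y j (h i k) z * snd z $ k) = 0"
    by simp
  then show ?thesis
    using frechet_vertical[OF smooth_on_differentiable[OF h z], of i j "snd z"]
    by (simp add: cl[of _ i j] mult.commute)
qed

section \<open>Homogeneity, projective changes and reversal\<close>

context local_spray
begin

text \<open>With \<theta>_i = df/dy^i of degree 0, \<Delta>(\<Gamma> \<theta>_i) =
  [\<Delta>, \<Gamma>] \<theta>_i + \<Gamma>(\<Delta> \<theta>_i) = \<Gamma> \<theta>_i, so both
  terms of E_i have degree 1. Euler's relation will recover E_i from its fibre derivatives.\<close>

lemma homogeneous_euler_lagrange:
  assumes f: "smooth_on U f" and hom: "\<And>z. z \<in> U \<Longrightarrow> fderiv f z (0, snd z) = f z"
    and z: "z \<in> U"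
  shows "fderiv (euler_lagrange S f i) z (0, snd z) = euler_lagrange S f i z"
proof -
  let ?L = "\<lambda>z::'n tpoint. (0::real^'n, snd z)"
  let ?\<theta> = "d_y i f"
  have L: "?L differentiable (at z)" using vertical_field_derivative differentiable_def by blast
  have \<theta>: "smooth_on U ?\<theta>" using f by (rule smooth_on_d_y)
  have "fderiv (\<lambda>x. fderiv ?\<theta> x (?L x)) z = (\<lambda>_. 0)"
    using frechet_derivative_cong_open(1)[OF open_U z, of "\<lambda>x. fderiv ?\<theta> x (?L x)" "\<lambda>_. 0"]
      homogeneous_d_y[OF open_U f hom] by simp
  then have 1: "fderiv (\<lambda>x. fderiv ?\<theta> x (S x)) z (0, snd z) =
     fderiv ?\<theta> z (S z)"
    using coord_bracket_derivative[OF open_U \<theta> z L diff_S[OF z]] homogeneous_S[OF z] by simp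
  have sS: "smooth_on U (\<lambda>x. fderiv ?\<theta> x (S x))"
    by (intro smooth_intros \<theta> smooth_S open_U)
  have "(euler_lagrange S f i has_derivative (\<lambda>v. fderiv (\<lambda>x. fderiv ?\<theta> x (S x)) z v -
      fderiv (d_x i f) z v)) (at z)"
    unfolding euler_lagrange_def[abs_def]
    by (intro has_derivative_diff smooth_on_has_derivative[OF sS z] smooth_on_has_derivative[OF smooth_on_d_x[OF f] z])
  then show ?thesis
    by (simp add: frechet_derivative_eqI 1 homogeneous_d_x[OF open_U f hom z]) (simp add: euler_lagrange_def)
qed

text \<open>The fibre derivatives of f have degree 0 and are annihilated by \<Delta>; hence E_i
  belongs to the projective class rather than to a single spray.\<close>

lemma euler_lagrange_shift:
  assumes f: "smooth_on U f" and hom: "\<And>z. z \<in> U \<Longrightarrow> fderiv f z (0, snd z) = f z"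
    and z: "z \<in> U" and S': "S' z = S z - c *\<^sub>R (0, snd z)"
  shows "euler_lagrange S' f i z = euler_lagrange S f i z"
  using homogeneous_d_y[OF open_U f hom z]
  by (simp add: euler_lagrange_def S' linear_diff[OF smooth_on_linear[OF smooth_on_d_y[OF f] z]]
      linear_scale[OF smooth_on_linear[OF smooth_on_d_y[OF f] z]] del: scaleR_Pair)

text \<open>With \<open>B\<^sub>i\<^sub>j\<close> the \<open>y\<^sup>j\<close>-derivative of the \<open>i\<close>-th Euler-Lagrange expression \<open>E\<^sub>i\<close>,
  the derivatives \<open>\<partial>B\<^sub>i\<^sub>j/\<partial>y\<^sup>k\<close> are antisymmetric in \<open>i, j\<close> and symmetric in \<open>j, k\<close>, hence vanish.
  So \<open>B\<^sub>i\<^sub>j\<close> is constant on each fibre; as \<open>E\<^sub>i\<close> is even it is also odd, hence zero.\<close>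

lemma even_euler_lagrange_zero:
  assumes U: "U = W \<times> - {0}" and n: "2 \<le> CARD('n)"
    and f: "smooth_on U f" and hom: "\<And>z. z \<in> U \<Longrightarrow> fderiv f z (0, snd z) = f z"
    and even: "\<And>z. z \<in> U \<Longrightarrow> f (reflect_vec z) = f z"
    and rev: "\<And>z. z \<in> U \<Longrightarrow> - reflect_vec (S (reflect_vec z)) = S z - (2 * \<mu> z) *\<^sub>R (0, snd z)"
    and dyn: "\<And>z i j. z \<in> U \<Longrightarrow> dyn_cov_deriv S (vertical_hessian f) i j z = 0"
    and z: "z \<in> U"
  shows "euler_lagrange S f i z = 0"
proof -
  define E where "E = euler_lagrange S f"
  define B where "B i j = d_y j (E i)" for i j
  have E: "smooth_on U (E i)" for i using smooth_euler_lagrange[OF f] by (simp add: E_def)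
  have B: "smooth_on U (B i j)" for i j using smooth_on_d_y[OF E] by (simp add: B_def)
  have rU: "reflect_vec z \<in> U" if "z \<in> U" for z using that by (auto simp: U)
  have f': "f differentiable (at z)" if "z \<in> U" for z by (rule smooth_on_differentiable[OF f that])
  have \<theta>': "d_y i f differentiable (at z)" if "z \<in> U" for z i by (rule smooth_on_differentiable[OF smooth_on_d_y[OF f] that])
  have odd\<theta>: "d_y i f (reflect_vec z) = - d_y i f z" "d_x i f (reflect_vec z) = d_x i f z" if "z \<in> U" for i z
  proof -
    have "d_y i f z = d_y i (\<lambda>z. f (reflect_vec z)) z" "d_x i f z = d_x i (\<lambda>z. f (reflect_vec z)) z"
      by (rule d_y_cong[OF open_U that] d_x_cong[OF open_U that], simp add: even)+
    then show "d_y i f (reflect_vec z) = - d_y i f z" "d_x i f (reflect_vec z) = d_x i f z"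
      using d_y_reflect[OF f'[OF rU[OF that]], of i] by simp_all
  qed
  have dodd: "fderiv (d_y i f) (reflect_vec z) v = - fderiv (d_y i f) z (reflect_vec v)"
    if "z \<in> U" for i z v
  proof -
    have "((\<lambda>z. - d_y i f (reflect_vec z)) has_derivative
       (\<lambda>v. - fderiv (d_y i f) (reflect_vec z) (reflect_vec v))) (at z)"
      by (intro has_derivative_minus frechet_derivative_reflect \<theta>' rU that)
    then have "(d_y i f has_derivative
       (\<lambda>v. - fderiv (d_y i f) (reflect_vec z) (reflect_vec v))) (at z)"
      by (rule has_derivative_transform_within_open[OF _ open_U that]) (simp add: odd\<theta>)
    then show ?thesis by (simp add: frechet_derivative_eqI)
  qed
  \<comment> \<open>As f is even, E_i at the reflected point is E_i of the reverse spray at z. The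
    reverse spray differs from \<open>S\<close> by a multiple of \<Delta>, which E_i does not
    see.\<close>
  have evenE: "E i (reflect_vec z) = E i z" if zU: "z \<in> U" for i z
  proof -
    have "E i (reflect_vec z) = fderiv (d_y i f) z (- reflect_vec (S (reflect_vec z))) - d_x i f z"
      by (simp add: E_def euler_lagrange_def dodd[OF zU] odd\<theta>[OF zU] linear_neg[OF linear_frechet_derivative[OF \<theta>'[OF zU]]])
    also have "\<dots> = E i z"
      using euler_lagrange_shift[OF f hom zU, of "\<lambda>z. - reflect_vec (S (reflect_vec z))" "2 * \<mu> z" i] rev[OF zU]
      by (simp add: E_def euler_lagrange_def)
    finally show ?thesis .
  qed
  have oddB: "B i j (reflect_vec z) = - B i j z" if zU: "z \<in> U" for i j z
  proof -
    have "B i j z = d_y j (\<lambda>z. E i (reflect_vec z)) z"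
      unfolding B_def by (rule d_y_cong[OF open_U zU]) (simp add: evenE)
    then show ?thesis
      using d_y_reflect(1)[OF smooth_on_differentiable[OF E rU[OF zU]], of j i] by (simp add: B_def)
  qed
  have antiB: "B i j z = - B j i z" if zU: "z \<in> U" for i j z
    using euler_lagrange_derivative[OF f zU] by (simp add: B_def E_def dyn[OF zU])
  have dB: "d_y k (B i j) z = 0" if zU: "z \<in> U" for i j k z
  proof -
    have anti: "d_y k (B i j) z = - d_y k (B j i) z" for i j k
    proof -
      have "d_y k (B i j) z = d_y k (\<lambda>z. - B j i z) z" by (rule d_y_cong[OF open_U zU antiB])
      also have "\<dots> = - d_y k (B j i) z"
        unfolding d_y_def
        using frechet_derivative_eqI[OF has_derivative_minus[OF smooth_on_has_derivative[OF B zU]]] by simp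
      finally show ?thesis .
    qed
    have sym: "d_y k (B i j) z = d_y j (B i k) z" for i j k
      unfolding B_def by (rule d_y_commute(1)[OF open_U E zU])
    show ?thesis
      using sym[of k i j] anti[of j i k] sym[of j k i] anti[of i k j] sym[of i j k] anti[of k j i] by linarith
  qed
  obtain x y where xy: "z = (x, y)" "x \<in> W" "y \<noteq> 0" using z U by auto
  have "B i j (x, a) = B i j (x, b)" if "a \<noteq> 0" "b \<noteq> 0" for i j a b
  proof -
    have con: "connected (- {0::real^'n})" by (rule connected_punctured_universe) (use n in simp)
    have D: "((\<lambda>y. B i j (x, y)) has_derivative (\<lambda>_. 0)) (at y)" if "y \<in> - {0}" for y
    proof -
      have xyU: "(x, y) \<in> U" using that xy U by auto
      have "((\<lambda>y. (x, y)) has_derivative (\<lambda>v. (0, v))) (at y)" by (auto intro!: derivative_eq_intros)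
      from diff_chain_at[OF this smooth_on_has_derivative[OF B xyU]]
      show ?thesis
        by (simp add: o_def frechet_vertical[OF smooth_on_differentiable[OF B xyU]] dB[OF xyU])
    qed
    have "(\<lambda>y. B i j (x, y)) constant_on - {0}"
      by (intro has_derivative_zero_connected_constant_on[of _ "{}"] con)
        (auto intro: has_derivative_at_withinI D continuous_at_imp_continuous_on has_derivative_continuous[OF D])
    then show ?thesis using that unfolding constant_on_def by auto
  qed
  from this[of "-y" y] have "B i j (reflect_vec z) = B i j z" for i j using xy by simp
  with oddB[OF z] have "B i j z = 0" for i j by (metis neg_equal_zero)
  \<comment> \<open>E_i has degree 1, so Euler's relation writes it as B_ij y^j.\<close>
  then show ?thesis
    using homogeneous_euler_lagrange[OF f hom z, of i]
      frechet_vertical[OF smooth_on_differentiable[OF E z], of i "snd z"] by (simp add: B_def E_def)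
qed

text \<open>The coefficients become N^k_l + P \<delta>^k_l + y^k dP/dy^l. The last term is
  annihilated by h, the terms with P subtract 2 P h_ij, and the summand - 2 P \<Delta> of the spray
  adds the same amount, because h has degree -1.\<close>

lemma dyn_cov_deriv_projective:
  fixes h :: "'n \<Rightarrow> 'n \<Rightarrow> 'n tpoint \<Rightarrow> real"
  assumes h: "\<And>i j. smooth_on U (h i j)" and z: "z \<in> U" and sym: "\<And>i j. h j i z = h i j z"
    and hy: "\<And>z i. z \<in> U \<Longrightarrow> (\<Sum>j\<in>UNIV. h i j z * snd z $ j) = 0"
    and cl: "\<And>i j k. d_y k (h i j) z = d_y j (h i k) z"
    and P: "P differentiable (at z)" and S': "\<And>z. z \<in> U \<Longrightarrow> S' z = S z - (2 * P z) *\<^sub>R (0, snd z)"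
  shows "dyn_cov_deriv S' h i j z = dyn_cov_deriv S h i j z"
proof -
  have conn: "conn_coeff S' k l z = conn_coeff S k l z + d_y l P z * snd z $ k + (if k = l then P z else 0)" for k l
  proof -
    have "((\<lambda>u. spray_coeff S k u + P u * snd u $ k) has_derivative
      (\<lambda>v. fderiv (spray_coeff S k) z v +
        (P z * snd v $ k + fderiv P z v * snd z $ k))) (at z)"
      by (intro has_derivative_add has_derivative_mult smooth_on_has_derivative[OF smooth_spray_coeff z]
        frechet_derivative_has[OF P] bounded_linear_imp_has_derivative
        bounded_linear_compose[OF bounded_linear_vec_nth bounded_linear_snd])
    then have "(spray_coeff S' k has_derivative
      (\<lambda>v. fderiv (spray_coeff S k) z v +
        (P z * snd v $ k + fderiv P z v * snd z $ k))) (at z)"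
      by (rule has_derivative_transform_within_open[OF _ open_U z]) (simp add: spray_coeff_def S' field_simps)
    then show ?thesis
      unfolding conn_coeff_def d_y_def by (simp add: frechet_derivative_eqI axis_def)
  qed
  have if_mult: "(if b then c else 0) * d = (if b then c * d else 0)" for b and c d :: real by simp
  have hy': "(\<Sum>k\<in>UNIV. snd z $ k * h k j z) = 0" "(\<Sum>k\<in>UNIV. snd z $ k * h j k z) = 0" for j
    using hy[OF z, of j] by (simp_all add: sym[of _ j] mult.commute)
  have lin: "linear (fderiv (h i j) z)"
    by (rule smooth_on_linear[OF h z])
  have "fderiv (h i j) z (S' z) = fderiv (h i j) z (S z) + 2 * P z * h i j z"
    using tensor_degree[where h = h, OF open_U h z hy cl, of i j]
    by (simp add: S'[OF z] linear_diff[OF lin] linear_scale[OF lin] del: scaleR_Pair)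
  moreover have "(\<Sum>k\<in>UNIV. conn_coeff S' k i z * h k j z) = (\<Sum>k\<in>UNIV. conn_coeff S k i z * h k j z) + P z * h i j z"
    using hy'(1)[of j]
    by (simp add: conn distrib_right sum.distrib if_mult mult.assoc sum_distrib_left[symmetric])
  moreover have "(\<Sum>k\<in>UNIV. conn_coeff S' k j z * h i k z) = (\<Sum>k\<in>UNIV. conn_coeff S k j z * h i k z) + P z * h i j z"
    using hy'(2)[of i]
    by (simp add: conn distrib_right sum.distrib if_mult mult.assoc sum_distrib_left[symmetric])
  ultimately show ?thesis unfolding dyn_cov_deriv_def by simp
qed

text \<open>The connection coefficients of the reverse spray are minus those of \<open>S\<close> at
  the reflected point, and the derivative of the reflected tensor along the reverse spray changes
  sign likewise.\<close>

lemma dyn_cov_deriv_reflect: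
  fixes h :: "'n \<Rightarrow> 'n \<Rightarrow> 'n tpoint \<Rightarrow> real"
  assumes h: "\<And>i j. smooth_on U (h i j)" and z: "reflect_vec z \<in> U"
  shows "dyn_cov_deriv (\<lambda>z. - reflect_vec (S (reflect_vec z))) (\<lambda>i j z. h i j (reflect_vec z)) i j z =
    - dyn_cov_deriv S h i j (reflect_vec z)"
proof -
  let ?S = "\<lambda>z. - reflect_vec (S (reflect_vec z))"
  have "spray_coeff ?S k = (\<lambda>z. spray_coeff S k (reflect_vec z))" for k
    by (simp add: spray_coeff_def fun_eq_iff)
  then have conn: "conn_coeff ?S k l z = - conn_coeff S k l (reflect_vec z)" for k l
    unfolding conn_coeff_def
    by (simp add: d_y_reflect(1)[OF smooth_on_differentiable[OF smooth_spray_coeff z]])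
  have hd: "h i j differentiable (at (reflect_vec z))" by (rule smooth_on_differentiable[OF h z])
  have "reflect_vec (- reflect_vec w) = - w" for w :: "'n tpoint"
    by (simp add: reflect_vec_def prod_eq_iff)
  then have "fderiv (\<lambda>z. h i j (reflect_vec z)) z (?S z) =
     - fderiv (h i j) (reflect_vec z) (S (reflect_vec z))"
    by (simp add: frechet_derivative_eqI[OF frechet_derivative_reflect[OF hd]]
      linear_neg[OF linear_frechet_derivative[OF hd]])
  then show ?thesis unfolding dyn_cov_deriv_def conn by (simp add: sum_negf)
qed

end

text \<open>Subtracting the two Euler-Lagrange equations cancels the x-derivative of f and leaves
  the fibre Hessian applied to the vertical difference of the sprays.\<close>

lemma euler_lagrange_diff:
  assumes "euler_lagrange S f i z = 0" "euler_lagrange S' f i z = 0" "d_y i f differentiable (at z)"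
    "S z - S' z = (0, w)"
  shows "(\<Sum>k\<in>UNIV. d_y k (d_y i f) z * w $ k) = 0"
proof -
  have "fderiv (d_y i f) z (0, w) = 0"
    using assms linear_diff[OF linear_frechet_derivative[OF assms(3)], of "S z" "S' z"]
    by (simp add: euler_lagrange_def)
  then show ?thesis by (simp add: frechet_vertical[OF assms(3)] mult.commute)
qed

section \<open>The potential of an even closed tensor\<close>

abbreviation bilinear_form :: "('n::finite \<Rightarrow> 'n \<Rightarrow> real) \<Rightarrow> real^'n \<Rightarrow> real^'n \<Rightarrow> real" where
  "bilinear_form q u v \<equiv> \<Sum>i\<in>UNIV. \<Sum>j\<in>UNIV. q i j * u $ i * v $ j"

text \<open>The Gram determinant, zero exactly for linearly dependent pairs. Being a polynomial, it
  exhibits independence as an open condition.\<close>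

definition gram :: "'a::real_inner \<Rightarrow> 'a \<Rightarrow> real" where
  "gram u a = (u \<bullet> u) * (a \<bullet> a) - (u \<bullet> a)\<^sup>2"

lemma gram_self [simp]: "gram u u = 0" "gram 0 u = 0" "gram u 0 = 0"
  by (simp_all add: gram_def power2_eq_square)

lemma gram_scaleR: "gram (k *\<^sub>R u) a = k\<^sup>2 * gram u a" "gram u (k *\<^sub>R a) = k\<^sup>2 * gram u a"
  by (simp_all add: gram_def power2_eq_square algebra_simps)

lemma gram_combination: "gram u (s *\<^sub>R u + t *\<^sub>R a) = t\<^sup>2 * gram u a"
  "gram (s *\<^sub>R u + t *\<^sub>R a) a = s\<^sup>2 * gram u a"
  by (simp_all add: gram_def inner_add_left inner_add_right inner_commute power2_eq_square algebra_simps)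

lemma gram_eq_0D:
  assumes "u \<noteq> 0" "gram u a = 0"
  shows "\<exists>t. a = t *\<^sub>R u"
proof -
  define t where "t = (u \<bullet> a) / (u \<bullet> u)"
  have "(a - t *\<^sub>R u) \<bullet> (a - t *\<^sub>R u) = a \<bullet> a - 2 * t * (u \<bullet> a) + t\<^sup>2 * (u \<bullet> u)"
    by (simp add: inner_diff_left inner_diff_right inner_commute power2_eq_square algebra_simps)
  also have "\<dots> = gram u a / (u \<bullet> u)"
    using assms(1) by (simp add: t_def gram_def power2_eq_square field_simps)
  finally show ?thesis using assms(2) by (intro exI[of _ t]) simp
qed

text \<open>Sine and cosine have no common zero, so the circle spanned by an independent pair stays
  in the punctured fibre.\<close>

lemma gram_circle_nonzero:
  assumes "gram u a \<noteq> 0"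
  shows "cos s *\<^sub>R u + sin s *\<^sub>R a \<noteq> 0"
proof
  assume "cos s *\<^sub>R u + sin s *\<^sub>R a = 0"
  then have "(sin s)\<^sup>2 * gram u a = 0" "(cos s)\<^sup>2 * gram u a = 0"
    using gram_combination[where u = u and s = "cos s" and t = "sin s" and a = a] by simp_all
  then show False using assms sin_cos_squared_add[of s] by (metis mult_eq_0_iff add_0 zero_neq_one)
qed

lemma gram_exists:
  fixes u :: "'a::euclidean_space"
  assumes "u \<noteq> 0" "2 \<le> DIM('a)"
  shows "\<exists>a. gram u a \<noteq> 0"
proof -
  obtain a where "a \<noteq> 0" "orthogonal u a" using orthogonal_to_vector_exists[OF assms(2), of u] by blast
  then have "gram u a = (u \<bullet> u) * (a \<bullet> a)" by (simp add: gram_def orthogonal_def)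
  with \<open>a \<noteq> 0\<close> assms(1) have "gram u a \<noteq> 0" by simp
  then show ?thesis ..
qed

text \<open>Pairing a dependent point of the segment with b, which is orthogonal to u, gives two
  nonnegative terms with sum zero. This forces t = 0, where the point is a itself.\<close>

lemma gram_segment:
  assumes "gram u a \<noteq> 0" "b \<noteq> 0" "b \<bullet> u = 0" "0 \<le> a \<bullet> b" "0 \<le> t" "t \<le> 1"
  shows "gram u ((1 - t) *\<^sub>R a + t *\<^sub>R b) \<noteq> 0"
proof
  have u: "u \<noteq> 0" using assms(1) by auto
  assume "gram u ((1 - t) *\<^sub>R a + t *\<^sub>R b) = 0"
  then obtain \<tau> where \<tau>: "(1 - t) *\<^sub>R a + t *\<^sub>R b = \<tau> *\<^sub>R u" using gram_eq_0D[OF u] by meson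
  then have "((1 - t) *\<^sub>R a + t *\<^sub>R b) \<bullet> b = 0" using assms(3) by (simp add: inner_commute)
  then have "(1 - t) * (a \<bullet> b) + t * (b \<bullet> b) = 0" by (simp add: inner_add_left)
  moreover have "0 \<le> (1 - t) * (a \<bullet> b)" "0 \<le> t * (b \<bullet> b)" using assms by simp_all
  ultimately have "t * (b \<bullet> b) = 0" by linarith
  then have "t = 0" using assms(2) by simp
  with \<tau> assms(1) show False by (simp add: gram_scaleR)
qed

section \<open>Odd primitives from half circles, and the potential\<close>

locale closed_tensor =
  fixes W :: "(real^'n::finite) set" and h :: "'n \<Rightarrow> 'n \<Rightarrow> 'n tpoint \<Rightarrow> real"
  assumes open_W: "open W" and card_n: "3 \<le> CARD('n)"
    and smooth_h: "\<And>i j. smooth_on (W \<times> - {0}) (h i j)"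
    and sym_h: "\<And>i j z. z \<in> W \<times> - {0} \<Longrightarrow> h j i z = h i j z"
    and null_h: "\<And>i z. z \<in> W \<times> - {0} \<Longrightarrow> (\<Sum>j\<in>UNIV. h i j z * snd z $ j) = 0"
    and closed_h: "\<And>i j k z. z \<in> W \<times> - {0} \<Longrightarrow> d_y k (h i j) z = d_y j (h i k) z"
    and even_h: "\<And>i j z. z \<in> W \<times> - {0} \<Longrightarrow> h i j (reflect_vec z) = h i j z"
begin

abbreviation U :: "('n tpoint) set" where "U \<equiv> W \<times> - {0}"

lemma open_U: "open U" by (intro open_Times open_W open_Compl closed_singleton)

text \<open>Minus one half of the integral of the closed 1-form \<open>h\<^sub>i\<^sub>j dy\<^sup>j\<close> along the half circle from
  \<open>u\<close> to \<open>- u\<close> through \<open>a\<close>, where \<open>z = (x, u)\<close>: the primitive takes opposite values at the two ends.\<close>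

definition arc_integrand :: "'n \<Rightarrow> (('n tpoint) \<times> (real^'n)) \<times> real \<Rightarrow> real" where
  "arc_integrand i p = (\<Sum>j\<in>UNIV.
     h i j (fst (fst (fst p)), cos (snd p) *\<^sub>R snd (fst (fst p)) + sin (snd p) *\<^sub>R snd (fst p)) *
     (cos (snd p) * snd (fst p) $ j - sin (snd p) * snd (fst (fst p)) $ j))"

definition arc_primitive :: "'n \<Rightarrow> ('n tpoint) \<times> (real^'n) \<Rightarrow> real" where
  "arc_primitive i p = - (integral {0..pi} (\<lambda>s. arc_integrand i (p, s)) / 2)"

text \<open>The auxiliary vector a is kept as a variable: the integral is smooth in x, u and a
  together, and its independence of a becomes a vanishing derivative.\<close>

definition arc_domain :: "(('n tpoint) \<times> (real^'n)) set" where
  "arc_domain = {p. fst (fst p) \<in> W \<and> gram (snd (fst p)) (snd p) \<noteq> 0}"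

lemma arc_domain_iff: "((x, u), a) \<in> arc_domain \<longleftrightarrow> x \<in> W \<and> gram u a \<noteq> 0"
  by (simp add: arc_domain_def)

lemma open_arc_domain: "open arc_domain"
proof -
  have "open ((\<lambda>p. fst (fst p)) -` W \<inter> (\<lambda>p::('n tpoint) \<times> (real^'n). gram (snd (fst p)) (snd p)) -` (- {0}))"
    unfolding gram_def
    by (intro open_Int open_vimage open_W) (auto intro!: continuous_intros open_Compl)
  also have "\<dots> = arc_domain" by (auto simp: arc_domain_def)
  finally show ?thesis .
qed

lemma smooth_arc_integrand: "smooth_on (arc_domain \<times> UNIV) (arc_integrand i)"
proof -
  have o: "open (arc_domain \<times> (UNIV::real set))" by (intro open_Times open_arc_domain) auto
  have "smooth_on (arc_domain \<times> UNIV) (\<lambda>p. h i j (fst (fst (fst p)), cos (snd p) *\<^sub>R snd (fst (fst p)) + sin (snd p) *\<^sub>R snd (fst p)))" for j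
  proof (rule smooth_on_compose[OF smooth_h _ o])
    show "smooth_on (arc_domain \<times> UNIV) (\<lambda>p. (fst (fst (fst p)), cos (snd p) *\<^sub>R snd (fst (fst p)) + sin (snd p) *\<^sub>R snd (fst p)))"
      by (intro smooth_intros o)
  qed (auto simp: arc_domain_def dest: gram_circle_nonzero)
  then show ?thesis
    unfolding arc_integrand_def[abs_def] by (intro smooth_intros o)
qed

lemma smooth_arc_primitive: "smooth_on arc_domain (arc_primitive i)"
proof -
  have "smooth_on arc_domain (\<lambda>p. integral {0..pi} (\<lambda>s. arc_integrand i (p, s)))"
    by (rule smooth_on_integral_param[OF open_arc_domain open_UNIV _ smooth_arc_integrand]) auto
  then show ?thesis unfolding arc_primitive_def[abs_def] by (intro smooth_intros open_arc_domain)
qed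

lemma has_derivative_h:
  "z \<in> U \<Longrightarrow> (h i j has_derivative fderiv (h i j) z) (at z)"
  by (rule smooth_on_has_derivative[OF smooth_h])

text \<open>The derivative of the integrand in the fibre directions is the exact derivative
  \<open>d/ds (h\<^sub>i\<^sub>j(x, \<gamma>(s)) \<delta>\<^sup>j(s))\<close> with \<open>\<gamma> = cos s u + sin s a\<close> and \<open>\<delta> = cos s v + sin s b\<close>.\<close>

lemma arc_primitive_derivative:
  assumes p: "((x, u), a) \<in> arc_domain"
  shows "fderiv (arc_primitive i) ((x, u), a) ((0, v), b) = (\<Sum>j\<in>UNIV. h i j (x, u) * v $ j)"
proof -
  have x: "x \<in> W" and g: "gram u a \<noteq> 0" using p by (auto simp: arc_domain_iff)
  then have u: "u \<noteq> 0" by auto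
  define \<gamma> where "\<gamma> s = cos s *\<^sub>R u + sin s *\<^sub>R a" for s
  define \<gamma>' where "\<gamma>' s = cos s *\<^sub>R a - sin s *\<^sub>R u" for s
  define \<delta> where "\<delta> s = cos s *\<^sub>R v + sin s *\<^sub>R b" for s
  define \<delta>' where "\<delta>' s = cos s *\<^sub>R b - sin s *\<^sub>R v" for s
  have \<gamma>U: "(x, \<gamma> s) \<in> U" for s using gram_circle_nonzero[OF g] x by (simp add: \<gamma>_def)
  let ?Dh = "\<lambda>j s w. fderiv (h i j) (x, \<gamma> s) (0, w)"
  define m' where "m' s = (\<Sum>j\<in>UNIV. ?Dh j s (\<gamma>' s) * \<delta> s $ j + h i j (x, \<gamma> s) * \<delta>' s $ j)" for s
  have d\<gamma>: "((\<lambda>s. (x, \<gamma> s)) has_derivative (\<lambda>t. (0, t *\<^sub>R \<gamma>' s))) (at s)" for s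
    unfolding \<gamma>_def \<gamma>'_def by (auto intro!: derivative_eq_intros simp: algebra_simps)
  have d\<delta>: "((\<lambda>s. \<delta> s $ j) has_derivative (\<lambda>t. t * \<delta>' s $ j)) (at s)" for s j
    unfolding \<delta>_def \<delta>'_def by (auto intro!: derivative_eq_intros simp: algebra_simps)
  have m: "((\<lambda>s. \<Sum>j\<in>UNIV. h i j (x, \<gamma> s) * \<delta> s $ j) has_vector_derivative m' s) (at s)" for s
  proof -
    have 1: "((\<lambda>s. h i j (x, \<gamma> s)) has_derivative (\<lambda>t. t * ?Dh j s (\<gamma>' s))) (at s)" for j
    proof -
      have "fderiv (h i j) (x, \<gamma> s) (0, t *\<^sub>R \<gamma>' s) = t * ?Dh j s (\<gamma>' s)" for t
        using linear_scale[OF smooth_on_linear[OF smooth_h \<gamma>U], of i j s t "(0, \<gamma>' s)"]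
        by simp
      moreover have "((\<lambda>s. h i j (x, \<gamma> s)) has_derivative
        (\<lambda>t. fderiv (h i j) (x, \<gamma> s) (0, t *\<^sub>R \<gamma>' s))) (at s)"
        using diff_chain_at[OF d\<gamma> has_derivative_h[OF \<gamma>U]] by (simp add: o_def)
      ultimately show ?thesis by simp
    qed
    have "((\<lambda>s. \<Sum>j\<in>UNIV. h i j (x, \<gamma> s) * \<delta> s $ j) has_derivative
      (\<lambda>t. \<Sum>j\<in>UNIV. h i j (x, \<gamma> s) * (t * \<delta>' s $ j) + t * ?Dh j s (\<gamma>' s) * \<delta> s $ j)) (at s)"
      by (intro has_derivative_sum has_derivative_mult 1 d\<delta>)
    then show ?thesis
      unfolding has_vector_derivative_def m'_def
      by (rule has_derivative_eq_rhs) (simp add: fun_eq_iff sum_distrib_left algebra_simps)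
  qed
  \<comment> \<open>At s = 0 and s = pi the curve \<gamma> is at u and - u, and \<delta> equals v
    and - v. As h is even, the boundary terms add up to - 2 h_ij v^j, whence the factor - 1/2 in
    \<open>arc_primitive\<close>. They do not contain b, because the sine vanishes at both
    ends.\<close>
  have "(m' has_integral (\<Sum>j\<in>UNIV. h i j (x, \<gamma> pi) * \<delta> pi $ j) - (\<Sum>j\<in>UNIV. h i j (x, \<gamma> 0) * \<delta> 0 $ j)) {0..pi}"
    by (rule fundamental_theorem_of_calculus) (auto intro: has_vector_derivative_at_within m)
  moreover have "h i j (x, - u) = h i j (x, u)" for j using even_h[of "(x, u)" i j] x u by simp
  ultimately have int: "integral {0..pi} m' = - 2 * (\<Sum>j\<in>UNIV. h i j (x, u) * v $ j)"
    by (simp add: \<gamma>_def \<delta>_def integral_unique sum_negf)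
  have "fderiv (arc_integrand i) (((x, u), a), s) (((0, v), b), 0) = m' s" for s
  proof -
    let ?q = "\<lambda>p::(('n tpoint) \<times> (real^'n)) \<times> real.
      (fst (fst (fst p)), cos (snd p) *\<^sub>R snd (fst (fst p)) + sin (snd p) *\<^sub>R snd (fst p))"
    let ?P = "(((x, u), a), s)"
    have q: "(?q has_derivative (\<lambda>d. (fst (fst (fst d)),
       cos s *\<^sub>R snd (fst (fst d)) + sin s *\<^sub>R snd (fst d) + snd d *\<^sub>R \<gamma>' s))) (at ?P)"
      unfolding \<gamma>'_def by (auto intro!: derivative_eq_intros simp: algebra_simps)
    have 1: "((\<lambda>p. h i j (?q p)) has_derivative (\<lambda>d. fderiv (h i j) (x, \<gamma> s)
      (fst (fst (fst d)), cos s *\<^sub>R snd (fst (fst d)) + sin s *\<^sub>R snd (fst d) + snd d *\<^sub>R \<gamma>' s))) (at ?P)" for j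
      using diff_chain_at[OF q, of "h i j"] has_derivative_h[OF \<gamma>U, of i j s] by (simp add: o_def \<gamma>_def)
    have 2: "((\<lambda>p. cos (snd p) * snd (fst p) $ j - sin (snd p) * snd (fst (fst p)) $ j) has_derivative
      (\<lambda>d. cos s * snd (fst d) $ j - sin s * snd (fst (fst d)) $ j - snd d * \<gamma> s $ j)) (at ?P)" for j
    proof -
      have "((\<lambda>p. cos (snd p) *\<^sub>R snd (fst p) - sin (snd p) *\<^sub>R snd (fst (fst p))) has_derivative
        (\<lambda>d. cos s *\<^sub>R snd (fst d) - sin s *\<^sub>R snd (fst (fst d)) - snd d *\<^sub>R \<gamma> s)) (at ?P)"
        unfolding \<gamma>_def by (auto intro!: derivative_eq_intros simp: algebra_simps)
      from bounded_linear.has_derivative[OF bounded_linear_vec_nth[of j] this] show ?thesis by simp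
    qed
    have "(arc_integrand i has_derivative (\<lambda>d. \<Sum>j\<in>UNIV.
        h i j (?q ?P) * (cos s * snd (fst d) $ j - sin s * snd (fst (fst d)) $ j - snd d * \<gamma> s $ j) +
        fderiv (h i j) (x, \<gamma> s)
         (fst (fst (fst d)), cos s *\<^sub>R snd (fst (fst d)) + sin s *\<^sub>R snd (fst d) + snd d *\<^sub>R \<gamma>' s) *
        (cos (snd ?P) * snd (fst ?P) $ j - sin (snd ?P) * snd (fst (fst ?P)) $ j))) (at ?P)"
      unfolding arc_integrand_def[abs_def] by (intro has_derivative_sum has_derivative_mult 1 2)
    then have "fderiv (arc_integrand i) ?P (((0, v), b), 0) =
       (\<Sum>j\<in>UNIV. h i j (x, \<gamma> s) * \<delta>' s $ j + ?Dh j s (\<delta> s) * \<gamma>' s $ j)"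
      by (simp add: frechet_derivative_eqI \<gamma>_def \<gamma>'_def \<delta>_def \<delta>'_def)
    also have "\<dots> = (\<Sum>j\<in>UNIV. h i j (x, \<gamma> s) * \<delta>' s $ j) + (\<Sum>j\<in>UNIV. ?Dh j s (\<delta> s) * \<gamma>' s $ j)"
      by (simp add: sum.distrib)
    \<comment> \<open>Closedness exchanges the direction of differentiation with the contracted
      index, which turns the sum into the matching one in m'.\<close>
    also have "(\<Sum>j\<in>UNIV. ?Dh j s (\<delta> s) * \<gamma>' s $ j) = (\<Sum>j\<in>UNIV. ?Dh j s (\<gamma>' s) * \<delta> s $ j)"
    proof -
      have "(\<Sum>j\<in>UNIV. ?Dh j s (\<delta> s) * \<gamma>' s $ j) =
        (\<Sum>j\<in>UNIV. \<Sum>k\<in>UNIV. \<delta> s $ k * d_y k (h i j) (x, \<gamma> s) * \<gamma>' s $ j)"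
        by (simp add: frechet_vertical[OF smooth_on_differentiable[OF smooth_h \<gamma>U]] sum_distrib_right)
      also have "\<dots> = (\<Sum>k\<in>UNIV. \<Sum>j\<in>UNIV. \<delta> s $ k * d_y j (h i k) (x, \<gamma> s) * \<gamma>' s $ j)"
        by (subst sum.swap) (intro sum.cong refl, simp only: closed_h[OF \<gamma>U, symmetric])
      also have "\<dots> = (\<Sum>j\<in>UNIV. ?Dh j s (\<gamma>' s) * \<delta> s $ j)"
        by (simp add: frechet_vertical[OF smooth_on_differentiable[OF smooth_h \<gamma>U]] sum_distrib_left sum_distrib_right mult_ac)
      finally show ?thesis .
    qed
    finally show ?thesis by (simp add: m'_def sum.distrib)
  qed
  moreover have "((\<lambda>p. integral {0..pi} (\<lambda>s. arc_integrand i (p, s))) has_derivative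
     (\<lambda>d. integral {0..pi} (\<lambda>s. fderiv (arc_integrand i) (((x, u), a), s) (d, 0)))) (at ((x, u), a))"
    by (rule has_derivative_integral_param[OF open_arc_domain open_UNIV _ _ p])
      (use smooth_arc_integrand[unfolded smooth_on_def] in blast)+
  from has_derivative_minus[OF has_derivative_divide'[OF this has_derivative_const[of "2::real"]]]
  have "(arc_primitive i has_derivative
     (\<lambda>d. - (integral {0..pi} (\<lambda>s. fderiv (arc_integrand i) (((x, u), a), s) (d, 0)) / 2))) (at ((x, u), a))"
    by (simp add: arc_primitive_def[abs_def])
  ultimately show ?thesis by (simp add: frechet_derivative_eqI int)
qed

text \<open>The derivative of \<open>arc_primitive\<close> in the direction of the auxiliary vector
  is zero, and by \<open>gram_segment\<close> the segment stays in the domain.\<close>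

lemma arc_primitive_segment:
  assumes x: "x \<in> W" and g: "gram u a \<noteq> 0" and b: "b \<noteq> 0" "b \<bullet> u = 0" "0 \<le> a \<bullet> b"
  shows "arc_primitive i ((x, u), a) = arc_primitive i ((x, u), b)"
proof -
  let ?f = "\<lambda>t. arc_primitive i ((x, u), (1 - t) *\<^sub>R a + t *\<^sub>R b)"
  have "(?f has_derivative (\<lambda>_. 0)) (at t within {0..1})" if "t \<in> {0..1}" for t
  proof -
    have p: "((x, u), (1 - t) *\<^sub>R a + t *\<^sub>R b) \<in> arc_domain"
      using gram_segment[OF g b] that x by (simp add: arc_domain_iff)
    have "((\<lambda>t. ((x, u), (1 - t) *\<^sub>R a + t *\<^sub>R b)) has_derivative (\<lambda>s. ((0, 0), s *\<^sub>R (b - a)))) (at t)"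
      by (auto intro!: derivative_eq_intros simp: algebra_simps zero_prod_def)
    from diff_chain_at[OF this smooth_on_has_derivative[OF smooth_arc_primitive p]]
    have "(?f has_derivative (\<lambda>_. 0)) (at t)" by (simp add: o_def arc_primitive_derivative[OF p])
    then show ?thesis by (rule has_derivative_at_withinI)
  qed
  then obtain c where "\<And>t. t \<in> {0..1} \<Longrightarrow> ?f t = c"
    using has_derivative_zero_constant[of "{0..1}" ?f] by auto
  from this[of 0] this[of 1] show ?thesis by simp
qed

text \<open>Here n >= 3 enters: u and a do not span the fibre, so some nonzero b is orthogonal to
  both, and its sign can be chosen such that it does not point away from a'. Then a and a' are both
  joined to this vector by admissible segments.\<close>

lemma arc_primitive_indep:
  assumes x: "x \<in> W" and g: "gram u a \<noteq> 0" "gram u a' \<noteq> 0"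
  shows "arc_primitive i ((x, u), a) = arc_primitive i ((x, u), a')"
proof -
  have "dim {u, a} \<le> card {u, a}" by (rule dim_le_card) (auto simp: span_superset)
  also have "\<dots> \<le> 2" by (simp add: card_insert_if)
  finally have "dim {u, a} < DIM(real^'n)" using card_n by simp
  then obtain b where b: "b \<noteq> 0" "\<And>y. y \<in> span {u, a} \<Longrightarrow> orthogonal b y"
    using orthogonal_to_subspace_exists by blast
  then have "orthogonal b u" "orthogonal b a" by (auto intro: span_base)
  then have bu: "b \<bullet> u = 0" "a \<bullet> b = 0" by (simp_all add: orthogonal_def inner_commute)
  define b' where "b' = (if 0 \<le> a' \<bullet> b then b else - b)"
  have "b' \<noteq> 0" "b' \<bullet> u = 0" "0 \<le> a \<bullet> b'" "0 \<le> a' \<bullet> b'" using b bu by (auto simp: b'_def)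
  then show ?thesis using arc_primitive_segment[OF x g(1)] arc_primitive_segment[OF x g(2)] by metis
qed

definition primitive :: "'n \<Rightarrow> 'n tpoint \<Rightarrow> real" where
  "primitive i z = arc_primitive i (z, SOME a. gram (snd z) a \<noteq> 0)"

lemma primitive_eq:
  assumes "fst z \<in> W" "gram (snd z) a \<noteq> 0"
  shows "primitive i z = arc_primitive i (z, a)"
proof -
  have "gram (snd z) (SOME a. gram (snd z) a \<noteq> 0) \<noteq> 0" using assms(2) by (rule someI)
  from arc_primitive_indep[OF assms(1) this assms(2)] show ?thesis by (simp add: primitive_def)
qed

text \<open>Near a given point one auxiliary vector serves all points, as independence is an open
  condition. This removes the choice made by \<open>SOME\<close>, so that smoothness and derivatives
  pass from \<open>arc_primitive\<close> to \<open>primitive\<close>.\<close>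

lemma primitive_nbhd:
  assumes "z \<in> U"
  obtains a T where "open T" "z \<in> T" "T \<subseteq> U" "\<And>z. z \<in> T \<Longrightarrow> (z, a) \<in> arc_domain"
    "\<And>i z. z \<in> T \<Longrightarrow> primitive i z = arc_primitive i (z, a)"
proof -
  have "snd z \<noteq> 0" using assms by auto
  then obtain a where a: "gram (snd z) a \<noteq> 0" using gram_exists[where u = "snd z"] card_n by auto
  define T where "T = (\<lambda>z. (z, a)) -` arc_domain"
  have "open T" unfolding T_def by (intro open_vimage open_arc_domain) (auto intro!: continuous_intros)
  moreover have "z \<in> T" "T \<subseteq> U" using assms a by (auto simp: T_def arc_domain_def)
  ultimately show ?thesis using that[of T a] primitive_eq by (auto simp: T_def arc_domain_def)
qed

lemma smooth_primitive: "smooth_on U (primitive i)"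
proof (rule smooth_on_locally)
  fix z assume "z \<in> U"
  then obtain a T where T: "open T" "z \<in> T" "\<And>z. z \<in> T \<Longrightarrow> (z, a) \<in> arc_domain"
    "\<And>i z. z \<in> T \<Longrightarrow> primitive i z = arc_primitive i (z, a)" by (rule primitive_nbhd) blast
  have "smooth_on T (\<lambda>z. arc_primitive i (z, a))"
    by (rule smooth_on_compose[OF smooth_arc_primitive]) (use T in \<open>auto intro!: smooth_intros\<close>)
  then have "smooth_on T (primitive i)" using smooth_on_cong[OF T(1), of "primitive i" "\<lambda>z. arc_primitive i (z, a)"] T(4) by simp
  then show "\<exists>T. open T \<and> z \<in> T \<and> smooth_on T (primitive i)" using T by blast
qed

lemma d_y_primitive:
  assumes z: "z \<in> U"
  shows "d_y j (primitive i) z = h i j z"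
proof -
  obtain a T where T: "open T" "z \<in> T" "\<And>z. z \<in> T \<Longrightarrow> (z, a) \<in> arc_domain"
    "\<And>i z. z \<in> T \<Longrightarrow> primitive i z = arc_primitive i (z, a)" using z by (rule primitive_nbhd) blast
  obtain x u where xu: "z = (x, u)" by (cases z)
  have p: "((x, u), a) \<in> arc_domain" using T xu by auto
  have "((\<lambda>z. (z, a)) has_derivative (\<lambda>v. (v, 0))) (at z)" by (auto intro!: derivative_eq_intros)
  from diff_chain_at[OF this smooth_on_has_derivative[OF smooth_arc_primitive]] T
  have "((\<lambda>z. arc_primitive i (z, a)) has_derivative (\<lambda>v. fderiv (arc_primitive i) (z, a) (v, 0))) (at z)"
    by (simp add: o_def)
  then have "(primitive i has_derivative (\<lambda>v. fderiv (arc_primitive i) (z, a) (v, 0))) (at z)"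
    by (rule has_derivative_transform_within_open[OF _ T(1,2)]) (simp add: T)
  then have "d_y j (primitive i) z = (\<Sum>k\<in>UNIV. h i k (x, u) * axis j 1 $ k)"
    using arc_primitive_derivative[OF p] by (simp add: d_y_def frechet_derivative_eqI xu)
  then show ?thesis by (simp add: xu axis_def if_distrib cong: if_cong)
qed

text \<open>The half circle of (- u, - a) is antipodal to that of (u, a): the even h has the same
  values there and the velocity is reversed, so the integral changes sign.\<close>

lemma primitive_odd:
  assumes z: "z \<in> U"
  shows "primitive i (reflect_vec z) = - primitive i z"
proof -
  obtain x u where xu: "z = (x, u)" "x \<in> W" "u \<noteq> 0" using z by auto
  then obtain a where a: "gram u a \<noteq> 0" using gram_exists[where u = u] card_n by auto
  have a': "gram (-u) (-a) \<noteq> 0" using a by (simp add: gram_def)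
  have "h i j (x, - (cos s *\<^sub>R u) - sin s *\<^sub>R a) = h i j (x, cos s *\<^sub>R u + sin s *\<^sub>R a)" for j s
    using even_h[of "(x, cos s *\<^sub>R u + sin s *\<^sub>R a)" i j] xu gram_circle_nonzero[OF a] by simp
  then have "arc_integrand i (((x, - u), - a), s) = - arc_integrand i (((x, u), a), s)" for s
    by (simp add: arc_integrand_def sum_negf[symmetric] algebra_simps)
  then show ?thesis
    using primitive_eq[of "(x, u)" a i] primitive_eq[of "(x, -u)" "-a" i] a a' xu
    by (simp add: arc_primitive_def)
qed

text \<open>Euler's relation read backwards: a function of degree 1 with fibre derivatives
  \<theta>_i must be y^i \<theta>_i.\<close>

definition potential :: "'n tpoint \<Rightarrow> real" where
  "potential z = (\<Sum>i\<in>UNIV. snd z $ i * primitive i z)"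

lemma smooth_potential: "smooth_on U potential"
  unfolding potential_def[abs_def] by (intro smooth_intros smooth_primitive open_U)

lemma potential_even: "z \<in> U \<Longrightarrow> potential (reflect_vec z) = potential z"
  by (simp add: potential_def primitive_odd)

text \<open>The product rule also produces y^i h_ik v^k, which vanishes by symmetry and
  nullity.\<close>

lemma potential_derivative:
  assumes z: "z \<in> U"
  shows "fderiv potential z (0, v) = (\<Sum>i\<in>UNIV. v $ i * primitive i z)"
proof -
  have "(potential has_derivative (\<lambda>v. \<Sum>i\<in>UNIV. snd z $ i * fderiv (primitive i) z v + snd v $ i * primitive i z)) (at z)"
    unfolding potential_def[abs_def]
    by (intro has_derivative_sum has_derivative_mult smooth_on_has_derivative[OF smooth_primitive z]
      bounded_linear_imp_has_derivative bounded_linear_compose[OF bounded_linear_vec_nth bounded_linear_snd])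
  then have "fderiv potential z (0, v) =
    (\<Sum>i\<in>UNIV. snd z $ i * (\<Sum>k\<in>UNIV. v $ k * h i k z)) + (\<Sum>i\<in>UNIV. v $ i * primitive i z)"
    by (simp add: frechet_derivative_eqI sum.distrib
      frechet_vertical[OF smooth_on_differentiable[OF smooth_primitive z]] d_y_primitive[OF z])
  also have "(\<Sum>i\<in>UNIV. snd z $ i * (\<Sum>k\<in>UNIV. v $ k * h i k z)) = (\<Sum>k\<in>UNIV. v $ k * (\<Sum>i\<in>UNIV. h k i z * snd z $ i))"
    unfolding sum_distrib_left by (subst sum.swap) (intro sum.cong refl, simp add: sym_h[OF z] mult_ac)
  finally show ?thesis by (simp add: null_h[OF z])
qed

lemma d_y_potential: "z \<in> U \<Longrightarrow> d_y j potential z = primitive j z"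
  by (simp add: d_y_def potential_derivative) (simp add: axis_def if_distrib if_distribR cong: if_cong)

lemma hessian_potential: "z \<in> U \<Longrightarrow> vertical_hessian potential i j z = h i j z"
  using d_y_cong[OF open_U, of z "d_y j potential" "primitive j" i] by (simp add: d_y_potential d_y_primitive sym_h)

lemma potential_euler: "z \<in> U \<Longrightarrow> fderiv potential z (0, snd z) = potential z"
  by (simp add: potential_derivative potential_def)

text \<open>Contracting the free index with u leaves a scalar: h at \<gamma>(s), evaluated on u and
  the velocity. Its sign gives positivity, and its invariance makes the potentials of different
  charts agree.\<close>

abbreviation arc_form :: "real^'n \<Rightarrow> real^'n \<Rightarrow> real^'n \<Rightarrow> real \<Rightarrow> real" where
  "arc_form x u a s \<equiv>
     bilinear_form (\<lambda>i j. h i j (x, cos s *\<^sub>R u + sin s *\<^sub>R a)) u (cos s *\<^sub>R a - sin s *\<^sub>R u)"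

lemma potential_arc:
  assumes x: "x \<in> W" and g: "gram u a \<noteq> 0"
  shows "potential (x, u) = - (integral {0..pi} (\<lambda>s. arc_form x u a s) / 2)"
    and "continuous_on {0..pi} (\<lambda>s. arc_form x u a s)"
proof -
  have c: "continuous_on {0..pi} (\<lambda>s. arc_integrand i (((x, u), a), s))" for i
    by (rule continuous_on_compose2[OF smooth_on_continuous_on[OF smooth_arc_integrand]])
      (use x g in \<open>auto intro!: continuous_intros simp: arc_domain_iff\<close>)
  have eq: "arc_form x u a s =
     (\<Sum>i\<in>UNIV. u $ i * arc_integrand i (((x, u), a), s))" for s
    by (simp add: arc_integrand_def sum_distrib_left mult_ac)
  show "continuous_on {0..pi} (\<lambda>s. arc_form x u a s)"
    unfolding eq by (intro continuous_intros c)
  have "integral {0..pi} (\<lambda>s. \<Sum>i\<in>UNIV. u $ i * arc_integrand i (((x, u), a), s)) =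
     (\<Sum>i\<in>UNIV. u $ i * integral {0..pi} (\<lambda>s. arc_integrand i (((x, u), a), s)))"
    by (subst integral_sum) (auto intro!: integrable_continuous_real continuous_intros c)
  then show "potential (x, u) = - (integral {0..pi} (\<lambda>s. arc_form x u a s) / 2)"
    unfolding eq using primitive_eq[of "(x, u)" a] x g
    by (simp add: potential_def arc_primitive_def sum_negf sum_divide_distrib)
qed

text \<open>From u + sin s \<gamma>'(s) = cos s \<gamma>(s) and the nullity of h along \<gamma>(s)
  one obtains sin s h(u, \<gamma>') = - h(u, u), with h taken at \<gamma>(s). So the integrand is
  negative where 0 < s < pi, and the factor - 1/2 makes the potential positive.\<close>

lemma potential_pos:
  assumes z: "z \<in> U"
    and nonneg: "\<And>z v. z \<in> U \<Longrightarrow> 0 \<le> bilinear_form (\<lambda>i j. h i j z) v v"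
    and null: "\<And>z v. z \<in> U \<Longrightarrow> bilinear_form (\<lambda>i j. h i j z) v v = 0 \<Longrightarrow> \<exists>a. v = a *\<^sub>R snd z"
  shows "0 < potential z"
proof -
  obtain x u where xu: "z = (x, u)" "x \<in> W" "u \<noteq> 0" using z by auto
  then obtain a where a: "gram u a \<noteq> 0" using gram_exists[where u = u] card_n by auto
  let ?\<gamma> = "\<lambda>s. cos s *\<^sub>R u + sin s *\<^sub>R a"
  let ?Q = "arc_form x u a"
  let ?q = "\<lambda>s. bilinear_form (\<lambda>i j. h i j (x, ?\<gamma> s)) u u"
  have \<gamma>U: "(x, ?\<gamma> s) \<in> U" for s using gram_circle_nonzero[OF a] xu by simp
  have eq: "sin s * ?Q s = - ?q s" for s
  proof -
    have "?q s + sin s * ?Q s = cos s * (\<Sum>i\<in>UNIV. u $ i * (\<Sum>j\<in>UNIV. h i j (x, ?\<gamma> s) * ?\<gamma> s $ j))"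
      unfolding sum_distrib_left sum.distrib[symmetric]
    proof (intro sum.cong refl)
      fix i j
      have "u $ j = (cos s)\<^sup>2 * u $ j + (sin s)\<^sup>2 * u $ j"
        by (metis distrib_right mult_1 sin_cos_squared_add2)
      show "h i j (x, ?\<gamma> s) * u $ i * u $ j + sin s * (h i j (x, ?\<gamma> s) * u $ i * (cos s *\<^sub>R a - sin s *\<^sub>R u) $ j) =
        cos s * (u $ i * (h i j (x, ?\<gamma> s) * ?\<gamma> s $ j))"
        using arg_cong[OF \<open>u $ j = _\<close>, of "\<lambda>t. h i j (x, ?\<gamma> s) * u $ i * t"]
        by (simp add: power2_eq_square algebra_simps)
    qed
    then show ?thesis using null_h[OF \<gamma>U[of s]] by simp
  qed
  have q: "0 < ?q s" if "sin s \<noteq> 0" for s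
  proof -
    have "?q s \<noteq> 0"
    proof
      assume "?q s = 0"
      then obtain t where "u = t *\<^sub>R ?\<gamma> s" using null[OF \<gamma>U[of s], of u] by auto
      then have "gram u (?\<gamma> s) = 0" by (metis gram_scaleR(1) gram_self(1) mult_zero_right)
      then show False using gram_combination(1)[where u = u and s = "cos s" and t = "sin s" and a = a] a that by simp
    qed
    then show ?thesis using nonneg[OF \<gamma>U[of s], of u] by linarith
  qed
  have Q: "?Q s \<le> 0" if "s \<in> {0..pi}" for s
  proof (cases "sin s = 0")
    \<comment> \<open>At the ends the identity cannot be divided by sin s; there u = cos s
      \<gamma>(s) itself lies in the kernel of h.\<close>
    case True
    then have "(cos s)\<^sup>2 = 1" using sin_cos_squared_add[of s] by simp
    then have "cos s * cos s = 1" by (simp add: power2_eq_square)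
    then have u: "u = cos s *\<^sub>R ?\<gamma> s" using True by simp
    have "?Q s = (\<Sum>j\<in>UNIV. (cos s * (\<Sum>i\<in>UNIV. h j i (x, ?\<gamma> s) * ?\<gamma> s $ i)) * (cos s *\<^sub>R a - sin s *\<^sub>R u) $ j)"
      unfolding sum_distrib_left sum_distrib_right
      by (subst sum.swap, subst (2) u) (intro sum.cong refl, simp add: sym_h[OF \<gamma>U])
    then show ?thesis using null_h[OF \<gamma>U[of s]] by simp
  next
    case False
    then have "0 < sin s" using that by (metis atLeastAtMost_iff less_eq_real_def sin_ge_zero)
    then show ?thesis using eq[of s] q[OF False] mult_pos_pos[of "sin s" "?Q s"] by linarith
  qed
  have cont: "continuous_on {0..pi} (\<lambda>s. - ?Q s)"
    by (intro continuous_on_minus potential_arc(2) xu a)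
  have "integral {0..pi} (\<lambda>s. - ?Q s) \<noteq> 0"
  proof
    assume 0: "integral {0..pi} (\<lambda>s. - ?Q s) = 0"
    from integral_eq_0_iff[OF cont] Q 0 have all: "\<forall>s\<in>{0..pi}. - ?Q s = 0" by force
    \<comment> \<open>A nonnegative continuous integrand with integral zero vanishes everywhere, but
      at pi / 2, where the sine is 1, it is positive.\<close>
    have "pi / 2 \<in> {0..pi}" by simp
    from bspec[OF all this] have Q0: "?Q (pi/2) = 0" by linarith
    have "?q (pi/2) = - (sin (pi/2) * ?Q (pi/2))" using eq[of "pi/2"] by linarith
    also have "\<dots> = 0" unfolding Q0 by (simp only: mult_zero_right minus_zero)
    finally have "?q (pi/2) = 0" .
    moreover have "0 < ?q (pi/2)" by (rule q) simp
    ultimately show False by linarith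
  qed
  moreover have "0 \<le> integral {0..pi} (\<lambda>s. - ?Q s)"
    by (rule integral_nonneg[OF integrable_continuous_real[OF cont]]) (use Q in force)
  ultimately have "0 < integral {0..pi} (\<lambda>s. - ?Q s)" by linarith
  moreover have "potential z = integral {0..pi} (\<lambda>s. - ?Q s) / 2"
    using potential_arc(1)[OF xu(2) a] by (simp add: xu)
  ultimately show ?thesis by simp
qed

text \<open>By Euler's relation F(x, t y) / t has derivative zero for t > 0; evenness carries the
  result over to negative factors.\<close>

lemma potential_homogeneous:
  assumes z: "(x, y) \<in> U" and k: "k \<noteq> 0"
  shows "potential (x, k *\<^sub>R y) = \<bar>k\<bar> * potential (x, y)"
proof -
  let ?f = "\<lambda>t. potential (x, t *\<^sub>R y) / t"
  have D: "(?f has_derivative (\<lambda>_. 0)) (at t)" if "t > 0" for t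
  proof -
    have zU: "(x, t *\<^sub>R y) \<in> U" using z that by auto
    have lin: "linear (fderiv potential (x, t *\<^sub>R y))"
      by (rule smooth_on_linear[OF smooth_potential zU])
    have "((\<lambda>t. (x, t *\<^sub>R y)) has_derivative (\<lambda>s. (0, s *\<^sub>R y))) (at t)" by (auto intro!: derivative_eq_intros)
    from diff_chain_at[OF this smooth_on_has_derivative[OF smooth_potential zU]]
    have "((\<lambda>t. potential (x, t *\<^sub>R y)) has_derivative (\<lambda>s. fderiv potential (x, t *\<^sub>R y) (0, s *\<^sub>R y))) (at t)"
      by (simp add: o_def)
    moreover have "fderiv potential (x, t *\<^sub>R y) (0, s *\<^sub>R y) = s * potential (x, t *\<^sub>R y) / t" for s
      using potential_euler[OF zU] linear_scale[OF lin, of "s / t" "(0, t *\<^sub>R y)"] that by simp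
    ultimately have "((\<lambda>t. potential (x, t *\<^sub>R y)) has_derivative (\<lambda>s. s * potential (x, t *\<^sub>R y) / t)) (at t)" by simp
    from has_derivative_divide'[OF this has_derivative_ident] that
    show ?thesis by (auto elim!: has_derivative_eq_rhs simp: field_simps)
  qed
  have pos: "potential (x, t *\<^sub>R y) = t * potential (x, y)" if "t > 0" for t
  proof -
    have "?f constant_on {0<..}"
      by (rule has_derivative_zero_connected_constant_on[of _ "{}"])
        (auto intro: has_derivative_at_withinI D continuous_at_imp_continuous_on has_derivative_continuous[OF D])
    then have "?f t = ?f 1" using that unfolding constant_on_def by (metis greaterThan_iff zero_less_one)
    then show ?thesis using that by (simp add: field_simps)
  qed
  show ?thesis
  proof (cases "k > 0")
    case False
    then have "potential (x, k *\<^sub>R y) = potential (x, (- k) *\<^sub>R y)"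
      using potential_even[of "(x, k *\<^sub>R y)"] z k by simp
    then show ?thesis using pos[of "- k"] False k by simp
  qed (simp add: pos)
qed

end

section \<open>Averaging a multiplier over the reflection\<close>

abbreviation even_part ::
    "('n \<Rightarrow> 'n \<Rightarrow> 'n::finite tpoint \<Rightarrow> real) \<Rightarrow> 'n \<Rightarrow> 'n \<Rightarrow> 'n tpoint \<Rightarrow> real" where
  "even_part h \<equiv> \<lambda>i j z. (h i j z + h i j (reflect_vec z)) / 2"

text \<open>The reflected tensor satisfies \<nabla>h = 0 for the reverse spray, which by
  \<open>rev\<close> differs from \<open>S\<close> by a multiple of \<Delta>.
  \<open>dyn_cov_deriv_projective\<close> brings this back to \<open>S\<close>, and the conditions
  are linear in h.\<close>

lemma (in local_spray) even_part_properties: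
  fixes h :: "'n \<Rightarrow> 'n \<Rightarrow> 'n tpoint \<Rightarrow> real"
  assumes U: "U = W \<times> - {0}"
    and h: "\<And>i j. smooth_on U (h i j)" and sym: "\<And>i j z. z \<in> U \<Longrightarrow> h j i z = h i j z"
    and hy: "\<And>z i. z \<in> U \<Longrightarrow> (\<Sum>j\<in>UNIV. h i j z * snd z $ j) = 0"
    and cl: "\<And>i j k z. z \<in> U \<Longrightarrow> d_y k (h i j) z = d_y j (h i k) z"
    and dyn: "\<And>i j z. z \<in> U \<Longrightarrow> dyn_cov_deriv S h i j z = 0"
    and \<mu>: "smooth_on U \<mu>"
    and rev: "\<And>z. z \<in> U \<Longrightarrow> - reflect_vec (S (reflect_vec z)) = S z - (2 * \<mu> z) *\<^sub>R (0, snd z)"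
    and z: "z \<in> U"
  shows "smooth_on U (even_part h i j)"
    and "(\<Sum>j\<in>UNIV. even_part h i j z * snd z $ j) = 0"
    and "d_y k (even_part h i j) z = d_y j (even_part h i k) z"
    and "dyn_cov_deriv S (even_part h) i j z = 0"
proof -
  have rU: "reflect_vec z \<in> U" if "z \<in> U" for z using that by (auto simp: U)
  let ?r = "\<lambda>i j z. h i j (reflect_vec z)"
  have r: "smooth_on U (?r i j)" for i j
    by (rule smooth_on_compose[OF h smooth_on_bounded_linear[OF bounded_linear_reflect_vec] open_U]) (use rU in auto)
  show "smooth_on U (even_part h i j)" by (intro smooth_intros h r open_U)
  have ry: "(\<Sum>j\<in>UNIV. ?r i j z * snd z $ j) = 0" if "z \<in> U" for i z
    using hy[OF rU[OF that], of i] by (simp add: sum_negf)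
  show "(\<Sum>j\<in>UNIV. even_part h i j z * snd z $ j) = 0"
    using hy[OF z, of i] ry[OF z, of i]
    by (simp add: add_divide_distrib distrib_right sum.distrib sum_divide_distrib[symmetric])
  have rcl: "d_y k (?r i j) z = d_y j (?r i k) z" if "z \<in> U" for i j k z
    using cl[OF rU[OF that], of k i j] by (simp add: d_y_reflect[OF smooth_on_differentiable[OF h rU[OF that]]])
  have D: "(even_part h i j has_derivative (\<lambda>v. (fderiv (h i j) z v + fderiv (?r i j) z v) / 2)) (at z)" for i j
    by (intro bounded_linear.has_derivative[OF bounded_linear_divide] has_derivative_add
      smooth_on_has_derivative[OF h z] smooth_on_has_derivative[OF r z])
  note D = frechet_derivative_eqI[OF D]
  show "d_y k (even_part h i j) z = d_y j (even_part h i k) z"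
    using rcl[OF z, of k i j] cl[OF z, of k i j] by (simp add: d_y_def D)
  have "dyn_cov_deriv S ?r i j z = dyn_cov_deriv (\<lambda>z. - reflect_vec (S (reflect_vec z))) ?r i j z"
    by (rule dyn_cov_deriv_projective[symmetric, where P = \<mu>])
      (use r z ry rcl rev sym rU smooth_on_differentiable[OF \<mu> z] in auto)
  also have "\<dots> = 0" using dyn_cov_deriv_reflect[OF h rU[OF z]] dyn[OF rU[OF z]] by simp
  finally have "dyn_cov_deriv S ?r i j z = 0" .
  moreover have "dyn_cov_deriv S (even_part h) i j z = (dyn_cov_deriv S h i j z + dyn_cov_deriv S ?r i j z) / 2"
    unfolding dyn_cov_deriv_def D
    by (simp add: add_divide_distrib diff_divide_distrib distrib_left sum.distrib sum_divide_distrib)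
  ultimately show "dyn_cov_deriv S (even_part h) i j z = 0" using dyn[OF z] by simp
qed

section \<open>Atlases\<close>

text \<open>Stated abstractly because it is instantiated twice: by the charts of the manifold and by
  the canonical charts of the slit tangent bundle.\<close>

locale smooth_atlas =
  fixes A :: "('m, 'e::euclidean_space) chart set"
  assumes inj_coord: "c \<in> A \<Longrightarrow> inj_on (coord c) (dom_chart c)"
    and open_overlap: "c \<in> A \<Longrightarrow> d \<in> A \<Longrightarrow> open (coord c ` (dom_chart c \<inter> dom_chart d))"
    and smooth_transition: "c \<in> A \<Longrightarrow> d \<in> A \<Longrightarrow>
      smooth_on (coord c ` (dom_chart c \<inter> dom_chart d)) (coord d \<circ> coord_inv c)"
begin

definition jac :: "('m, 'e) chart \<Rightarrow> ('m, 'e) chart \<Rightarrow> 'm \<Rightarrow> 'e \<Rightarrow> 'e" where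
  "jac c d p = fderiv (coord d \<circ> coord_inv c) (coord c p)"

lemma coord_inv_coord: "c \<in> A \<Longrightarrow> p \<in> dom_chart c \<Longrightarrow> coord_inv c (coord c p) = p"
  unfolding coord_inv_def by (rule inv_into_f_f[OF inj_coord])

lemma coord_coord_inv: "z \<in> coord_range c \<Longrightarrow> coord c (coord_inv c z) = z"
  unfolding coord_range_def coord_inv_def by (simp add: f_inv_into_f)

lemma coord_in_range: "p \<in> dom_chart c \<Longrightarrow> coord c p \<in> coord_range c"
  by (simp add: coord_range_def)

lemma open_range: "c \<in> A \<Longrightarrow> open (coord_range c)"
  using open_overlap[of c c] by (simp add: coord_range_def)

lemma has_derivative_transition:
  assumes "c \<in> charts_at A p" "d \<in> charts_at A p"
  shows "(coord d \<circ> coord_inv c has_derivative jac c d p) (at (coord c p))"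
  unfolding jac_def
  by (rule smooth_on_has_derivative[OF smooth_transition]) (use assms in \<open>auto simp: charts_at_def\<close>)

lemma linear_jac: "c \<in> charts_at A p \<Longrightarrow> d \<in> charts_at A p \<Longrightarrow> linear (jac c d p)"
  using has_derivative_transition has_derivative_linear by blast

lemma jac_self:
  assumes "c \<in> charts_at A p"
  shows "jac c c p v = v"
proof -
  have c: "c \<in> A" "p \<in> dom_chart c" using assms by (auto simp: charts_at_def)
  have "(coord c \<circ> coord_inv c has_derivative (\<lambda>v. v)) (at (coord c p))"
    by (rule has_derivative_transform_within_open[OF has_derivative_ident open_range[OF c(1)] coord_in_range[OF c(2)]])
      (simp add: coord_coord_inv)
  from fun_cong[OF has_derivative_unique[OF this has_derivative_transition[OF assms assms]], of v]
  show ?thesis by simp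
qed

text \<open>The chain rule for coordinate changes. This cocycle property makes
  \<open>tangent_vec\<close> a consistent family of components.\<close>

lemma jac_comp:
  assumes c: "c \<in> charts_at A p" and d: "d \<in> charts_at A p" and e: "e \<in> charts_at A p"
  shows "jac d e p (jac c d p v) = jac c e p v"
proof -
  let ?S = "coord c ` (dom_chart c \<inter> dom_chart d)"
  have A: "c \<in> A" "d \<in> A" "e \<in> A" "p \<in> dom_chart c" "p \<in> dom_chart d" "p \<in> dom_chart e"
    using assms by (auto simp: charts_at_def)
  have "(coord e \<circ> coord_inv d has_derivative jac d e p) (at ((coord d \<circ> coord_inv c) (coord c p)))"
    using has_derivative_transition[OF d e] A by (simp add: coord_inv_coord)
  from diff_chain_at[OF has_derivative_transition[OF c d] this]
  have 1: "((coord e \<circ> coord_inv d) \<circ> (coord d \<circ> coord_inv c) has_derivative jac d e p \<circ> jac c d p) (at (coord c p))" .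
  have 2: "(coord e \<circ> coord_inv c has_derivative jac d e p \<circ> jac c d p) (at (coord c p))"
    by (rule has_derivative_transform_within_open[OF 1 open_overlap[OF A(1,2)]])
      (use A in \<open>auto simp: coord_inv_coord\<close>)
  from fun_cong[OF has_derivative_unique[OF 2 has_derivative_transition[OF c e]], of v]
  show ?thesis by simp
qed

lemma tangent_space_iff:
  "v \<in> tangent_space A p \<longleftrightarrow> (\<forall>c\<in>charts_at A p. \<forall>d\<in>charts_at A p. v d = jac c d p (v c)) \<and>
     (\<forall>c. c \<notin> charts_at A p \<longrightarrow> v c = 0)"
  by (simp add: tangent_space_def jac_def)

lemma tangent_jac: "v \<in> tangent_space A p \<Longrightarrow> c \<in> charts_at A p \<Longrightarrow> d \<in> charts_at A p \<Longrightarrow> v d = jac c d p (v c)"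
  unfolding tangent_space_iff by blast

lemma tangentI:
  "(\<And>c d. c \<in> charts_at A p \<Longrightarrow> d \<in> charts_at A p \<Longrightarrow> v d = jac c d p (v c)) \<Longrightarrow>
    (\<And>c. c \<notin> charts_at A p \<Longrightarrow> v c = 0) \<Longrightarrow> v \<in> tangent_space A p"
  unfolding tangent_space_iff by blast

lemma tangent_outside: "v \<in> tangent_space A p \<Longrightarrow> c \<notin> charts_at A p \<Longrightarrow> v c = 0"
  unfolding tangent_space_iff by blast

definition tangent_vec :: "('m, 'e) chart \<Rightarrow> 'm \<Rightarrow> 'e \<Rightarrow> ('m, 'e) chart \<Rightarrow> 'e" where
  "tangent_vec c p y = (\<lambda>d. if d \<in> charts_at A p then jac c d p y else 0)"

lemma tangent_vec:
  assumes "c \<in> charts_at A p"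
  shows "tangent_vec c p y \<in> tangent_space A p" "tangent_vec c p y c = y"
  by (rule tangentI) (use assms in \<open>simp_all add: tangent_vec_def jac_comp jac_self\<close>)

lemma tangent_ext:
  assumes "v \<in> tangent_space A p" "w \<in> tangent_space A p" "c \<in> charts_at A p" "v c = w c"
  shows "v = w"
proof
  fix d show "v d = w d"
    using tangent_jac[OF assms(1,3)] tangent_jac[OF assms(2,3)] tangent_outside[OF assms(1)] tangent_outside[OF assms(2)] assms(4)
    by (cases "d \<in> charts_at A p") auto
qed

lemma zero_tangent: "(\<lambda>_. 0) \<in> tangent_space A p"
  by (rule tangentI) (simp_all add: linear_0[OF linear_jac])

lemma tangent_nonzero:
  assumes "v \<in> tangent_space A p" "c \<in> charts_at A p"
  shows "v c \<noteq> 0 \<longleftrightarrow> v \<noteq> (\<lambda>_. 0)"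
  using tangent_ext[OF assms(1) zero_tangent assms(2)] by auto

lemma scale_tangent: "v \<in> tangent_space A p \<Longrightarrow> (\<lambda>c. k *\<^sub>R v c) \<in> tangent_space A p"
  by (rule tangentI) (simp_all add: linear_scale[OF linear_jac] tangent_outside flip: tangent_jac)

lemma jac_eq_0_iff:
  assumes "c \<in> charts_at A p" "d \<in> charts_at A p"
  shows "jac c d p y = 0 \<longleftrightarrow> y = 0"
  using jac_comp[OF assms assms(1), of y] jac_self[OF assms(1), of y]
    linear_0[OF linear_jac[OF assms]] linear_0[OF linear_jac[OF assms(2,1)]] by auto

end

lemma smooth_manifold_atlas:
  assumes "smooth_manifold X A"
  shows "smooth_atlas A"
proof
  fix c assume c: "c \<in> A"
  have on: "openin X (dom_chart c)" "open (coord_range c)"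
    and hom: "homeomorphic_map (subtopology X (dom_chart c)) (top_of_set (coord_range c)) (coord c)" if "c \<in> A" for c
    using assms that by (auto simp: smooth_manifold_def chart_on_def)
  have top: "topspace (subtopology X (dom_chart c)) = dom_chart c"
    using openin_subset[OF on(1)[OF c]] by auto
  show "inj_on (coord c) (dom_chart c)"
    using homeomorphic_imp_injective_map[OF hom[OF c]] top by simp
  fix d assume d: "d \<in> A"
  have "openin (subtopology X (dom_chart c)) (dom_chart c \<inter> dom_chart d)"
    using on(1)[OF d] by (auto simp: openin_subtopology_Int2)
  then have "openin (top_of_set (coord_range c)) (coord c ` (dom_chart c \<inter> dom_chart d))"
    using homeomorphic_imp_open_map[OF hom[OF c]] by (simp add: open_map_def)
  then show "open (coord c ` (dom_chart c \<inter> dom_chart d))"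
    using on(2)[OF c] by (metis openin_open_eq)
  show "smooth_on (coord c ` (dom_chart c \<inter> dom_chart d)) (coord d \<circ> coord_inv c)"
    using assms c d by (auto simp: smooth_manifold_def compatible_def)
qed

section \<open>Canonical coordinates on the slit tangent bundle\<close>

locale slit_atlas = smooth_atlas A for A :: "('m, real^'n::finite) chart set"
begin

lemma dom_canonical: "w \<in> dom_chart (canonical A c) \<longleftrightarrow> w \<in> slit A \<and> fst w \<in> dom_chart c"
  and coord_canonical: "coord (canonical A c) w = (coord c (fst w), snd w c)"
  by (auto simp: canonical_def)

lemma slitD:
  assumes "w \<in> slit A"
  shows "snd w \<in> tangent_space A (fst w)" "c \<in> charts_at A (fst w) \<Longrightarrow> snd w c \<noteq> 0"
  using assms tangent_nonzero[of "snd w" "fst w" c] by (auto simp: slit_def)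

lemma slit_component_nonzero: "w \<in> slit A \<Longrightarrow> c \<in> A \<Longrightarrow> fst w \<in> dom_chart c \<Longrightarrow> snd w c \<noteq> 0"
  by (rule slitD(2)) (simp_all add: charts_at_def)

lemma slitI: "c \<in> charts_at A p \<Longrightarrow> v \<in> tangent_space A p \<Longrightarrow> v c \<noteq> 0 \<Longrightarrow> (p, v) \<in> slit A"
  by (auto simp: slit_def carrier_of_def charts_at_def)

lemma slit_chart: "w \<in> slit A \<Longrightarrow> \<exists>c. c \<in> charts_at A (fst w)"
  by (auto simp: slit_def carrier_of_def charts_at_def)

text \<open>Each nonzero component vector occurs, because \<open>tangent_vec\<close> extends it to
  all charts. The half circles and the connectedness argument rely on having whole punctured
  fibres.\<close>

lemma range_canonical:
  assumes c: "c \<in> A"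
  shows "coord_range (canonical A c) = coord_range c \<times> - {0::real^'n}"
proof
  show "coord_range (canonical A c) \<subseteq> coord_range c \<times> - {0::real^'n}"
    using slit_component_nonzero[OF _ c] unfolding coord_range_def
    by (intro image_subsetI) (simp add: dom_canonical coord_canonical)
  show "coord_range c \<times> - {0::real^'n} \<subseteq> coord_range (canonical A c)"
  proof
    fix z assume "z \<in> coord_range c \<times> - {0::real^'n}"
    then obtain p y where z: "z = (coord c p, y)" "p \<in> dom_chart c" "y \<noteq> 0" by (auto simp: coord_range_def)
    then have ca: "c \<in> charts_at A p" using c by (simp add: charts_at_def)
    have "(p, tangent_vec c p y) \<in> slit A"
      using tangent_vec[OF ca, of y] z(3) by (intro slitI[OF ca]) auto
    then show "z \<in> coord_range (canonical A c)"
      using z tangent_vec(2)[OF ca, of y] unfolding coord_range_def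
      by (intro image_eqI[of _ _ "(p, tangent_vec c p y)"]) (auto simp: dom_canonical coord_canonical)
  qed
qed

lemma inj_canonical:
  assumes c: "c \<in> A"
  shows "inj_on (coord (canonical A c)) (dom_chart (canonical A c))"
proof (rule inj_onI)
  fix v w assume vw: "v \<in> dom_chart (canonical A c)" "w \<in> dom_chart (canonical A c)"
    "coord (canonical A c) v = coord (canonical A c) w"
  then have "fst v = fst w" using inj_onD[OF inj_coord[OF c]] by (auto simp: dom_canonical coord_canonical)
  moreover have "snd v = snd w"
    using vw c calculation slitD(1)[of v] slitD(1)[of w]
    by (intro tangent_ext[of "snd v" "fst v" "snd w" c]) (auto simp: dom_canonical coord_canonical charts_at_def)
  ultimately show "v = w" by (rule prod_eqI)
qed

lemma canonical_coord_inv: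
  "c \<in> A \<Longrightarrow> w \<in> dom_chart (canonical A c) \<Longrightarrow> coord_inv (canonical A c) (coord (canonical A c) w) = w"
  unfolding coord_inv_def by (rule inv_into_f_f[OF inj_canonical])

lemma canonical_coord_inv_simps:
  assumes "c \<in> A" "z \<in> coord_range (canonical A c)"
  shows "coord c (fst (coord_inv (canonical A c) z)) = fst z" "snd (coord_inv (canonical A c) z) c = snd z"
    "coord_inv (canonical A c) z \<in> slit A" "c \<in> charts_at A (fst (coord_inv (canonical A c) z))"
    "fst (coord_inv (canonical A c) z) = coord_inv c (fst z)"
proof -
  have 1: "coord (canonical A c) (coord_inv (canonical A c) z) = z" "coord_inv (canonical A c) z \<in> dom_chart (canonical A c)"
    using assms unfolding coord_range_def coord_inv_def by (simp_all add: f_inv_into_f inv_into_into)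
  then show 2: "coord c (fst (coord_inv (canonical A c) z)) = fst z" "snd (coord_inv (canonical A c) z) c = snd z"
    "coord_inv (canonical A c) z \<in> slit A" "c \<in> charts_at A (fst (coord_inv (canonical A c) z))"
    using assms(1) by (auto simp: coord_canonical dom_canonical charts_at_def prod_eq_iff)
  show "fst (coord_inv (canonical A c) z) = coord_inv c (fst z)"
    using coord_inv_coord[OF assms(1)] 2 by (metis (no_types, lifting) charts_at_def mem_Collect_eq)
qed

lemma canonical_overlap:
  assumes "c \<in> A" "d \<in> A"
  shows "coord (canonical A c) ` (dom_chart (canonical A c) \<inter> dom_chart (canonical A d)) =
    coord c ` (dom_chart c \<inter> dom_chart d) \<times> - {0::real^'n}" (is "?L = ?R")
proof
  show "?L \<subseteq> ?R"
    using slit_component_nonzero[OF _ assms(1)]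
    by (intro image_subsetI) (simp add: dom_canonical coord_canonical)
  show "?R \<subseteq> ?L"
  proof
    fix z assume z: "z \<in> ?R"
    then have r: "z \<in> coord_range (canonical A c)"
      unfolding range_canonical[OF assms(1)] by (auto simp: coord_range_def)
    let ?w = "coord_inv (canonical A c) z"
    have "fst ?w \<in> dom_chart c \<inter> dom_chart d"
      using z canonical_coord_inv_simps(5)[OF assms(1) r] coord_inv_coord[OF assms(1)] by auto
    then show "z \<in> ?L"
      using canonical_coord_inv_simps[OF assms(1) r]
      by (intro image_eqI[of _ _ ?w]) (auto simp: dom_canonical coord_canonical)
  qed
qed

lemma canonical_transition:
  assumes "c \<in> A" "d \<in> A" "x \<in> coord c ` (dom_chart c \<inter> dom_chart d)" "y \<noteq> 0"
  shows "(coord (canonical A d) \<circ> coord_inv (canonical A c)) (x, y) =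
    ((coord d \<circ> coord_inv c) x, fderiv (coord d \<circ> coord_inv c) x y)"
proof -
  have r: "(x, y) \<in> coord_range (canonical A c)"
    using assms unfolding range_canonical[OF assms(1)] by (auto simp: coord_range_def)
  let ?w = "coord_inv (canonical A c) (x, y)"
  have d: "d \<in> charts_at A (fst ?w)"
    using assms canonical_coord_inv_simps(5)[OF assms(1) r] coord_inv_coord[OF assms(1)] by (auto simp: charts_at_def)
  note w = canonical_coord_inv_simps[OF assms(1) r]
  have "snd ?w d = jac c d (fst ?w) (snd ?w c)"
    by (rule tangent_jac[OF slitD(1)[OF w(3)] w(4) d])
  then show ?thesis using w by (simp add: coord_canonical jac_def)
qed

lemma smooth_canonical_transition:
  assumes c: "c \<in> A" and d: "d \<in> A"
  shows "smooth_on (coord c ` (dom_chart c \<inter> dom_chart d) \<times> - {0::real^'n}) (coord (canonical A d) \<circ> coord_inv (canonical A c))"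
proof -
  let ?S = "coord c ` (dom_chart c \<inter> dom_chart d)" let ?\<phi> = "coord d \<circ> coord_inv c"
  let ?U = "?S \<times> - {0::real^'n}"
  have o: "open ?U" by (intro open_Times open_overlap c d open_Compl closed_singleton)
  note s\<phi> = smooth_transition[OF c d]
  have f: "smooth_on ?U (fst :: 'n tpoint \<Rightarrow> _)" by (rule smooth_on_bounded_linear[OF bounded_linear_fst])
  have "smooth_on ?U (\<lambda>z. ?\<phi> (fst z))"
    by (rule smooth_on_compose[OF s\<phi> f o]) auto
  moreover have "smooth_on ?U (\<lambda>z. fderiv ?\<phi> (fst z) b)" for b
    by (rule smooth_on_compose[OF smooth_on_frechet[OF s\<phi>] f o]) auto
  ultimately have "smooth_on ?U (\<lambda>z. (?\<phi> (fst z), \<Sum>b\<in>Basis. (snd z \<bullet> b) *\<^sub>R fderiv ?\<phi> (fst z) b))"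
    by (intro smooth_on_Pair smooth_on_sum smooth_on_scaleR smooth_on_inner smooth_on_snd smooth_on_id smooth_on_const o)
  moreover have "(coord (canonical A d) \<circ> coord_inv (canonical A c)) z =
      (?\<phi> (fst z), \<Sum>b\<in>Basis. (snd z \<bullet> b) *\<^sub>R fderiv ?\<phi> (fst z) b)" if "z \<in> ?U" for z
    using that canonical_transition[OF c d, of "fst z" "snd z"]
      linear_expand_Basis[OF smooth_on_linear[OF s\<phi>], of "fst z" "snd z"]
    by (simp add: mem_Times_iff)
  ultimately show ?thesis using smooth_on_cong[OF o] by (metis (no_types, lifting))
qed

sublocale slit: smooth_atlas "slit_charts A"
proof
  fix b assume "b \<in> slit_charts A"
  then obtain c where c: "c \<in> A" "b = canonical A c" by (auto simp: slit_charts_def)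
  show "inj_on (coord b) (dom_chart b)" unfolding c(2) by (rule inj_canonical[OF c(1)])
  fix b' assume "b' \<in> slit_charts A"
  then obtain d where d: "d \<in> A" "b' = canonical A d" by (auto simp: slit_charts_def)
  show "open (coord b ` (dom_chart b \<inter> dom_chart b'))"
    unfolding c(2) d(2) canonical_overlap[OF c(1) d(1)]
    by (intro open_Times open_overlap c d open_Compl closed_singleton)
  show "smooth_on (coord b ` (dom_chart b \<inter> dom_chart b')) (coord b' \<circ> coord_inv b)"
    unfolding c(2) d(2) canonical_overlap[OF c(1) d(1)] by (rule smooth_canonical_transition[OF c(1) d(1)])
qed

lemma charts_at_slit: "w \<in> slit A \<Longrightarrow> charts_at (slit_charts A) w = canonical A ` charts_at A (fst w)"
  by (auto simp: charts_at_def slit_charts_def dom_canonical)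

lemma carrier_slit: "carrier_of (slit_charts A) = slit A"
proof
  show "carrier_of (slit_charts A) \<subseteq> slit A" by (auto simp: carrier_of_def slit_charts_def dom_canonical)
  show "slit A \<subseteq> carrier_of (slit_charts A)"
  proof
    fix w assume w: "w \<in> slit A"
    then obtain c where "c \<in> charts_at A (fst w)" using slit_chart by blast
    then have "w \<in> dom_chart (canonical A c)" "canonical A c \<in> slit_charts A"
      using w by (simp_all add: dom_canonical charts_at_def slit_charts_def)
    then show "w \<in> carrier_of (slit_charts A)" unfolding carrier_of_def by blast
  qed
qed

text \<open>The coordinate change (\<phi>(x), D\<phi>(x) y) has a block triangular derivative. The
  two facts recorded here involve only D\<phi>, not its derivative: base components and vertical
  vectors both transform by the Jacobian of the base.\<close>

lemma slit_jac:
  assumes w: "w \<in> slit A" and c: "c \<in> charts_at A (fst w)" and d: "d \<in> charts_at A (fst w)"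
  shows "fst (slit.jac (canonical A c) (canonical A d) w v) = jac c d (fst w) (fst v)"
    and "slit.jac (canonical A c) (canonical A d) w (0, b) = (0, jac c d (fst w) b)"
proof -
  let ?T = "coord (canonical A d) \<circ> coord_inv (canonical A c)" let ?\<phi> = "coord d \<circ> coord_inv c"
  let ?S = "coord c ` (dom_chart c \<inter> dom_chart d)"
  let ?x = "coord c (fst w)" let ?y = "snd w c"
  have A: "c \<in> A" "d \<in> A" using c d by (auto simp: charts_at_def)
  have z: "coord (canonical A c) w = (?x, ?y)" by (simp add: coord_canonical)
  have xy: "?x \<in> ?S" "?y \<noteq> 0" using slitD(2)[OF w c] c d by (auto simp: charts_at_def)
  have o: "open ?S" by (rule open_overlap[OF A])
  have ch: "canonical A c \<in> charts_at (slit_charts A) w" "canonical A d \<in> charts_at (slit_charts A) w"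
    using charts_at_slit[OF w] c d by auto
  have D: "(?T has_derivative slit.jac (canonical A c) (canonical A d) w) (at (?x, ?y))"
    using slit.has_derivative_transition[OF ch] by (simp add: coord_canonical)
  have 1: "((\<lambda>z. fst (?T z)) has_derivative (\<lambda>v. fst (slit.jac (canonical A c) (canonical A d) w v))) (at (?x, ?y))"
    by (rule has_derivative_fst[OF D])
  have "(fst has_derivative fst) (at (?x, ?y))" by (rule bounded_linear_imp_has_derivative[OF bounded_linear_fst])
  from diff_chain_at[OF this, of ?\<phi>] has_derivative_transition[OF c d]
  have "((\<lambda>z. ?\<phi> (fst z)) has_derivative (\<lambda>v. jac c d (fst w) (fst v))) (at (?x, ?y))" by (simp add: o_def)
  then have "((\<lambda>z. fst (?T z)) has_derivative (\<lambda>v. jac c d (fst w) (fst v))) (at (?x, ?y))"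
  proof (rule has_derivative_transform_within_open[of _ _ _ _ "?S \<times> - {0::real^'n}"])
    show "open (?S \<times> - {0::real^'n})" by (intro open_Times o open_Compl closed_singleton)
    show "?\<phi> (fst z) = fst (?T z)" if "z \<in> ?S \<times> - {0::real^'n}" for z
      using that canonical_transition[OF A, of "fst z" "snd z"] by (simp add: mem_Times_iff del: o_apply)
  qed (use xy in simp)
  from fun_cong[OF has_derivative_unique[OF 1 this], of v]
  show "fst (slit.jac (canonical A c) (canonical A d) w v) = jac c d (fst w) (fst v)" .
  have "((\<lambda>y. (?x, y)) has_derivative (\<lambda>b. (0, b))) (at ?y)" by (auto intro!: derivative_eq_intros)
  from diff_chain_at[OF this D]
  have 2: "((\<lambda>y. ?T (?x, y)) has_derivative (\<lambda>b. slit.jac (canonical A c) (canonical A d) w (0, b))) (at ?y)"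
    by (simp add: o_def)
  have bl: "bounded_linear (jac c d (fst w))" using has_derivative_transition[OF c d] by (rule has_derivative_bounded_linear)
  have "((\<lambda>y. (?\<phi> ?x, jac c d (fst w) y)) has_derivative (\<lambda>b. (0, jac c d (fst w) b))) (at ?y)"
    by (intro has_derivative_Pair has_derivative_const bounded_linear_imp_has_derivative bl)
  then have "((\<lambda>y. ?T (?x, y)) has_derivative (\<lambda>b. (0, jac c d (fst w) b))) (at ?y)"
    by (rule has_derivative_transform_within_open[of _ _ _ _ "- {0::real^'n}"])
      (use xy o canonical_transition[OF A xy(1)] in \<open>auto simp del: o_apply intro!: open_Compl simp: jac_def\<close>)
  from fun_cong[OF has_derivative_unique[OF 2 this], of b]
  show "slit.jac (canonical A c) (canonical A d) w (0, b) = (0, jac c d (fst w) b)" .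
qed

end

section \<open>Sprays on the slit tangent bundle\<close>

lemma dyn_cov_deriv_cong:
  assumes "open U" "z \<in> U" "\<And>i j u. u \<in> U \<Longrightarrow> h i j u = k i j u"
  shows "dyn_cov_deriv S h i j z = dyn_cov_deriv S k i j z"
proof -
  have "fderiv (h i j) z = fderiv (k i j) z"
    by (rule frechet_derivative_cong_open(1)[OF assms(1,2)]) (rule assms(3))
  then show ?thesis by (simp add: dyn_cov_deriv_def assms(2,3))
qed

section \<open>Strong convexity and quasi-definiteness on one fibre\<close>

lemma quadratic_expand:
  fixes v :: "real^'n::finite"
  shows "bilinear_form (\<lambda>i j. f * h i j + \<theta> i * \<theta> j) v v =
    f * bilinear_form h v v + (\<Sum>i\<in>UNIV. \<theta> i * v $ i)\<^sup>2"
  by (simp add: power2_eq_square sum_product sum_distrib_left sum.distrib[symmetric] algebra_simps)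

text \<open>As \<theta>(y) = f, the vector u = v - (\<theta>(v) / f) y lies in the kernel of
  \<theta>. On it the convexity form is f h(u, u), and h(u, u) = h(v, v) because h annihilates
  y.\<close>

lemma quasi_definite_of_strongly_convex:
  fixes v y :: "real^'n::finite"
  assumes convex: "\<And>v. v \<noteq> 0 \<Longrightarrow> 0 < bilinear_form (\<lambda>i j. f * h i j + \<theta> i * \<theta> j) v v"
    and f: "0 < f" "(\<Sum>i\<in>UNIV. \<theta> i * y $ i) = f"
    and hy: "\<And>i. (\<Sum>j\<in>UNIV. h i j * y $ j) = 0" and sym: "\<And>i j. h j i = h i j"
  shows "0 \<le> bilinear_form h v v"
    and "bilinear_form h v v = 0 \<Longrightarrow> \<exists>a. v = a *\<^sub>R y"
proof -
  let ?q = "\<lambda>v. bilinear_form h v v"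
  define a where "a = (\<Sum>i\<in>UNIV. \<theta> i * v $ i) / f"
  define u where "u = v - a *\<^sub>R y"
  have hu: "(\<Sum>j\<in>UNIV. h i j * u $ j) = (\<Sum>j\<in>UNIV. h i j * v $ j)" for i
  proof -
    have "(\<Sum>j\<in>UNIV. h i j * u $ j) = (\<Sum>j\<in>UNIV. h i j * v $ j) - a * (\<Sum>j\<in>UNIV. h i j * y $ j)"
      by (simp add: u_def sum_subtractf sum_distrib_left algebra_simps)
    then show ?thesis by (simp add: hy)
  qed
  have "?q u = (\<Sum>i\<in>UNIV. u $ i * (\<Sum>j\<in>UNIV. h i j * u $ j))"
    by (simp add: sum_distrib_left mult_ac)
  also have "\<dots> = (\<Sum>i\<in>UNIV. \<Sum>j\<in>UNIV. u $ i * (h i j * v $ j))" unfolding hu by (simp add: sum_distrib_left)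
  also have "\<dots> = (\<Sum>j\<in>UNIV. v $ j * (\<Sum>i\<in>UNIV. h j i * u $ i))"
    unfolding sum_distrib_left by (subst sum.swap) (intro sum.cong refl, simp add: sym mult_ac)
  also have "\<dots> = ?q v" unfolding hu by (simp add: sum_distrib_left mult_ac)
  finally have qu: "?q u = ?q v" .
  have "(\<Sum>i\<in>UNIV. \<theta> i * u $ i) = (\<Sum>i\<in>UNIV. \<theta> i * v $ i) - a * (\<Sum>i\<in>UNIV. \<theta> i * y $ i)"
    by (simp add: u_def sum_subtractf sum_distrib_left algebra_simps)
  then have \<theta>u: "(\<Sum>i\<in>UNIV. \<theta> i * u $ i) = 0" using f by (simp add: a_def)
  have pos: "0 < ?q v" if "u \<noteq> 0"
    using convex[OF that] f(1) unfolding quadratic_expand \<theta>u qu by (simp add: zero_less_mult_iff)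
  have zero: "?q v = 0" if "u = 0" using qu that by simp
  show "0 \<le> ?q v" using pos zero by (cases "u = 0") auto
  show "\<exists>a. v = a *\<^sub>R y" if "?q v = 0"
  proof
    have "u = 0" using pos that by force
    then show "v = a *\<^sub>R y" by (simp add: u_def)
  qed
qed

text \<open>The two summands complement each other: h is positive off the line through y, and on
  that line the square of \<theta> is positive because \<theta>(y) = f.\<close>

lemma strongly_convex_of_quasi_definite:
  fixes v y :: "real^'n::finite"
  assumes nonneg: "0 \<le> bilinear_form h v v"
    and null: "bilinear_form h v v = 0 \<Longrightarrow> \<exists>a. v = a *\<^sub>R y"
    and f: "0 < f" "(\<Sum>i\<in>UNIV. \<theta> i * y $ i) = f" and v: "v \<noteq> 0"
  shows "0 < bilinear_form (\<lambda>i j. f * h i j + \<theta> i * \<theta> j) v v"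
proof (cases "bilinear_form h v v = 0")
  case True
  then obtain a where a: "v = a *\<^sub>R y" using null by blast
  have "(\<Sum>i\<in>UNIV. \<theta> i * v $ i) = a * (\<Sum>i\<in>UNIV. \<theta> i * y $ i)"
    by (simp add: a sum_distrib_left algebra_simps)
  then have "(\<Sum>i\<in>UNIV. \<theta> i * v $ i) \<noteq> 0" using f v a by auto
  then show ?thesis unfolding quadratic_expand True by simp
next
  case False
  then have "0 < f * bilinear_form h v v" using nonneg f(1) by simp
  then show ?thesis unfolding quadratic_expand by (simp add: add_pos_nonneg)
qed

lemma bilinear_transform:
  fixes J :: "real^'n::finite \<Rightarrow> real^'n"
  assumes J: "linear J"
  shows "bilinear_form (\<lambda>i j. \<Sum>k\<in>UNIV. \<Sum>l\<in>UNIV. h k l * J (axis i 1) $ k * J (axis j 1) $ l) u v =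
    bilinear_form h (J u) (J v)"
proof -
  let ?t = "\<lambda>i j k l. h k l * J (axis i 1) $ k * J (axis j 1) $ l * u $ i * v $ j"
  have exp: "J u $ k = (\<Sum>i\<in>UNIV. J (axis i 1) $ k * u $ i)" for u k
  proof -
    have "u = (\<Sum>i\<in>UNIV. u $ i *\<^sub>R axis i 1)"
      by (simp add: vec_eq_iff axis_def if_distrib cong: if_cong)
    then have "J u = J (\<Sum>i\<in>UNIV. u $ i *\<^sub>R axis i 1)" by (rule arg_cong)
    then show ?thesis by (simp add: linear_sum[OF J] linear_scale[OF J] mult.commute)
  qed
  have "bilinear_form h (J u) (J v) =
    (\<Sum>k\<in>UNIV. \<Sum>l\<in>UNIV. \<Sum>i\<in>UNIV. \<Sum>j\<in>UNIV. ?t i j k l)"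
    unfolding exp[of u] exp[of v] mult.assoc sum_product by (simp add: sum_distrib_left mult_ac)
  also have "\<dots> = (\<Sum>k\<in>UNIV. \<Sum>i\<in>UNIV. \<Sum>l\<in>UNIV. \<Sum>j\<in>UNIV. ?t i j k l)"
    by (intro sum.cong refl sum.swap)
  also have "\<dots> = (\<Sum>i\<in>UNIV. \<Sum>k\<in>UNIV. \<Sum>l\<in>UNIV. \<Sum>j\<in>UNIV. ?t i j k l)"
    by (rule sum.swap)
  also have "\<dots> = (\<Sum>i\<in>UNIV. \<Sum>k\<in>UNIV. \<Sum>j\<in>UNIV. \<Sum>l\<in>UNIV. ?t i j k l)"
    by (intro sum.cong refl sum.swap)
  also have "\<dots> = (\<Sum>i\<in>UNIV. \<Sum>j\<in>UNIV. \<Sum>k\<in>UNIV. \<Sum>l\<in>UNIV. ?t i j k l)"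
    by (intro sum.cong refl sum.swap)
  finally show ?thesis by (simp add: sum_distrib_right)
qed

text \<open>Only derivatives along a fibre are compared. There the coordinate change is a constant
  linear map, so no derivative of the Jacobian appears; this is why the fibre Hessian is a
  tensor.\<close>

lemma fibre_chain_rule:
  fixes J :: "'a::real_normed_vector \<Rightarrow> 'b::real_normed_vector" and g :: "'c::real_normed_vector \<times> 'a \<Rightarrow> real"
    and g' :: "'d::real_normed_vector \<times> 'b \<Rightarrow> real"
  assumes J: "bounded_linear J" and g: "g differentiable (at (x, b))" and g': "g' differentiable (at (x', J b))"
    and eq: "\<And>b. b \<noteq> 0 \<Longrightarrow> g (x, b) = g' (x', J b)" and b: "b \<noteq> 0"
  shows "fderiv g (x, b) (0, v) = fderiv g' (x', J b) (0, J v)"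
proof -
  have "((\<lambda>b. (x, b)) has_derivative (\<lambda>v. (0, v))) (at b)" by (auto intro!: derivative_eq_intros)
  from diff_chain_at[OF this frechet_derivative_has[OF g]]
  have 1: "((\<lambda>b. g (x, b)) has_derivative (\<lambda>v. fderiv g (x, b) (0, v))) (at b)" by (simp add: o_def)
  have "((\<lambda>b. (x', J b)) has_derivative (\<lambda>v. (0, J v))) (at b)"
    by (intro has_derivative_Pair has_derivative_const bounded_linear_imp_has_derivative J)
  from diff_chain_at[OF this frechet_derivative_has[OF g']]
  have "((\<lambda>b. g' (x', J b)) has_derivative (\<lambda>v. fderiv g' (x', J b) (0, J v))) (at b)" by (simp add: o_def)
  then have 2: "((\<lambda>b. g (x, b)) has_derivative (\<lambda>v. fderiv g' (x', J b) (0, J v))) (at b)"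
    by (rule has_derivative_transform_within_open[of _ _ _ _ "- {0}"]) (use eq b in auto)
  from fun_cong[OF has_derivative_unique[OF 1 2], of v] show ?thesis .
qed

lemma reflect_reflect [simp]: "reflect (reflect w) = w"
  by (simp add: reflect_def scale_tm_def)

section \<open>Coordinate representations of fields and tensors\<close>

context slit_atlas
begin

abbreviation slit_range :: "('m, real^'n) chart \<Rightarrow> ('n tpoint) set" where
  "slit_range c \<equiv> coord_range c \<times> - {0}"

abbreviation point :: "('m, real^'n) chart \<Rightarrow> 'n tpoint \<Rightarrow> ('m, 'n) tm" where
  "point c \<equiv> coord_inv (canonical A c)"

abbreviation rep :: "('m, real^'n) chart \<Rightarrow> ('m, 'n) tm_field \<Rightarrow> 'n tpoint \<Rightarrow> 'n tpoint" where
  "rep c \<equiv> field_rep (canonical A c)"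

abbreviation tcomp :: "('m, 'n) tensor02 \<Rightarrow> ('m, real^'n) chart \<Rightarrow> 'n \<Rightarrow> 'n \<Rightarrow> 'n tpoint \<Rightarrow> real" where
  "tcomp h c \<equiv> tensor_comp A c h"

lemma open_slit_range: "c \<in> A \<Longrightarrow> open (slit_range c)"
  by (intro open_Times open_range open_Compl closed_singleton)

abbreviation charts :: "('m, 'n) tm \<Rightarrow> ('m, real^'n) chart set" where
  "charts w \<equiv> charts_at A (fst w)"

lemma charts_atD: "c \<in> charts_at A p \<Longrightarrow> c \<in> A" "c \<in> charts_at A p \<Longrightarrow> p \<in> dom_chart c"
  by (simp_all add: charts_at_def)

lemma point_coord:
  assumes "w \<in> slit A" "c \<in> charts w"
  shows "point c (coord c (fst w), snd w c) = w" "(coord c (fst w), snd w c) \<in> slit_range c"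
    "point c (coord (canonical A c) w) = w" "coord (canonical A c) w \<in> slit_range c"
  using canonical_coord_inv[of c w] assms slitD(2)[OF assms] charts_atD[OF assms(2)] coord_in_range[of "fst w" c]
  by (simp_all add: dom_canonical coord_canonical)

lemma coord_point:
  assumes "c \<in> A" "z \<in> slit_range c"
  shows "coord (canonical A c) (point c z) = z" "coord c (fst (point c z)) = fst z" "snd (point c z) c = snd z"
    "point c z \<in> slit A" "c \<in> charts_at A (fst (point c z))" "fst (point c z) = coord_inv c (fst z)"
  using canonical_coord_inv_simps[OF assms(1), of z] assms by (simp_all add: range_canonical coord_canonical)

lemma canonical_charts_at: "w \<in> slit A \<Longrightarrow> c \<in> charts w \<Longrightarrow> canonical A c \<in> charts_at (slit_charts A) w"
  by (simp add: charts_at_slit)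

lemma slit_charts_atE:
  assumes "w \<in> slit A" "b \<in> charts_at (slit_charts A) w"
  obtains c where "c \<in> charts w" "b = canonical A c"
  using assms by (auto simp: charts_at_slit)

text \<open>\<open>tangent_map\<close> and \<open>apply_field\<close> are evaluated in a chart
  selected by \<open>SOME\<close>. On the slit tangent bundle it is a canonical one, from which
  results are transported to the chart of interest.\<close>

lemma some_slit_chart:
  assumes "w \<in> slit A"
  obtains c where "c \<in> charts w" "(SOME b. b \<in> charts_at (slit_charts A) w) = canonical A c"
proof -
  obtain c where "c \<in> charts w" using slit_chart[OF assms] by blast
  then have "(SOME b. b \<in> charts_at (slit_charts A) w) \<in> charts_at (slit_charts A) w"
    using someI[of "\<lambda>b. b \<in> charts_at (slit_charts A) w"] canonical_charts_at[OF assms] by blast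
  then show ?thesis using slit_charts_atE[OF assms] that by metis
qed

lemma scale_slit:
  assumes "w \<in> slit A" "k \<noteq> 0"
  shows "scale_tm k w \<in> slit A"
proof -
  obtain c where c: "c \<in> charts w" using slit_chart[OF assms(1)] by blast
  show ?thesis
    using slitI[OF c scale_tangent[OF slitD(1)[OF assms(1)], of k]] slitD(2)[OF assms(1) c] assms(2)
    by (simp add: scale_tm_def)
qed

lemma reflect_slit: "w \<in> slit A \<Longrightarrow> reflect w \<in> slit A"
  by (simp add: reflect_def scale_slit)

lemma scale_reflect_components [simp]: "fst (scale_tm k w) = fst w" "snd (scale_tm k w) c = k *\<^sub>R snd w c" "fst (reflect w) = fst w" "snd (reflect w) c = - snd w c"
  by (simp_all add: scale_tm_def reflect_def)

lemma point_reflect: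
  assumes "c \<in> A" "z \<in> slit_range c"
  shows "point c (reflect_vec z) = reflect (point c z)"
  using point_coord(1)[of "reflect (point c z)" c] coord_point[OF assms] reflect_slit
  by (simp add: reflect_vec_def)

lemma reflect_slit_range: "z \<in> slit_range c \<Longrightarrow> reflect_vec z \<in> slit_range c"
  by (auto simp: reflect_vec_def)

lemma field_rep_canonical:
  assumes "w \<in> slit A" "c \<in> charts w"
  shows "rep c \<Gamma> (coord (canonical A c) w) = \<Gamma> w (canonical A c)"
  by (simp add: field_rep_def point_coord[OF assms])

lemma liouville_canonical:
  "w \<in> slit A \<Longrightarrow> c \<in> charts w \<Longrightarrow> liouville A w (canonical A c) = (0, snd w c)"
  by (simp add: liouville_def canonical_charts_at coord_canonical)

lemma liouville_rep: "c \<in> A \<Longrightarrow> z \<in> slit_range c \<Longrightarrow> rep c (liouville A) z = (0, snd z)"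
  using liouville_canonical[OF coord_point(4,5)] coord_point(3) by (simp add: field_rep_def)

lemma spray_tangent: "spray A \<Gamma> \<Longrightarrow> w \<in> slit A \<Longrightarrow> \<Gamma> w \<in> tangent_space (slit_charts A) w"
  by (simp add: spray_def smooth_field_def carrier_slit)

lemma spray_jac:
  assumes "spray A \<Gamma>" "w \<in> slit A" "c \<in> charts w" "d \<in> charts w"
  shows "\<Gamma> w (canonical A d) = slit.jac (canonical A c) (canonical A d) w (\<Gamma> w (canonical A c))"
  by (rule slit.tangent_jac[OF spray_tangent[OF assms(1,2)]]) (use assms canonical_charts_at in auto)

lemma fst_spray:
  assumes \<Gamma>: "spray A \<Gamma>" and w: "w \<in> slit A" and c: "c \<in> charts w"
  shows "fst (\<Gamma> w (canonical A c)) = snd w c"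
proof -
  obtain d where d: "d \<in> charts w" "(SOME b. b \<in> charts_at (slit_charts A) w) = canonical A d"
    by (rule some_slit_chart[OF w])
  have dA: "d \<in> A" using charts_atD d by blast
  \<comment> \<open>In canonical coordinates the projection is \<open>fst\<close>. This settles the
    claim in the selected chart \<open>d\<close>; \<open>slit_jac\<close> carries it over to
    \<open>c\<close>.\<close>
  have "(coord d \<circ> fst \<circ> point d has_derivative fst) (at (coord (canonical A d) w))"
  proof (rule has_derivative_transform_within_open[OF _ open_slit_range[OF dA] point_coord(4)[OF w d(1)]])
    show "(fst has_derivative fst) (at (coord (canonical A d) w))"
      by (rule bounded_linear_imp_has_derivative[OF bounded_linear_fst])
  qed (simp add: coord_point(2)[OF dA])
  then have "tangent_map (slit_charts A) A fst w (\<Gamma> w) d = fst (\<Gamma> w (canonical A d))"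
    by (simp add: tangent_map_def d frechet_derivative_eqI)
  then have "fst (\<Gamma> w (canonical A d)) = snd w d" using \<Gamma> w by (simp add: spray_def)
  then have "fst (\<Gamma> w (canonical A c)) = jac d c (fst w) (snd w d)"
    using spray_jac[OF \<Gamma> w d(1) c] slit_jac(1)[OF w d(1) c] by simp
  then show ?thesis using tangent_jac[OF slitD(1)[OF w] d(1) c] by simp
qed

lemma spray_local:
  assumes \<Gamma>: "spray A \<Gamma>" and c: "c \<in> A"
  shows "local_spray (slit_range c) (rep c \<Gamma>)"
proof
  let ?S = "rep c \<Gamma>"
  show o: "open (slit_range c)" by (rule open_slit_range[OF c])
  have "canonical A c \<in> slit_charts A" using c by (simp add: slit_charts_def)
  then show "smooth_on (slit_range c) ?S"
    using \<Gamma> range_canonical[OF c] by (auto simp: spray_def smooth_field_def)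
  fix z assume z: "z \<in> slit_range c"
  let ?w = "point c z"
  note w = coord_point[OF c z]
  show "fst (?S z) = snd z" using fst_spray[OF \<Gamma> w(4,5)] w(3) by (simp add: field_rep_def)
  have "lie_bracket (slit_charts A) (liouville A) \<Gamma> ?w (canonical A c) = \<Gamma> ?w (canonical A c)"
    using \<Gamma> w(4) by (simp add: spray_def)
  then have "coord_bracket (rep c (liouville A)) ?S z = ?S z"
    using canonical_charts_at[OF w(4,5)] by (simp add: lie_bracket_def w(1)) (simp add: field_rep_def)
  moreover have "fderiv (rep c (liouville A)) z =
      fderiv (\<lambda>z. (0, snd z)) z"
    by (rule frechet_derivative_cong_open(1)[OF o z]) (rule liouville_rep[OF c])
  ultimately show "coord_bracket (\<lambda>z. (0, snd z)) ?S z = ?S z"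
    using liouville_rep[OF c z] by (simp add: coord_bracket_def)
qed

lemma smooth_fun_local:
  assumes "smooth_fun (slit_charts A) P" "c \<in> A"
  shows "smooth_on (slit_range c) (P \<circ> point c)"
  using assms range_canonical[OF assms(2)] by (auto simp: smooth_fun_def slit_charts_def)

lemma projective_local:
  assumes "projectively_equivalent A \<Gamma> \<Gamma>'"
  obtains P where "\<And>c. c \<in> A \<Longrightarrow> smooth_on (slit_range c) (P \<circ> point c)"
    "\<And>c z. c \<in> A \<Longrightarrow> z \<in> slit_range c \<Longrightarrow>
      rep c \<Gamma>' z = rep c \<Gamma> z - (2 * (P \<circ> point c) z) *\<^sub>R (0, snd z)"
proof -
  obtain P where P: "smooth_fun (slit_charts A) P"
    "\<And>w b. w \<in> slit A \<Longrightarrow> \<Gamma>' w b = \<Gamma> w b - (2 * P w) *\<^sub>R liouville A w b"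
    using assms by (auto simp: projectively_equivalent_def)
  show ?thesis
  proof (rule that)
    fix c z assume c: "c \<in> A" and z: "z \<in> slit_range c"
    show "rep c \<Gamma>' z = rep c \<Gamma> z - (2 * (P \<circ> point c) z) *\<^sub>R (0, snd z)"
      using P(2)[OF coord_point(4)[OF c z], of "canonical A c"] liouville_rep[OF c z]
      by (simp add: field_rep_def)
  qed (rule smooth_fun_local[OF P(1)])
qed

lemma reverse_local:
  assumes \<Gamma>: "spray A \<Gamma>" and c: "c \<in> A" and z: "z \<in> slit_range c"
  shows "rep c (reverse_spray A \<Gamma>) z = - reflect_vec (rep c \<Gamma> (reflect_vec z))"
proof -
  let ?w = "point c z" let ?v = "reflect ?w"
  note w = coord_point[OF c z]
  have v: "?v \<in> slit A" using reflect_slit[OF w(4)] .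
  have cv: "c \<in> charts ?v" using w(5) by simp
  obtain d where d: "d \<in> charts ?v" "(SOME b. b \<in> charts_at (slit_charts A) ?v) = canonical A d"
    by (rule some_slit_chart[OF v])
  have ch: "canonical A d \<in> charts_at (slit_charts A) ?v" "canonical A c \<in> charts_at (slit_charts A) ?v"
    using canonical_charts_at[OF v] d cv by auto
  \<comment> \<open>In coordinates \<open>reflect\<close> is a change of charts from
    \<open>d\<close> to \<open>c\<close> followed by \<open>reflect_vec\<close>; the change of
    charts is absorbed by the transformation law of \<Gamma>.\<close>
  have "coord (canonical A c) \<circ> reflect \<circ> point d = reflect_vec \<circ> (coord (canonical A c) \<circ> point d)"
    by (simp add: fun_eq_iff coord_canonical)
  moreover have "(reflect_vec \<circ> (coord (canonical A c) \<circ> point d) has_derivative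
     reflect_vec \<circ> slit.jac (canonical A d) (canonical A c) ?v) (at (coord (canonical A d) ?v))"
    by (rule diff_chain_at[OF slit.has_derivative_transition[OF ch] has_derivative_reflect_vec])
  ultimately have "fderiv (coord (canonical A c) \<circ> reflect \<circ> point d) (coord (canonical A d) ?v) =
     reflect_vec \<circ> slit.jac (canonical A d) (canonical A c) ?v" by (simp only: frechet_derivative_eqI)
  then have "reverse_spray A \<Gamma> ?w (canonical A c) = - reflect_vec (\<Gamma> ?v (canonical A c))"
    using spray_jac[OF \<Gamma> v d(1) cv] canonical_charts_at[OF w(4,5)]
    by (simp add: reverse_spray_def tangent_map_def d Let_def)
  then show ?thesis using point_reflect[OF c z] by (simp add: field_rep_def)
qed

lemma tensor_comp_canonical:
  assumes "w \<in> slit A" "c \<in> charts w"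
  shows "tcomp h c i j (coord c (fst w), snd w c) = h w c $ i $ j"
  by (simp add: tensor_comp_def point_coord[OF assms])

lemma hessian_transform:
  assumes F: "smooth_fun (slit_charts A) F" and w: "w \<in> slit A"
    and c: "c \<in> charts w" and d: "d \<in> charts w"
  shows "vertical_hessian (F \<circ> point c) i j (coord (canonical A c) w) =
    (\<Sum>k\<in>UNIV. \<Sum>l\<in>UNIV. vertical_hessian (F \<circ> point d) k l (coord (canonical A d) w) *
       jac c d (fst w) (axis i 1) $ k * jac c d (fst w) (axis j 1) $ l)"
proof -
  let ?J = "jac c d (fst w)" let ?x = "coord c (fst w)" let ?x' = "coord d (fst w)"
  let ?f = "F \<circ> point c" let ?g = "F \<circ> point d"
  have cA: "c \<in> A" and dA: "d \<in> A" using charts_atD c d by blast+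
  have J: "bounded_linear ?J" using has_derivative_transition[OF c d] by (rule has_derivative_bounded_linear)
  have sf: "smooth_on (slit_range c) ?f" by (rule smooth_fun_local[OF F cA])
  have sg: "smooth_on (slit_range d) ?g" by (rule smooth_fun_local[OF F dA])
  have inc: "(?x, b) \<in> slit_range c" "(?x', ?J b) \<in> slit_range d" if "b \<noteq> 0" for b
    using that jac_eq_0_iff[OF c d] coord_in_range[OF charts_atD(2)[OF c]] coord_in_range[OF charts_atD(2)[OF d]] by simp_all
  have eq: "?f (?x, b) = ?g (?x', ?J b)" if b: "b \<noteq> 0" for b
  proof -
    let ?v = "point c (?x, b)"
    note v = coord_point[OF cA inc(1)[OF b]]
    have fv: "fst ?v = fst w" using v(6) coord_inv_coord[OF cA charts_atD(2)[OF c]] by simp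
    have "snd ?v d = ?J b" using tangent_jac[OF slitD(1)[OF v(4)] v(5), of d] d fv v(3) by simp
    then have "point d (?x', ?J b) = ?v" using point_coord(1)[OF v(4), of d] d fv by simp
    then show ?thesis by simp
  qed
  \<comment> \<open>The derivative in the direction e_j becomes one in the direction J e_j, which is
    the same at all points of the fibre. So \<open>fibre_chain_rule\<close> applies a second
    time.\<close>
  have eq1: "d_y j ?f (?x, b) = fderiv ?g (?x', ?J b) (0, ?J (axis j 1))" if b: "b \<noteq> 0" for b
    unfolding d_y_def
    by (rule fibre_chain_rule[where g = ?f and g' = ?g and J = ?J, OF J _ _ eq b]) (use sf sg inc[OF b] smooth_on_differentiable in blast)+
  let ?y = "snd w c"
  have y: "?y \<noteq> 0" by (rule slitD(2)[OF w c])
  have Jy: "?J ?y = snd w d" using tangent_jac[OF slitD(1)[OF w] c d] by simp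
  let ?z = "(?x', snd w d)"
  have z: "?z \<in> slit_range d" using inc(2)[OF y] Jy by simp
  have sg': "smooth_on (slit_range d) (\<lambda>z. fderiv ?g z (0, ?J (axis j 1)))"
    by (rule smooth_on_frechet[OF sg])
  have "vertical_hessian ?f i j (?x, ?y) =
     fderiv (\<lambda>z. fderiv ?g z (0, ?J (axis j 1))) ?z (0, ?J (axis i 1))"
    unfolding Jy[symmetric]
    by (subst d_y_def, rule fibre_chain_rule[where g = "d_y j ?f" and g' = "\<lambda>z. fderiv ?g z (0, ?J (axis j 1))" and J = ?J, OF J _ _ eq1 y])
      (use smooth_on_d_y[OF sf] sg' inc[OF y] smooth_on_differentiable in blast)+
  also have "fderiv (\<lambda>z. fderiv ?g z (0, ?J (axis j 1))) ?z =
     (\<lambda>v. \<Sum>l\<in>UNIV. ?J (axis j 1) $ l * fderiv (d_y l ?g) ?z v)"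
  proof -
    have "((\<lambda>z. \<Sum>l\<in>UNIV. ?J (axis j 1) $ l * d_y l ?g z) has_derivative
      (\<lambda>v. \<Sum>l\<in>UNIV. ?J (axis j 1) $ l * fderiv (d_y l ?g) ?z v)) (at ?z)"
      by (intro has_derivative_sum has_derivative_mult_right smooth_on_has_derivative[OF smooth_on_d_y[OF sg] z])
    then have "((\<lambda>z. fderiv ?g z (0, ?J (axis j 1))) has_derivative
      (\<lambda>v. \<Sum>l\<in>UNIV. ?J (axis j 1) $ l * fderiv (d_y l ?g) ?z v)) (at ?z)"
      by (rule has_derivative_transform_within_open[OF _ open_slit_range[OF dA] z])
        (simp only: frechet_vertical[OF smooth_on_differentiable[OF sg]])
    then show ?thesis by (rule frechet_derivative_eqI)
  qed
  also have "(\<Sum>l\<in>UNIV. ?J (axis j 1) $ l * fderiv (d_y l ?g) ?z (0, ?J (axis i 1))) =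
     (\<Sum>l\<in>UNIV. \<Sum>k\<in>UNIV. vertical_hessian ?g k l ?z * ?J (axis i 1) $ k * ?J (axis j 1) $ l)"
    by (simp add: frechet_vertical[OF smooth_on_differentiable[OF smooth_on_d_y[OF sg] z]] sum_distrib_left mult_ac)
  also have "\<dots> = (\<Sum>k\<in>UNIV. \<Sum>l\<in>UNIV. vertical_hessian ?g k l ?z * ?J (axis i 1) $ k * ?J (axis j 1) $ l)"
    by (rule sum.swap)
  finally show ?thesis unfolding coord_canonical .
qed

end

section \<open>Geodesic classes\<close>

context slit_atlas
begin

lemma finsler_hessian_multiplier:
  assumes F: "finsler_function A F" and \<Gamma>: "spray A \<Gamma>"
    and el: "\<And>c z i. c \<in> A \<Longrightarrow> z \<in> slit_range c \<Longrightarrow> euler_lagrange (rep c \<Gamma>) (F \<circ> point c) i z = 0"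
  defines "h \<equiv> \<lambda>w c. \<chi> i j. vertical_hessian (F \<circ> point c) i j (coord (canonical A c) w)"
  shows "smooth_tensor02 A h" "positive_quasi_definite A h"
    and "c \<in> A \<Longrightarrow> z \<in> slit_range c \<Longrightarrow> tcomp h c j i z = tcomp h c i j z"
    and "c \<in> A \<Longrightarrow> z \<in> slit_range c \<Longrightarrow> (\<Sum>j\<in>UNIV. tcomp h c i j z * snd z $ j) = 0"
    and "c \<in> A \<Longrightarrow> z \<in> slit_range c \<Longrightarrow> d_y k (tcomp h c i j) z = d_y j (tcomp h c i k) z"
    and "c \<in> A \<Longrightarrow> z \<in> slit_range c \<Longrightarrow> dyn_cov_deriv (rep c \<Gamma>) (tcomp h c) i j z = 0"
    and "c \<in> A \<Longrightarrow> z \<in> slit_range c \<Longrightarrow>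
      (\<Sum>k\<in>UNIV. tcomp h c i k z * weyl (rep c \<Gamma>) k j z) =
      (\<Sum>k\<in>UNIV. tcomp h c j k z * weyl (rep c \<Gamma>) k i z)"
proof -
  have sF: "smooth_fun (slit_charts A) F" using F by (simp add: finsler_function_def)
  have h: "tcomp h c i j z = vertical_hessian (F \<circ> point c) i j z" if "c \<in> A" "z \<in> slit_range c" for c z i j
    by (simp add: tensor_comp_def h_def coord_point(1)[OF that])
  have sf: "smooth_on (slit_range c) (F \<circ> point c)" if "c \<in> A" for c by (rule smooth_fun_local[OF sF that])
  have sym: "tcomp h c j i z = tcomp h c i j z" if "c \<in> A" "z \<in> slit_range c" for c z i j
    using d_y_commute(1)[OF open_slit_range[OF that(1)] sf[OF that(1)] that(2)] by (simp only: h[OF that])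
  have euler: "fderiv (F \<circ> point c) z (0, snd z) = (F \<circ> point c) z" if c: "c \<in> A" and z: "z \<in> slit_range c" for c z
  proof -
    obtain x y where xy: "z = (x, y)" by (cases z)
    have "(F \<circ> point c) (x, k *\<^sub>R y) = k * (F \<circ> point c) (x, y)" if k: "k > 0" for k
    proof -
      note w = coord_point[OF c z]
      have "scale_tm k (point c z) \<in> slit A" using scale_slit[OF w(4)] k by simp
      from point_coord(1)[OF this, of c] have "point c (x, k *\<^sub>R y) = scale_tm k (point c z)"
        using w by (simp add: xy)
      then show ?thesis using F w(4) k by (simp add: finsler_function_def positively_homogeneous_def xy)
    qed
    then show ?thesis
      using homogeneous_euler[OF smooth_on_differentiable[OF sf[OF c]], of x y] z by (simp add: xy)
  qed
  have null: "(\<Sum>j\<in>UNIV. tcomp h c i j z * snd z $ j) = 0" if "c \<in> A" "z \<in> slit_range c" for c z i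
    unfolding h[OF that] by (rule homogeneous_hessian[OF open_slit_range sf euler]) (use that in auto)
  show "c \<in> A \<Longrightarrow> z \<in> slit_range c \<Longrightarrow> tcomp h c j i z = tcomp h c i j z"
    by (rule sym)
  show "c \<in> A \<Longrightarrow> z \<in> slit_range c \<Longrightarrow> (\<Sum>j\<in>UNIV. tcomp h c i j z * snd z $ j) = 0"
    by (rule null)
  show "smooth_tensor02 A h"
    unfolding smooth_tensor02_def Let_def
  proof (intro conjI ballI allI)
    fix w c d i j assume w: "w \<in> slit A" and c: "c \<in> charts w" and d: "d \<in> charts w"
    show "h w c $ i $ j = (\<Sum>k\<in>UNIV. \<Sum>l\<in>UNIV. h w d $ k $ l *
       fderiv (coord d \<circ> coord_inv c) (coord c (fst w)) (axis i 1) $ k *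
       fderiv (coord d \<circ> coord_inv c) (coord c (fst w)) (axis j 1) $ l)"
      unfolding jac_def[symmetric] using hessian_transform[OF sF w c d, of i j] by (simp add: h_def)
  next
    fix c i j assume c: "c \<in> A"
    have "smooth_on (slit_range c) (vertical_hessian (F \<circ> point c) i j)"
      by (intro smooth_on_d_y sf c)
    then show "smooth_on (coord_range (canonical A c)) (tcomp h c i j)"
      unfolding range_canonical[OF c] by (subst smooth_on_cong[OF open_slit_range[OF c] h[OF c]])
  qed
  show "positive_quasi_definite A h"
    unfolding positive_quasi_definite_def Let_def
  proof (intro ballI allI)
    fix c z and v :: "real^'n" assume c: "c \<in> A" and zr: "z \<in> coord_range (canonical A c)"
    then have z: "z \<in> slit_range c" by (simp add: range_canonical)
    let ?f = "F \<circ> point c"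
    have "strongly_convex A F" using F by (simp add: finsler_function_def)
    note conv = bspec[OF bspec[OF this[unfolded strongly_convex_def Let_def] c] zr, rule_format]
    have convex: "0 < bilinear_form (\<lambda>i j. ?f z * tcomp h c i j z + d_y i ?f z * d_y j ?f z) v v"
      if "v \<noteq> 0" for v :: "real^'n"
      unfolding h[OF c z] by (rule conv[OF that])
    have pos: "0 < ?f z" using F coord_point(4)[OF c z] by (simp add: finsler_function_def)
    have \<theta>y: "(\<Sum>i\<in>UNIV. d_y i ?f z * snd z $ i) = ?f z"
      using euler[OF c z] by (simp add: frechet_vertical[OF smooth_on_differentiable[OF sf[OF c] z]] mult.commute)
    show "0 \<le> bilinear_form (\<lambda>i j. tcomp h c i j z) v v \<and>
       (bilinear_form (\<lambda>i j. tcomp h c i j z) v v = 0 \<longrightarrow> (\<exists>a. v = a *\<^sub>R snd z))"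
      using quasi_definite_of_strongly_convex[OF convex pos \<theta>y null[OF c z] sym[OF c z], of v] by blast
  qed
  assume c: "c \<in> A" and z: "z \<in> slit_range c"
  let ?f = "F \<circ> point c" let ?S = "rep c \<Gamma>"
  interpret local_spray "slit_range c" ?S by (rule spray_local[OF \<Gamma> c])
  note o = open_slit_range[OF c]
  have dh: "d_y k (tcomp h c i j) z = d_y k (vertical_hessian ?f i j) z" for i j k
    by (rule d_y_cong[OF o z]) (rule h[OF c])
  \<comment> \<open>Symmetry of the third fibre derivatives, by three interchanges of adjacent
    derivatives.\<close>
  have "d_y k (vertical_hessian ?f i j) z = d_y k (vertical_hessian ?f j i) z"
    by (rule d_y_cong[OF o z]) (rule d_y_commute(1)[OF o sf[OF c]])
  also have "\<dots> = d_y j (vertical_hessian ?f k i) z"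
    by (rule d_y_commute(1)[OF o smooth_on_d_y[OF sf[OF c]] z])
  also have "\<dots> = d_y j (vertical_hessian ?f i k) z"
    by (rule d_y_cong[OF o z]) (rule d_y_commute(1)[OF o sf[OF c]])
  finally show "d_y k (tcomp h c i j) z = d_y j (tcomp h c i k) z" by (simp only: dh)
  have "dyn_cov_deriv ?S (tcomp h c) i j z = dyn_cov_deriv ?S (vertical_hessian ?f) i j z"
    by (rule dyn_cov_deriv_cong[OF o z]) (rule h[OF c])
  then show "dyn_cov_deriv ?S (tcomp h c) i j z = 0"
    using extremal_dyn_cov_deriv(1)[OF sf[OF c] el[OF c] z] by simp
  show "(\<Sum>k\<in>UNIV. tcomp h c i k z * weyl ?S k j z) = (\<Sum>k\<in>UNIV. tcomp h c j k z * weyl ?S k i z)"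
  proof (rule weyl_sym)
    fix i j show "(\<Sum>k\<in>UNIV. tcomp h c i k z * riemann ?S k j z) = (\<Sum>k\<in>UNIV. tcomp h c j k z * riemann ?S k i z)"
      unfolding h[OF c z] by (rule extremal_riemann[OF sf[OF c] el[OF c] z])
  qed (use sym[OF c z] null[OF c z] in auto)
qed

section \<open>Geodesic classes as projective classes\<close>

lemma smooth_funI:
  "(\<And>c. c \<in> A \<Longrightarrow> smooth_on (slit_range c) (P \<circ> point c)) \<Longrightarrow> smooth_fun (slit_charts A) P"
  unfolding smooth_fun_def slit_charts_def by (metis (no_types, lifting) imageE range_canonical)

lemma geodesic_class_iff:
  "\<Gamma> \<in> geodesic_class A F \<longleftrightarrow> spray A \<Gamma> \<and> (\<forall>c\<in>A. \<forall>z\<in>slit_range c. \<forall>i.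
     euler_lagrange (rep c \<Gamma>) (F \<circ> point c) i z = 0)"
  by (simp add: geodesic_class_def euler_lagrange_def range_canonical Let_def)

text \<open>A vertical difference of two sprays is a multiple of \<open>\<Delta>\<close> in one chart if and only if it is in all,
  with the same factor, since both are tangent vectors of the slit tangent bundle.\<close>

lemma projectively_equivalentI:
  assumes \<Gamma>: "spray A \<Gamma>" and \<Gamma>': "spray A \<Gamma>'"
    and mult: "\<And>c z. c \<in> A \<Longrightarrow> z \<in> slit_range c \<Longrightarrow>
      \<exists>a. rep c \<Gamma> z - rep c \<Gamma>' z = a *\<^sub>R (0, snd z)"
  shows "projectively_equivalent A \<Gamma> \<Gamma>'"
proof -
  \<comment> \<open>The factor of y is read off by pairing with y, and the 2 matches \<Gamma>' =
    \<Gamma> - 2 P \<Delta>. The explicit formula shows smoothness, which the mere existence of a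
    factor at each point does not.\<close>
  define ratio where "ratio c z = (snd (rep c \<Gamma> z - rep c \<Gamma>' z) \<bullet> snd z) /
     (2 * (snd z \<bullet> snd z))" for c and z :: "'n tpoint"
  have ratio: "rep c \<Gamma> z - rep c \<Gamma>' z = (2 * ratio c z) *\<^sub>R (0, snd z)"
    if c: "c \<in> A" and z: "z \<in> slit_range c" for c z
  proof -
    obtain a where "rep c \<Gamma> z - rep c \<Gamma>' z = a *\<^sub>R (0, snd z)"
      using mult[OF c z] by blast
    moreover from this have "ratio c z = a / 2" using z by (auto simp: ratio_def simp del: snd_diff)
    ultimately show ?thesis by simp
  qed
  have ratio': "\<Gamma> w (canonical A c) - \<Gamma>' w (canonical A c) = (2 * ratio c (coord (canonical A c) w)) *\<^sub>R (0, snd w c)"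
    if "w \<in> slit A" "c \<in> charts w" for w c
    using ratio[OF charts_atD(1)[OF that(2)] point_coord(4)[OF that]]
    unfolding field_rep_canonical[OF that] by (simp add: coord_canonical)
  have indep: "ratio c (coord (canonical A c) w) = ratio d (coord (canonical A d) w)"
    if w: "w \<in> slit A" and c: "c \<in> charts w" and d: "d \<in> charts w" for w c d
  proof -
    let ?J = "slit.jac (canonical A c) (canonical A d) w"
    have lin: "linear ?J" by (rule slit.linear_jac) (use canonical_charts_at[OF w] c d in auto)
    have "\<Gamma> w (canonical A d) - \<Gamma>' w (canonical A d) = ?J (\<Gamma> w (canonical A c) - \<Gamma>' w (canonical A c))"
      by (simp add: linear_diff[OF lin] spray_jac[OF \<Gamma> w c d] spray_jac[OF \<Gamma>' w c d])
    also have "\<dots> = (2 * ratio c (coord (canonical A c) w)) *\<^sub>R ?J (0, snd w c)"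
      unfolding ratio'[OF w c] by (rule linear_scale[OF lin])
    also have "?J (0, snd w c) = (0, snd w d)"
      using slit_jac(2)[OF w c d] tangent_jac[OF slitD(1)[OF w] c d] by simp
    finally have "(2 * ratio d (coord (canonical A d) w)) *\<^sub>R snd w d = (2 * ratio c (coord (canonical A c) w)) *\<^sub>R snd w d"
      unfolding ratio'[OF w d] by simp
    then show ?thesis using slitD(2)[OF w d] by simp
  qed
  define P where "P w = (let c = SOME c. c \<in> charts w in ratio c (coord (canonical A c) w))" for w
  have P: "P w = ratio c (coord (canonical A c) w)" if "w \<in> slit A" "c \<in> charts w" for w c
    unfolding P_def Let_def by (rule indep[OF that(1) someI[of _ c]]) (use that in auto)
  have PC: "(P \<circ> point c) z = ratio c z" if "c \<in> A" "z \<in> slit_range c" for c z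
    using P[OF coord_point(4,5)[OF that]] by (simp add: coord_point(1)[OF that])
  have sr: "smooth_on (slit_range c) (ratio c)" if c: "c \<in> A" for c
  proof -
    interpret S: local_spray "slit_range c" "rep c \<Gamma>" by (rule spray_local[OF \<Gamma> c])
    interpret S': local_spray "slit_range c" "rep c \<Gamma>'" by (rule spray_local[OF \<Gamma>' c])
    show ?thesis unfolding ratio_def[abs_def]
      by (intro smooth_intros S.smooth_S S'.smooth_S open_slit_range c) auto
  qed
  \<comment> \<open>Let r be the factor. Both sprays satisfy [\<Delta>, \<Gamma>] = \<Gamma>, so
    their vertical difference 2 r y has derivative 4 r y along \<Delta>. The product rule gives 2 r
    y + 2 \<Delta>(r) y instead, hence \<Delta>(r) = r.\<close>
  have hom: "fderiv (ratio c) z (0, snd z) = ratio c z" if c: "c \<in> A" and z: "z \<in> slit_range c" for c z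
  proof -
    let ?S = "rep c \<Gamma>" let ?S' = "rep c \<Gamma>'"
    interpret S: local_spray "slit_range c" ?S by (rule spray_local[OF \<Gamma> c])
    interpret S': local_spray "slit_range c" ?S' by (rule spray_local[OF \<Gamma>' c])
    let ?D = "fderiv (\<lambda>z. (0, snd z)) z"
    have D: "?D v = (0, snd v)" for v :: "'n tpoint"
      by (simp add: frechet_derivative_eqI[OF vertical_field_derivative])
    have "((\<lambda>z. ?S z - ?S' z) has_derivative (\<lambda>v. fderiv ?S z v - fderiv ?S' z v)) (at z)"
      by (intro has_derivative_diff frechet_derivative_has S.diff_S S'.diff_S z)
    from has_derivative_snd[OF this]
    have 1: "((\<lambda>z. snd (?S z - ?S' z)) has_derivative
       (\<lambda>v. snd (fderiv ?S z v - fderiv ?S' z v))) (at z)" .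
    have "((\<lambda>z. (2 * ratio c z) *\<^sub>R snd z) has_derivative
       (\<lambda>v. (2 * ratio c z) *\<^sub>R snd v + (2 * fderiv (ratio c) z v) *\<^sub>R snd z)) (at z)"
      by (intro has_derivative_scaleR has_derivative_mult_right smooth_on_has_derivative[OF sr[OF c] z]
        bounded_linear_imp_has_derivative bounded_linear_snd)
    then have 2: "((\<lambda>z. snd (?S z - ?S' z)) has_derivative
       (\<lambda>v. (2 * ratio c z) *\<^sub>R snd v + (2 * fderiv (ratio c) z v) *\<^sub>R snd z)) (at z)"
      by (rule has_derivative_transform_within_open[OF _ open_slit_range[OF c] z]) (simp add: ratio[OF c] del: snd_diff)
    from fun_cong[OF has_derivative_unique[OF 1 2], of "(0, snd z)"]
    have "snd (fderiv ?S z (0, snd z) - fderiv ?S' z (0, snd z)) =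
      (2 * ratio c z) *\<^sub>R snd z + (2 * fderiv (ratio c) z (0, snd z)) *\<^sub>R snd z" by simp
    moreover have "fderiv ?S z (0, snd z) - fderiv ?S' z (0, snd z) =
      (?S z - ?S' z) + ?D (?S z - ?S' z)"
      using S.homogeneous_S[OF z] S'.homogeneous_S[OF z] by (simp add: coord_bracket_def D algebra_simps prod_eq_iff)
    moreover have "snd ((?S z - ?S' z) + ?D (?S z - ?S' z)) = (2 * ratio c z) *\<^sub>R snd z + (2 * ratio c z) *\<^sub>R snd z"
      unfolding ratio[OF c z] D by (simp only: snd_add snd_scaleR snd_conv)
    ultimately have "(2 * ratio c z) *\<^sub>R snd z = (2 * fderiv (ratio c) z (0, snd z)) *\<^sub>R snd z"
      by (metis add_left_cancel)
    then show ?thesis using z by auto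
  qed
  have "smooth_on (slit_range c) (P \<circ> point c)" if c: "c \<in> A" for c
    using sr[OF c] smooth_on_cong[OF open_slit_range[OF c], of "P \<circ> point c" "ratio c"] PC[OF c] by blast
  then have "smooth_fun (slit_charts A) P" by (rule smooth_funI)
  moreover have "apply_field (slit_charts A) (liouville A) P w = P w" if w: "w \<in> slit A" for w
  proof -
    obtain c where c: "c \<in> charts w" "(SOME b. b \<in> charts_at (slit_charts A) w) = canonical A c"
      by (rule some_slit_chart[OF w])
    have cA: "c \<in> A" using charts_atD c by blast
    have "fderiv (P \<circ> point c) (coord (canonical A c) w) =
       fderiv (ratio c) (coord (canonical A c) w)"
      by (rule frechet_derivative_cong_open(1)[OF open_slit_range[OF cA] point_coord(4)[OF w c(1)]]) (rule PC[OF cA])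
    then show ?thesis
      using hom[OF cA point_coord(4)[OF w c(1)]] P[OF w c(1)] liouville_canonical[OF w c(1)]
      by (simp add: apply_field_def c(2) coord_canonical)
  qed
  moreover have "\<Gamma>' w b = \<Gamma> w b - (2 * P w) *\<^sub>R liouville A w b" if w: "w \<in> slit A" for w b
  proof (cases "b \<in> charts_at (slit_charts A) w")
    case True
    then obtain c where c: "c \<in> charts w" "b = canonical A c" by (rule slit_charts_atE[OF w])
    show ?thesis
      using ratio'[OF w c(1)] by (simp add: c(2) P[OF w c(1)] liouville_canonical[OF w c(1)] algebra_simps del: scaleR_Pair)
  next
    \<comment> \<open>Away from the charts at w the components of both sprays and of \<Delta> have
      the default value 0.\<close>
    case False
    then show ?thesis
      using slit.tangent_outside[OF spray_tangent[OF \<Gamma> w]] slit.tangent_outside[OF spray_tangent[OF \<Gamma>' w]]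
      by (simp add: liouville_def)
  qed
  ultimately show ?thesis unfolding projectively_equivalent_def by blast
qed

lemma geodesic_class_projective:
  assumes F: "smooth_fun (slit_charts A) F"
    and euler: "\<And>c z. c \<in> A \<Longrightarrow> z \<in> slit_range c \<Longrightarrow> fderiv (F \<circ> point c) z (0, snd z) = (F \<circ> point c) z"
    and \<Gamma>\<^sub>0: "spray A \<Gamma>\<^sub>0" and \<Gamma>: "\<Gamma> \<in> projective_class A \<Gamma>\<^sub>0"
  shows "\<Gamma> \<in> geodesic_class A F \<longleftrightarrow> \<Gamma>\<^sub>0 \<in> geodesic_class A F"
proof -
  have sp: "spray A \<Gamma>" and "projectively_equivalent A \<Gamma>\<^sub>0 \<Gamma>" using \<Gamma> by (auto simp: projective_class_def)
  from this(2) obtain P where P: "\<And>c z. c \<in> A \<Longrightarrow> z \<in> slit_range c \<Longrightarrow>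
      rep c \<Gamma> z = rep c \<Gamma>\<^sub>0 z - (2 * (P \<circ> point c) z) *\<^sub>R (0, snd z)"
    by (rule projective_local) blast
  have "euler_lagrange (rep c \<Gamma>) (F \<circ> point c) i z =
      euler_lagrange (rep c \<Gamma>\<^sub>0) (F \<circ> point c) i z" if "c \<in> A" "z \<in> slit_range c" for c z i
    by (rule local_spray.euler_lagrange_shift[where S' = "rep c \<Gamma>" and c = "2 * (P \<circ> point c) z", OF spray_local[OF \<Gamma>\<^sub>0 that(1)]
      smooth_fun_local[OF F that(1)] euler[OF that(1)] that(2) P[OF that]])
  then show ?thesis using sp \<Gamma>\<^sub>0 unfolding geodesic_class_iff by auto
qed

text \<open>The vertical difference of two sprays with the same Euler-Lagrange equations lies in the
  kernel of the fibre Hessian, which consists of multiples of y. So the equations determine a spray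
  up to projective equivalence.\<close>

lemma projective_class_eq_geodesic_class:
  assumes F: "smooth_fun (slit_charts A) F"
    and euler: "\<And>c z. c \<in> A \<Longrightarrow> z \<in> slit_range c \<Longrightarrow> fderiv (F \<circ> point c) z (0, snd z) = (F \<circ> point c) z"
    and null: "\<And>c z v. c \<in> A \<Longrightarrow> z \<in> slit_range c \<Longrightarrow>
      bilinear_form (\<lambda>i j. vertical_hessian (F \<circ> point c) i j z) v v = 0 \<Longrightarrow> \<exists>a. v = a *\<^sub>R snd z"
    and \<Gamma>\<^sub>0: "spray A \<Gamma>\<^sub>0" and el: "\<Gamma>\<^sub>0 \<in> geodesic_class A F"
  shows "projective_class A \<Gamma>\<^sub>0 = geodesic_class A F"
proof (intro set_eqI iffI)
  fix \<Gamma>' assume "\<Gamma>' \<in> projective_class A \<Gamma>\<^sub>0"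
  from geodesic_class_projective[OF F euler \<Gamma>\<^sub>0 this] el show "\<Gamma>' \<in> geodesic_class A F" by simp
next
  fix \<Gamma>' assume \<Gamma>': "\<Gamma>' \<in> geodesic_class A F"
  then have sp: "spray A \<Gamma>'" by (simp add: geodesic_class_iff)
  have "\<exists>a. rep c \<Gamma>\<^sub>0 z - rep c \<Gamma>' z = a *\<^sub>R (0, snd z)"
    if c: "c \<in> A" and z: "z \<in> slit_range c" for c z
  proof -
    let ?S = "rep c \<Gamma>\<^sub>0" let ?S' = "rep c \<Gamma>'"
    let ?f = "F \<circ> point c"
    define v where "v = snd (?S z) - snd (?S' z)"
    have v: "?S z - ?S' z = (0, v)"
      using local_spray.fst_S[OF spray_local[OF \<Gamma>\<^sub>0 c] z] local_spray.fst_S[OF spray_local[OF sp c] z]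
      by (simp add: v_def prod_eq_iff)
    have sf: "smooth_on (slit_range c) ?f" by (rule smooth_fun_local[OF F c])
    have "euler_lagrange ?S ?f i z = 0" "euler_lagrange ?S' ?f i z = 0" for i
      using el \<Gamma>' c z unfolding geodesic_class_iff by blast+
    then have "(\<Sum>k\<in>UNIV. d_y k (d_y i ?f) z * v $ k) = 0" for i
      by (rule euler_lagrange_diff[where S = ?S and S' = ?S', OF _ _ smooth_on_differentiable[OF smooth_on_d_y[OF sf] z] v])
    then have "(\<Sum>i\<in>UNIV. v $ i * (\<Sum>k\<in>UNIV. d_y k (d_y i ?f) z * v $ k)) = 0" by simp
    then have "bilinear_form (\<lambda>i j. vertical_hessian ?f i j z) v v = 0"
      unfolding sum_distrib_left d_y_commute(1)[OF open_slit_range[OF c] sf z] by (simp add: mult_ac)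
    then obtain a where "v = a *\<^sub>R snd z" using null[OF c z] by blast
    then show ?thesis by (auto simp: v)
  qed
  then show "\<Gamma>' \<in> projective_class A \<Gamma>\<^sub>0"
    using projectively_equivalentI[OF \<Gamma>\<^sub>0 sp] sp by (simp add: projective_class_def)
qed

end

section \<open>From multipliers to Finsler functions\<close>

lemma (in slit_atlas) tensor_law:
  assumes "smooth_tensor02 A h" "w \<in> slit A" "c \<in> charts w" "d \<in> charts w"
  shows "h w c $ i $ j = (\<Sum>k\<in>UNIV. \<Sum>l\<in>UNIV. h w d $ k $ l *
     jac c d (fst w) (axis i 1) $ k * jac c d (fst w) (axis j 1) $ l)"
  using assms unfolding smooth_tensor02_def Let_def jac_def by blast

lemma (in slit_atlas) quasi_definiteD:
  assumes "positive_quasi_definite A h" "c \<in> A" "z \<in> slit_range c"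
  shows "0 \<le> bilinear_form (\<lambda>i j. tcomp h c i j z) v v"
    and "bilinear_form (\<lambda>i j. tcomp h c i j z) v v = 0 \<Longrightarrow> \<exists>a. v = a *\<^sub>R snd z"
proof -
  have "z \<in> coord_range (canonical A c)" using assms by (simp add: range_canonical)
  from bspec[OF bspec[OF assms(1)[unfolded positive_quasi_definite_def Let_def] assms(2)] this]
  show "0 \<le> bilinear_form (\<lambda>i j. tcomp h c i j z) v v"
    and "bilinear_form (\<lambda>i j. tcomp h c i j z) v v = 0 \<Longrightarrow> \<exists>a. v = a *\<^sub>R snd z"
    by blast+
qed

section \<open>The global Finsler function of an even multiplier\<close>

locale even_multiplier = slit_atlas A for A :: "('m, real^'n::finite) chart set" +
  fixes h :: "('m, 'n) tensor02"
  assumes card_n: "3 \<le> CARD('n)"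
    and tensor_h: "smooth_tensor02 A h" and quasi_definite_h: "positive_quasi_definite A h"
    and sym_h: "\<And>c z i j. c \<in> A \<Longrightarrow> z \<in> slit_range c \<Longrightarrow> tcomp h c j i z = tcomp h c i j z"
    and null_h: "\<And>c z i. c \<in> A \<Longrightarrow> z \<in> slit_range c \<Longrightarrow> (\<Sum>j\<in>UNIV. tcomp h c i j z * snd z $ j) = 0"
    and closed_h: "\<And>c z i j k. c \<in> A \<Longrightarrow> z \<in> slit_range c \<Longrightarrow>
      d_y k (tcomp h c i j) z = d_y j (tcomp h c i k) z"
    and even_h: "\<And>c z i j. c \<in> A \<Longrightarrow> z \<in> slit_range c \<Longrightarrow>
      tcomp h c i j (reflect_vec z) = tcomp h c i j z"
begin

lemma smooth_comp: "c \<in> A \<Longrightarrow> smooth_on (slit_range c) (tcomp h c i j)"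
  using tensor_h by (simp add: smooth_tensor02_def range_canonical)

lemma closed_tensor_comp: "c \<in> A \<Longrightarrow> closed_tensor (coord_range c) (tcomp h c)"
  by unfold_locales (simp_all add: open_range card_n smooth_comp sym_h null_h closed_h even_h)

abbreviation chart_potential :: "('m, real^'n) chart \<Rightarrow> 'n tpoint \<Rightarrow> real" where
  "chart_potential c \<equiv> closed_tensor.potential (tcomp h c)"

text \<open>The integrand of the potential is a contraction of the tensor \<open>h\<close> with tangent vectors.\<close>

lemma chart_potential_indep:
  assumes w: "w \<in> slit A" and c: "c \<in> charts w" and d: "d \<in> charts w"
  shows "chart_potential c (coord (canonical A c) w) = chart_potential d (coord (canonical A d) w)"
proof -
  let ?p = "fst w" let ?J = "jac c d ?p" let ?x = "coord c ?p" let ?x' = "coord d ?p" let ?u = "snd w c"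
  have cA: "c \<in> A" and dA: "d \<in> A" using charts_atD c d by blast+
  interpret C: closed_tensor "coord_range c" "tensor_comp A c h" by (rule closed_tensor_comp[OF cA])
  interpret D: closed_tensor "coord_range d" "tensor_comp A d h" by (rule closed_tensor_comp[OF dA])
  have J: "linear ?J" by (rule linear_jac[OF c d])
  have u: "?u \<noteq> 0" by (rule slitD(2)[OF w c])
  have Ju: "?J ?u = snd w d" using tangent_jac[OF slitD(1)[OF w] c d] by simp
  \<comment> \<open>In the chart \<open>d\<close> the half circle is taken through J a. It is the
    image under J of the one used in \<open>c\<close>, so the integrals can be compared integrand by
    integrand.\<close>
  obtain a where a: "gram ?u a \<noteq> 0" using gram_exists[where u = ?u] u card_n by auto
  \<comment> \<open>\<open>gram\<close> depends on the inner product of the chart, but its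
    non-vanishing means linear independence, which the invertible J preserves.\<close>
  have Ja: "gram (?J ?u) (?J a) \<noteq> 0"
  proof
    assume "gram (?J ?u) (?J a) = 0"
    moreover have "?J ?u \<noteq> 0" using u jac_eq_0_iff[OF c d] by simp
    ultimately obtain t where "?J a = t *\<^sub>R ?J ?u" using gram_eq_0D by blast
    then have "?J (a - t *\<^sub>R ?u) = 0" by (simp add: linear_diff[OF J] linear_scale[OF J])
    then have "a = t *\<^sub>R ?u" using jac_eq_0_iff[OF c d] by simp
    then have "gram ?u a = 0" by (metis gram_scaleR(2) gram_self(1) mult_zero_right)
    then show False using a by contradiction
  qed
  have x: "?x \<in> coord_range c" "?x' \<in> coord_range d"
    by (rule coord_in_range[OF charts_atD(2)], rule c) (rule coord_in_range[OF charts_atD(2)], rule d)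
  have "C.arc_form ?x ?u a s = D.arc_form ?x' (?J ?u) (?J a) s" for s
  proof -
    let ?g = "cos s *\<^sub>R ?u + sin s *\<^sub>R a" let ?v = "cos s *\<^sub>R a - sin s *\<^sub>R ?u"
    let ?w = "point c (?x, ?g)"
    have z: "(?x, ?g) \<in> slit_range c" using x gram_circle_nonzero[OF a] by simp
    note w' = coord_point[OF cA z]
    have fw: "fst ?w = ?p" using w'(6) coord_inv_coord[OF cA charts_atD(2)[OF c]] by simp
    have c': "c \<in> charts ?w" and d': "d \<in> charts ?w" using c d fw by simp_all
    have "snd ?w d = ?J ?g" using tangent_jac[OF slitD(1)[OF w'(4)] c' d'] fw w'(3) by simp
    also have "\<dots> = cos s *\<^sub>R ?J ?u + sin s *\<^sub>R ?J a" by (simp add: linear_add[OF J] linear_scale[OF J])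
    finally have sw: "snd ?w d = cos s *\<^sub>R ?J ?u + sin s *\<^sub>R ?J a" .
    have Jv: "?J ?v = cos s *\<^sub>R ?J a - sin s *\<^sub>R ?J ?u" by (simp add: linear_diff[OF J] linear_scale[OF J])
    have hc: "tcomp h c i j (?x, ?g) = h ?w c $ i $ j" for i j
      using tensor_comp_canonical[OF w'(4) c'] fw w'(3) by simp
    have hd: "tensor_comp A d h i j (?x', cos s *\<^sub>R ?J ?u + sin s *\<^sub>R ?J a) = h ?w d $ i $ j" for i j
      using tensor_comp_canonical[OF w'(4) d'] fw sw by simp
    have "h ?w c $ i $ j = (\<Sum>k\<in>UNIV. \<Sum>l\<in>UNIV. h ?w d $ k $ l * ?J (axis i 1) $ k * ?J (axis j 1) $ l)" for i j
      using tensor_law[OF tensor_h w'(4) c' d', of i j] unfolding fw .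
    then show ?thesis
      unfolding hc hd Jv[symmetric] using bilinear_transform[OF J, of "\<lambda>k l. h ?w d $ k $ l" ?u ?v] by simp
  qed
  then show ?thesis
    using C.potential_arc(1)[OF x(1) a] D.potential_arc(1)[OF x(2) Ja] by (simp add: coord_canonical Ju)
qed

definition finsler :: "('m, 'n) tm \<Rightarrow> real" where
  "finsler w = (let c = SOME c. c \<in> charts w in chart_potential c (coord (canonical A c) w))"

lemma finsler_eq:
  assumes "w \<in> slit A" "c \<in> charts w"
  shows "finsler w = chart_potential c (coord (canonical A c) w)"
  unfolding finsler_def Let_def
  by (rule chart_potential_indep[OF assms(1) someI[of "\<lambda>c. c \<in> charts w" c] assms(2)]) (rule assms(2))

lemma finsler_point: "c \<in> A \<Longrightarrow> z \<in> slit_range c \<Longrightarrow> (finsler \<circ> point c) z = chart_potential c z"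
  using finsler_eq[OF coord_point(4,5)] coord_point(1) by simp

lemma smooth_finsler: "smooth_fun (slit_charts A) finsler"
proof (rule smooth_funI)
  fix c assume c: "c \<in> A"
  interpret C: closed_tensor "coord_range c" "tensor_comp A c h" by (rule closed_tensor_comp[OF c])
  show "smooth_on (slit_range c) (finsler \<circ> point c)"
    using C.smooth_potential smooth_on_cong[OF open_slit_range[OF c], of "finsler \<circ> point c" C.potential]
      finsler_point[OF c] by blast
qed

lemma
  assumes c: "c \<in> A" and z: "z \<in> slit_range c"
  shows hessian_finsler: "vertical_hessian (finsler \<circ> point c) i j z = tcomp h c i j z"
    and euler_finsler: "fderiv (finsler \<circ> point c) z (0, snd z) = (finsler \<circ> point c) z"
    and finsler_reflect: "(finsler \<circ> point c) (reflect_vec z) = (finsler \<circ> point c) z"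
    and finsler_pos: "0 < (finsler \<circ> point c) z"
proof -
  interpret C: closed_tensor "coord_range c" "tensor_comp A c h" by (rule closed_tensor_comp[OF c])
  note o = open_slit_range[OF c]
  have D: "fderiv (finsler \<circ> point c) z = fderiv C.potential z" if "z \<in> slit_range c" for z
    by (rule frechet_derivative_cong_open(1)[OF o that]) (rule finsler_point[OF c])
  have dy: "d_y i (finsler \<circ> point c) z = d_y i C.potential z" if "z \<in> slit_range c" for i z
    by (simp only: d_y_def D[OF that])
  have "vertical_hessian (finsler \<circ> point c) i j z = vertical_hessian C.potential i j z"
    by (rule d_y_cong[OF o z dy])
  then show "vertical_hessian (finsler \<circ> point c) i j z = tcomp h c i j z"
    using C.hessian_potential[OF z] by simp
  show "fderiv (finsler \<circ> point c) z (0, snd z) = (finsler \<circ> point c) z"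
    unfolding D[OF z] finsler_point[OF c z] by (rule C.potential_euler[OF z])
  show "(finsler \<circ> point c) (reflect_vec z) = (finsler \<circ> point c) z"
    unfolding finsler_point[OF c z] finsler_point[OF c reflect_slit_range[OF z]] by (rule C.potential_even[OF z])
  show "0 < (finsler \<circ> point c) z"
    unfolding finsler_point[OF c z]
    by (rule C.potential_pos[OF z]) (rule quasi_definiteD[OF quasi_definite_h c]; assumption)+
qed

lemma null_finsler:
  assumes c: "c \<in> A" and z: "z \<in> slit_range c"
    and "bilinear_form (\<lambda>i j. vertical_hessian (finsler \<circ> point c) i j z) v v = 0"
  shows "\<exists>a. v = a *\<^sub>R snd z"
  using quasi_definiteD(2)[OF quasi_definite_h c z] assms(3) unfolding hessian_finsler[OF c z] by blast

lemma absolutely_homogeneous_finsler: "absolutely_homogeneous A finsler"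
  unfolding absolutely_homogeneous_def
proof (intro ballI allI impI)
  fix w k assume w: "w \<in> slit A" and k: "(k::real) \<noteq> 0"
  obtain c where c: "c \<in> charts w" using slit_chart[OF w] by blast
  have cA: "c \<in> A" using charts_atD c by blast
  interpret C: closed_tensor "coord_range c" "tensor_comp A c h" by (rule closed_tensor_comp[OF cA])
  show "finsler (scale_tm k w) = \<bar>k\<bar> * finsler w"
    using finsler_eq[OF w c] finsler_eq[OF scale_slit[OF w k], of c] c
      C.potential_homogeneous[OF point_coord(2)[OF w c] k] by (simp add: coord_canonical)
qed

lemma finsler_function_finsler: "finsler_function A finsler"
proof -
  have pos: "finsler w > 0" if w: "w \<in> slit A" for w
  proof -
    obtain c where c: "c \<in> charts w" using slit_chart[OF w] by blast
    show ?thesis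
      using finsler_pos[OF charts_atD(1)[OF c] point_coord(4)[OF w c]] by (simp add: point_coord(3)[OF w c])
  qed
  have "strongly_convex A finsler"
    unfolding strongly_convex_def Let_def
  proof (intro ballI allI impI)
    fix c z and v :: "real^'n" assume c: "c \<in> A" and zr: "z \<in> coord_range (canonical A c)" and v: "v \<noteq> 0"
    then have z: "z \<in> slit_range c" by (simp add: range_canonical)
    let ?f = "finsler \<circ> point c"
    have "(\<Sum>i\<in>UNIV. d_y i ?f z * snd z $ i) = ?f z"
      using euler_finsler[OF c z]
      by (simp add: frechet_vertical[OF smooth_on_differentiable[OF smooth_fun_local[OF smooth_finsler c] z]] mult.commute)
    then show "0 < bilinear_form (\<lambda>i j. ?f z * vertical_hessian ?f i j z + d_y i ?f z * d_y j ?f z) v v"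
      using quasi_definiteD[OF quasi_definite_h c z, of v] finsler_pos[OF c z] v
      unfolding hessian_finsler[OF c z] by (intro strongly_convex_of_quasi_definite[of _ v "snd z"]) blast+
  qed
  then show ?thesis
    using pos smooth_finsler absolutely_homogeneous_finsler
    by (auto simp: finsler_function_def positively_homogeneous_def absolutely_homogeneous_def)
qed

lemma geodesic_finsler:
  assumes \<Gamma>: "spray A \<Gamma>"
    and dyn: "\<And>c z i j. c \<in> A \<Longrightarrow> z \<in> slit_range c \<Longrightarrow>
      dyn_cov_deriv (rep c \<Gamma>) (tcomp h c) i j z = 0"
    and rev: "\<And>c z. c \<in> A \<Longrightarrow> z \<in> slit_range c \<Longrightarrow>
      - reflect_vec (rep c \<Gamma> (reflect_vec z)) =
      rep c \<Gamma> z - (2 * \<mu> c z) *\<^sub>R (0, snd z)"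
  shows "\<Gamma> \<in> geodesic_class A finsler"
  unfolding geodesic_class_iff
proof (intro conjI ballI allI \<Gamma>)
  fix c z i assume c: "c \<in> A" and z: "z \<in> slit_range c"
  interpret local_spray "slit_range c" "rep c \<Gamma>" by (rule spray_local[OF \<Gamma> c])
  show "euler_lagrange (rep c \<Gamma>) (finsler \<circ> point c) i z = 0"
  proof (rule even_euler_lagrange_zero[OF refl _ smooth_fun_local[OF smooth_finsler c] euler_finsler[OF c]
      finsler_reflect[OF c] rev[OF c] _ z])
    fix z i j assume z: "z \<in> slit_range c"
    have "dyn_cov_deriv (rep c \<Gamma>) (vertical_hessian (finsler \<circ> point c)) i j z =
      dyn_cov_deriv (rep c \<Gamma>) (tcomp h c) i j z"
      by (rule dyn_cov_deriv_cong[OF open_slit_range[OF c] z]) (rule hessian_finsler[OF c])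
    then show "dyn_cov_deriv (rep c \<Gamma>) (vertical_hessian (finsler \<circ> point c)) i j z = 0"
      using dyn[OF c z] by simp
  qed (use card_n in auto)
qed

end

section \<open>Reversibility of the whole class and the even multiplier\<close>

context slit_atlas
begin

text \<open>Reversibility is given for \<open>\<Gamma>\<^sub>0\<close>, the multiplier conditions
  for \<open>\<Gamma>\<close>. Passing from one to the other by a factor Q changes the reversal
  factor P by Q at z, from the spray, and by Q at the reflected point, from its reverse.\<close>

lemma reversible_local:
  assumes \<Gamma>\<^sub>0: "spray A \<Gamma>\<^sub>0" "reversible A \<Gamma>\<^sub>0" and \<Gamma>: "\<Gamma> \<in> projective_class A \<Gamma>\<^sub>0"
  obtains \<mu> where "\<And>c. c \<in> A \<Longrightarrow> smooth_on (slit_range c) (\<mu> c)"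
    "\<And>c z. c \<in> A \<Longrightarrow> z \<in> slit_range c \<Longrightarrow> - reflect_vec (rep c \<Gamma> (reflect_vec z)) =
      rep c \<Gamma> z - (2 * \<mu> c z) *\<^sub>R (0, snd z)"
proof -
  obtain P where P: "\<And>c. c \<in> A \<Longrightarrow> smooth_on (slit_range c) (P \<circ> point c)"
    "\<And>c z. c \<in> A \<Longrightarrow> z \<in> slit_range c \<Longrightarrow>
      rep c (reverse_spray A \<Gamma>\<^sub>0) z = rep c \<Gamma>\<^sub>0 z - (2 * (P \<circ> point c) z) *\<^sub>R (0, snd z)"
    using projective_local[OF \<Gamma>\<^sub>0(2)[unfolded reversible_def]] by blast
  obtain Q where Q: "\<And>c. c \<in> A \<Longrightarrow> smooth_on (slit_range c) (Q \<circ> point c)"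
    "\<And>c z. c \<in> A \<Longrightarrow> z \<in> slit_range c \<Longrightarrow>
      rep c \<Gamma> z = rep c \<Gamma>\<^sub>0 z - (2 * (Q \<circ> point c) z) *\<^sub>R (0, snd z)"
    using projective_local[of \<Gamma>\<^sub>0 \<Gamma>] \<Gamma> by (auto simp: projective_class_def)
  let ?\<mu> = "\<lambda>c z. (P \<circ> point c) z - (Q \<circ> point c) z - (Q \<circ> point c) (reflect_vec z)"
  show ?thesis
  proof (rule that[of ?\<mu>])
    fix c assume c: "c \<in> A"
    have "smooth_on (slit_range c) (\<lambda>z. (Q \<circ> point c) (reflect_vec z))"
      by (rule smooth_on_compose[OF Q(1)[OF c] smooth_on_bounded_linear[OF bounded_linear_reflect_vec] open_slit_range[OF c]])
        (use reflect_slit_range in blast)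
    then show "smooth_on (slit_range c) (?\<mu> c)"
      by (intro smooth_on_diff P Q c open_slit_range)
    fix z assume z: "z \<in> slit_range c"
    have "- reflect_vec (rep c \<Gamma>\<^sub>0 (reflect_vec z)) =
       rep c \<Gamma>\<^sub>0 z - (2 * (P \<circ> point c) z) *\<^sub>R (0, snd z)"
      using reverse_local[OF \<Gamma>\<^sub>0(1) c z] P(2)[OF c z] by simp
    then show "- reflect_vec (rep c \<Gamma> (reflect_vec z)) =
      rep c \<Gamma> z - (2 * ?\<mu> c z) *\<^sub>R (0, snd z)"
      unfolding Q(2)[OF c z] Q(2)[OF c reflect_slit_range[OF z]]
      by (simp add: reflect_vec_def prod_eq_iff algebra_simps)
  qed
qed

definition even_tensor :: "('m, 'n) tensor02 \<Rightarrow> ('m, 'n) tensor02" where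
  "even_tensor h w c = (1 / 2) *\<^sub>R (h w c + h (reflect w) c)"

lemma even_tensor_comp:
  assumes "c \<in> A" "z \<in> slit_range c"
  shows "tcomp (even_tensor h) c i j z = even_part (tcomp h c) i j z"
  by (simp add: tensor_comp_def even_tensor_def point_reflect[OF assms])

lemma even_tensor_law:
  assumes h: "smooth_tensor02 A h" and w: "w \<in> slit A" and c: "c \<in> charts w" and d: "d \<in> charts w"
  shows "even_tensor h w c $ i $ j = (\<Sum>k\<in>UNIV. \<Sum>l\<in>UNIV. even_tensor h w d $ k $ l *
     jac c d (fst w) (axis i 1) $ k * jac c d (fst w) (axis j 1) $ l)"
proof -
  show ?thesis
    using tensor_law[OF h w c d, of i j] tensor_law[OF h reflect_slit[OF w], of c d i j] c d
    by (simp add: even_tensor_def distrib_right sum.distrib sum_divide_distrib add_divide_distrib)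
qed

lemma even_multiplier_exists:
  assumes n: "3 \<le> CARD('n)" and \<Gamma>: "spray A \<Gamma>"
    and \<mu>: "\<And>c. c \<in> A \<Longrightarrow> smooth_on (slit_range c) (\<mu> c)"
    and rev: "\<And>c z. c \<in> A \<Longrightarrow> z \<in> slit_range c \<Longrightarrow> - reflect_vec (rep c \<Gamma> (reflect_vec z)) =
      rep c \<Gamma> z - (2 * \<mu> c z) *\<^sub>R (0, snd z)"
    and tensor: "smooth_tensor02 A h" and pqd: "positive_quasi_definite A h"
    and sym: "\<And>c z i j. c \<in> A \<Longrightarrow> z \<in> slit_range c \<Longrightarrow> tcomp h c j i z = tcomp h c i j z"
    and null: "\<And>c z i. c \<in> A \<Longrightarrow> z \<in> slit_range c \<Longrightarrow> (\<Sum>j\<in>UNIV. tcomp h c i j z * snd z $ j) = 0"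
    and closed: "\<And>c z i j k. c \<in> A \<Longrightarrow> z \<in> slit_range c \<Longrightarrow>
      d_y k (tcomp h c i j) z = d_y j (tcomp h c i k) z"
    and dyn: "\<And>c z i j. c \<in> A \<Longrightarrow> z \<in> slit_range c \<Longrightarrow>
      dyn_cov_deriv (rep c \<Gamma>) (tcomp h c) i j z = 0"
  shows "even_multiplier A (even_tensor h)"
    and "c \<in> A \<Longrightarrow> z \<in> slit_range c \<Longrightarrow>
      dyn_cov_deriv (rep c \<Gamma>) (tcomp (even_tensor h) c) i j z = 0"
proof -
  have sh: "smooth_on (slit_range c) (tcomp h c i j)" if "c \<in> A" for c i j
    using tensor that by (simp add: smooth_tensor02_def range_canonical)
  have ep: "smooth_on (slit_range c) (even_part (tcomp h c) i j)"
    "(\<Sum>j\<in>UNIV. even_part (tcomp h c) i j z * snd z $ j) = 0"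
    "d_y k (even_part (tcomp h c) i j) z = d_y j (even_part (tcomp h c) i k) z"
    "dyn_cov_deriv (rep c \<Gamma>) (even_part (tcomp h c)) i j z = 0"
    if c: "c \<in> A" and z: "z \<in> slit_range c" for c z i j k
  proof -
    interpret local_spray "slit_range c" "rep c \<Gamma>" by (rule spray_local[OF \<Gamma> c])
    note ep = even_part_properties[OF refl sh[OF c] sym[OF c] null[OF c] closed[OF c] dyn[OF c] \<mu>[OF c] rev[OF c] z]
    show "smooth_on (slit_range c) (even_part (tcomp h c) i j)" by (rule ep(1))
    show "(\<Sum>j\<in>UNIV. even_part (tcomp h c) i j z * snd z $ j) = 0" by (rule ep(2))
    show "d_y k (even_part (tcomp h c) i j) z = d_y j (even_part (tcomp h c) i k) z" by (rule ep(3))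
    show "dyn_cov_deriv (rep c \<Gamma>) (even_part (tcomp h c)) i j z = 0" by (rule ep(4))
  qed
  have sme: "smooth_on (slit_range c) (tcomp (even_tensor h) c i j)" if c: "c \<in> A" for c i j
  proof (rule smooth_on_locally)
    fix z assume z: "z \<in> slit_range c"
    have "smooth_on (slit_range c) (tcomp (even_tensor h) c i j)"
      using ep(1)[OF c z] even_tensor_comp[OF c]
        smooth_on_cong[OF open_slit_range[OF c], of "tcomp (even_tensor h) c i j" "even_part (tcomp h c) i j"]
      by blast
    then show "\<exists>T. open T \<and> z \<in> T \<and> smooth_on T (tcomp (even_tensor h) c i j)"
      using z open_slit_range[OF c] by blast
  qed
  have dy: "d_y k (tcomp (even_tensor h) c i j) z = d_y k (even_part (tcomp h c) i j) z"
    if c: "c \<in> A" and z: "z \<in> slit_range c" for c z i j k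
    by (rule d_y_cong[OF open_slit_range[OF c] z]) (rule even_tensor_comp[OF c])
  show "even_multiplier A (even_tensor h)"
  proof
    show "smooth_tensor02 A (even_tensor h)"
      unfolding smooth_tensor02_def Let_def jac_def[symmetric]
      by (intro conjI ballI allI even_tensor_law tensor) (simp_all add: range_canonical sme)
    show "positive_quasi_definite A (even_tensor h)"
      unfolding positive_quasi_definite_def Let_def
    proof (intro ballI allI)
      fix c z and v :: "real^'n" assume c: "c \<in> A" and zr: "z \<in> coord_range (canonical A c)"
      then have z: "z \<in> slit_range c" by (simp add: range_canonical)
      let ?q = "\<lambda>z. bilinear_form (\<lambda>i j. tcomp h c i j z) v v"
      have q: "0 \<le> ?q z \<and> (?q z = 0 \<longrightarrow> (\<exists>a. v = a *\<^sub>R snd z))" if "z \<in> slit_range c" for z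
        using quasi_definiteD[OF pqd c that] by blast
      have eq: "bilinear_form (\<lambda>i j. tcomp (even_tensor h) c i j z) v v = (?q z + ?q (reflect_vec z)) / 2"
        unfolding even_tensor_comp[OF c z]
        by (simp add: add_divide_distrib sum_divide_distrib distrib_right sum.distrib)
      \<comment> \<open>Both summands are nonnegative, so a null vector of the average is already
        null for h at z and therefore a multiple of y.\<close>
      show "0 \<le> bilinear_form (\<lambda>i j. tcomp (even_tensor h) c i j z) v v \<and>
        (bilinear_form (\<lambda>i j. tcomp (even_tensor h) c i j z) v v = 0 \<longrightarrow> (\<exists>a. v = a *\<^sub>R snd z))"
        unfolding eq using q[OF z] q[OF reflect_slit_range[OF z]] by auto
    qed
  next
    fix c z i j k assume c: "c \<in> A" and z: "z \<in> slit_range c"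
    show "tcomp (even_tensor h) c j i z = tcomp (even_tensor h) c i j z"
      unfolding even_tensor_comp[OF c z] using sym[OF c z] sym[OF c reflect_slit_range[OF z]] by simp
    show "(\<Sum>j\<in>UNIV. tcomp (even_tensor h) c i j z * snd z $ j) = 0"
      unfolding even_tensor_comp[OF c z] by (rule ep(2)[OF c z])
    show "d_y k (tcomp (even_tensor h) c i j) z = d_y j (tcomp (even_tensor h) c i k) z"
      unfolding dy[OF c z] by (rule ep(3)[OF c z])
    show "tcomp (even_tensor h) c i j (reflect_vec z) = tcomp (even_tensor h) c i j z"
      unfolding even_tensor_comp[OF c z] even_tensor_comp[OF c reflect_slit_range[OF z]] by simp
  qed (rule n)
  assume c: "c \<in> A" and z: "z \<in> slit_range c"
  have "dyn_cov_deriv (rep c \<Gamma>) (tcomp (even_tensor h) c) i j z =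
    dyn_cov_deriv (rep c \<Gamma>) (even_part (tcomp h c)) i j z"
    by (rule dyn_cov_deriv_cong[OF open_slit_range[OF c] z]) (rule even_tensor_comp[OF c])
  then show "dyn_cov_deriv (rep c \<Gamma>) (tcomp (even_tensor h) c) i j z = 0"
    using ep(4)[OF c z] by simp
qed

end

theorem theorem4:
  fixes X :: "'m topology"
    and A :: "('m, real^'n::finite) chart set"
    and \<Gamma>\<^sub>0 \<Gamma> :: "('m, 'n) tm_field"
  assumes "smooth_manifold X A" and "paracompact_space X" and "CARD('n) \<ge> 3"
    and "spray A \<Gamma>\<^sub>0" and "reversible A \<Gamma>\<^sub>0"
    and "\<Gamma> \<in> projective_class A \<Gamma>\<^sub>0"
  shows "(\<exists>F. finsler_function A F \<and> absolutely_homogeneous A F \<and>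
            projective_class A \<Gamma>\<^sub>0 = geodesic_class A F) \<longleftrightarrow>
    (\<exists>h. smooth_tensor02 A h \<and> positive_quasi_definite A h \<and>
      (\<forall>c\<in>A. \<forall>z\<in>coord_range (canonical A c).
        let hc = tensor_comp A c h; S = field_rep (canonical A c) \<Gamma> in
        (\<forall>i j. hc j i z = hc i j z) \<and>
        (\<forall>i. (\<Sum>j\<in>UNIV. hc i j z * snd z $ j) = 0) \<and>
        (\<forall>i j k. d_y k (hc i j) z = d_y j (hc i k) z) \<and>
        (\<forall>i j. dyn_cov_deriv S hc i j z = 0) \<and>
        (\<forall>i j. (\<Sum>k\<in>UNIV. hc i k z * weyl S k j z) = (\<Sum>k\<in>UNIV. hc j k z * weyl S k i z))))"
    (is "?Finsler \<longleftrightarrow> ?Multiplier")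
proof
  interpret slit_atlas A
    using smooth_manifold_atlas[OF assms(1)] by (simp add: slit_atlas_def)
  have \<Gamma>: "spray A \<Gamma>" using assms(6) by (simp add: projective_class_def)
  {
    assume ?Finsler
    then obtain F where F: "finsler_function A F" and "\<Gamma> \<in> geodesic_class A F" using assms(6) by blast
    then have el: "euler_lagrange (rep c \<Gamma>) (F \<circ> coord_inv (canonical A c)) i z = 0"
      if "c \<in> A" "z \<in> slit_range c" for c z i
      using that unfolding geodesic_class_iff by blast
    let ?h = "\<lambda>w c. \<chi> i j. vertical_hessian (F \<circ> coord_inv (canonical A c)) i j (coord (canonical A c) w)"
    show ?Multiplier
      unfolding Let_def
    proof (intro exI conjI ballI allI)
      fix c z assume c: "c \<in> A" and "z \<in> coord_range (canonical A c)"
      then have z: "z \<in> slit_range c" by (simp add: range_canonical)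
      show "tensor_comp A c ?h j i z = tensor_comp A c ?h i j z" for i j by (rule finsler_hessian_multiplier(3)[OF F \<Gamma> el c z])
      show "(\<Sum>j\<in>UNIV. tensor_comp A c ?h i j z * snd z $ j) = 0" for i by (rule finsler_hessian_multiplier(4)[OF F \<Gamma> el c z])
      show "d_y k (tensor_comp A c ?h i j) z = d_y j (tensor_comp A c ?h i k) z" for i j k by (rule finsler_hessian_multiplier(5)[OF F \<Gamma> el c z])
      show "dyn_cov_deriv (rep c \<Gamma>) (tensor_comp A c ?h) i j z = 0" for i j by (rule finsler_hessian_multiplier(6)[OF F \<Gamma> el c z])
      show "(\<Sum>k\<in>UNIV. tensor_comp A c ?h i k z * weyl (rep c \<Gamma>) k j z) =
        (\<Sum>k\<in>UNIV. tensor_comp A c ?h j k z * weyl (rep c \<Gamma>) k i z)" for i j by (rule finsler_hessian_multiplier(7)[OF F \<Gamma> el c z])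
    next
      show "smooth_tensor02 A ?h" by (rule finsler_hessian_multiplier(1)[OF F \<Gamma> el])
      show "positive_quasi_definite A ?h" by (rule finsler_hessian_multiplier(2)[OF F \<Gamma> el])
    qed
  next
    assume ?Multiplier
    then obtain h where h: "smooth_tensor02 A h" "positive_quasi_definite A h" and
      cond: "\<forall>c\<in>A. \<forall>z\<in>coord_range (canonical A c).
        let hc = tensor_comp A c h; S = field_rep (canonical A c) \<Gamma> in
        (\<forall>i j. hc j i z = hc i j z) \<and>
        (\<forall>i. (\<Sum>j\<in>UNIV. hc i j z * snd z $ j) = 0) \<and>
        (\<forall>i j k. d_y k (hc i j) z = d_y j (hc i k) z) \<and>
        (\<forall>i j. dyn_cov_deriv S hc i j z = 0) \<and>
        (\<forall>i j. (\<Sum>k\<in>UNIV. hc i k z * weyl S k j z) = (\<Sum>k\<in>UNIV. hc j k z * weyl S k i z))"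
      by blast
    have h':
      "tensor_comp A c h j i z = tensor_comp A c h i j z"
      "(\<Sum>j\<in>UNIV. tensor_comp A c h i j z * snd z $ j) = 0"
      "d_y k (tensor_comp A c h i j) z = d_y j (tensor_comp A c h i k) z"
      "dyn_cov_deriv (rep c \<Gamma>) (tensor_comp A c h) i j z = 0"
      if c: "c \<in> A" and z: "z \<in> slit_range c" for c z i j k
      using bspec[OF bspec[OF cond c], of z] z unfolding Let_def range_canonical[OF c] by blast+
    obtain \<mu> where \<mu>: "\<And>c. c \<in> A \<Longrightarrow> smooth_on (slit_range c) (\<mu> c)"
      "\<And>c z. c \<in> A \<Longrightarrow> z \<in> slit_range c \<Longrightarrow> - reflect_vec (rep c \<Gamma> (reflect_vec z)) =
        rep c \<Gamma> z - (2 * \<mu> c z) *\<^sub>R (0, snd z)"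
      using reversible_local[OF assms(4-6)] by blast
    \<comment> \<open>The function is built from the average: the odd primitives exist for even
      tensors, and h itself may fail to be even.\<close>
    interpret even_multiplier A "even_tensor h"
      by (rule even_multiplier_exists(1)[OF assms(3) \<Gamma> \<mu> h h'])
    have "\<Gamma> \<in> geodesic_class A finsler"
    proof (rule geodesic_finsler[OF \<Gamma> _ \<mu>(2)])
      fix c z i j assume cz: "c \<in> A" "z \<in> slit_range c"
      show "dyn_cov_deriv (rep c \<Gamma>) (tensor_comp A c (even_tensor h)) i j z = 0"
        by (rule even_multiplier_exists(2)[OF assms(3) \<Gamma> \<mu> h h' cz])
    qed
    \<comment> \<open>The construction works with \<open>\<Gamma>\<close>; invariance of E_i under
      projective changes transfers the equations to \<open>\<Gamma>\<^sub>0\<close>, which generates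
      the class.\<close>
    then have el: "\<Gamma>\<^sub>0 \<in> geodesic_class A finsler"
      using geodesic_class_projective[OF smooth_finsler euler_finsler assms(4,6)] by simp
    have "projective_class A \<Gamma>\<^sub>0 = geodesic_class A finsler"
      by (rule projective_class_eq_geodesic_class[OF smooth_finsler euler_finsler null_finsler assms(4) el])
    then show ?Finsler
      using finsler_function_finsler absolutely_homogeneous_finsler by auto
  }
qed

end
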